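(* Let $d\in\mathbb N$ and let $\mathcal{P}$ be a family of distributions $P$ of $(X,Y,Z)\in\mathbb{R}\times\mathbb{R}\times\mathbb{R}^d$ satisfying the linear model $$Y=\beta_PX+\boldsymbol\gamma_P^\top Z+\zeta_P,\qquad\mathbb{E}_P(\zeta_P\mid X,Z)=0,$$ with $\beta_P\in\mathbb{R}$ and $\boldsymbol\gamma_P\in\mathbb{R}^d$. Suppose that: (a) there exist $C,\delta>0$ such that $\sup_{P\in\mathcal{P}}\max\{\mathbb{E}_P(\|Z\|_\infty^{4+\delta}),\mathbb{E}_P(|Y|^{4+\delta}),\mathbb{E}_P(|X|^{4+\delta})\}\le C$; (b) $\mathbb{E}_P(ZZ^\top)\in\mathbb{R}^{d\times d}$ is invertible and, writing $\boldsymbol\eta_P:=\mathbb{E}_P(ZZ^\top)^{-1}\mathbb{E}_P(XZ)$, $\xi_P:=X-\boldsymbol\eta_P^\top Z$, $\boldsymbol\Theta_P:=\mathbb{E}_P(ZZ^\top\xi_P^2)$ and $\boldsymbol\Sigma_P^{XZ}:=\mathbb{E}_P(WW^\top)$ with $W:=(X,Z)\in\mathbb{R}\times\mathbb{R}^{d}$, there exists $c>0$ such that $$\inf_{P\in\mathcal{P}}\min\{\mathrm{Var}_P(\zeta_P\mid X,Z),\ \mathrm{Var}_P(\xi_P),\ \lambda_{\min}(\boldsymbol\Sigma_P^{XZ}),\ \lambda_{\min}(\boldsymbol\Theta_P)\}\ge c.$$ Let $T$ be computed using Algorithm 1 (see context) but with $\hat v\equiv1$ and with ordinary least squares (OLS)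 used for all remaining regressions, and define $\mathcal{P}_1(\kappa):=\{P\in\mathcal{P}:|\beta_P|\ge\kappa/\sqrt n\}$. Then for any $\alpha\in(0,1)$, $$\lim_{\kappa\to\infty}\lim_{n\to\infty}\inf_{P\in\mathcal{P}_1(\kappa)}\mathbb{P}_P(T>z_{1-\alpha})=1.$$
   Context: Conventions: $0/0:=0$, $\mathrm{sgn}(0):=0$; $z_\alpha$ is the $\alpha$-quantile of $N(0,1)$; $\lambda_{\min}$ is the smallest eigenvalue. Algorithm 1 with $\hat v\equiv1$ and OLS: the data are $2n$ i.i.d. copies $(X_i,Y_i,Z_i)$ of $(X,Y,Z)$, and $\{1,\dots,2n\}$ is partitioned into index sets $\mathcal I_1$ and $\mathcal I_2$, each of size $n$ (e.g. $\mathcal I_1=\{1,\dots,n\}$, $\mathcal I_2=\{n+1,\dots,2n\}$); $\mathcal D_j$ denotes the observations with indices in $\mathcal I_j$. (OLS is linear regression on the stated predictors.) 1. (i) Regress $Y$ on $(X,Z)$ using $\mathcal D_2$, giving $\hat g(x,z)=\hat\beta x+\hat{\boldsymbol\gamma}^\top z$. (ii) Remove the component involving only $Z$: $\tilde g(x,z):=\hat\beta x$. (iii) Regress $\tilde g(X,Z)$ on $Z$ using $\mathcal D_2$, giving $\tilde m$; set $\tilde h(x,z):=\tilde g(x,z)-\tilde m(z)$. (iv) With $\hat\rho:=\frac1n\sum_{i\in\mathcal I_2}\{Y_i-\hat g(X_i,Z_i)+\tilde g(X_i,Z_i)-\tilde m(Z_i)\}\tilde h(X_i,Z_i)$, set $\hat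 h:=\mathrm{sgn}(\hat\rho)\tilde h$. 2. Set $\hat f:=\hat h$ (since $\hat v\equiv1$). 3. Regress $\hat f(X,Z)$ on $Z$ using $\mathcal D_1$, giving $\hat m_{\hat f}$; regress $Y$ on $Z$ using $\mathcal D_1$, giving $\hat m$. For $i\in\mathcal I_1$ let $L_i:=\{Y_i-\hat m(Z_i)\}\{\hat f(X_i,Z_i)-\hat m_{\hat f}(Z_i)\}$ and $$T:=\frac{\frac1{\sqrt n}\sum_{i\in\mathcal I_1}L_i}{\sqrt{\frac1n\sum_{i\in\mathcal I_1}L_i^2-\bigl(\frac1n\sum_{i\in\mathcal I_1}L_i\bigr)^2}}.$$
   Formalization: The inner limit over n need not exist (e.g. Gaussian X, Z, ζ with β_P ranging over 2^-k), so the formal claim is that both the liminf and the limsup over n of the worst-case power tend to 1 as κ tends to infinity; when the inner limit exists this is the stated claim. *)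

theory Defs
  imports "HOL-Probability.Probability"
begin

type_synonym 'd obs = "real \<times> real \<times> (real ^ 'd)"

definition obs_X :: "'d::finite obs \<Rightarrow> real" where
  "obs_X w = fst w"

definition obs_Y :: "'d::finite obs \<Rightarrow> real" where
  "obs_Y w = fst (snd w)"

definition obs_Z :: "'d::finite obs \<Rightarrow> real ^ 'd" where
  "obs_Z w = snd (snd w)"

definition cond_variance :: "'a measure \<Rightarrow> 'a measure \<Rightarrow> ('a \<Rightarrow> real) \<Rightarrow> 'a \<Rightarrow> real" where
  "cond_variance M F f = real_cond_exp M F (\<lambda>w. (f w - real_cond_exp M F f w)\<^sup>2)"

definition quantile :: "real measure \<Rightarrow> real \<Rightarrow> real" where
  "quantile M p = Inf {x. p \<le> cdf M x}"

definition is_eigenvalue :: "real ^ 'n ^ 'n \<Rightarrow> real \<Rightarrow> bool" where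
  "is_eigenvalue A a \<longleftrightarrow> (\<exists>v. v \<noteq> 0 \<and> A *v v = a *\<^sub>R v)"

(* Intended for symmetric A, for which a least real eigenvalue exists. *)
definition lambda_min :: "real ^ 'n ^ 'n \<Rightarrow> real" where
  "lambda_min A = (LEAST a. is_eigenvalue A a)"

definition sigma_XZ :: "'d::finite obs measure \<Rightarrow> 'd obs measure" where
  "sigma_XZ P = vimage_algebra (space P) (\<lambda>w. (obs_X w, obs_Z w)) borel"

definition noise :: "real \<Rightarrow> real ^ 'd \<Rightarrow> 'd::finite obs \<Rightarrow> real" where
  "noise b g w = obs_Y w - b * obs_X w - g \<bullet> obs_Z w"

(* Integrability is what makes the conditional expectation meaningful:
   the library constant is total. *)
definition linear_model :: "'d::finite obs measure \<Rightarrow> real \<Rightarrow> real ^ 'd \<Rightarrow> bool" where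
  "linear_model P b g \<longleftrightarrow>
     integrable P (noise b g) \<and>
     (AE w in P. real_cond_exp P (sigma_XZ P) (noise b g) w = 0)"

definition E_ZZ :: "'d::finite obs measure \<Rightarrow> real ^ 'd ^ 'd" where
  "E_ZZ P = (\<chi> i j. \<integral>w. obs_Z w $ i * obs_Z w $ j \<partial>P)"

definition E_XZ :: "'d::finite obs measure \<Rightarrow> real ^ 'd" where
  "E_XZ P = (\<chi> i. \<integral>w. obs_X w * obs_Z w $ i \<partial>P)"

definition eta :: "'d::finite obs measure \<Rightarrow> real ^ 'd" where
  "eta P = matrix_inv (E_ZZ P) *v E_XZ P"

definition xi :: "'d::finite obs measure \<Rightarrow> 'd obs \<Rightarrow> real" where
  "xi P w = obs_X w - eta P \<bullet> obs_Z w"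

definition Theta :: "'d::finite obs measure \<Rightarrow> real ^ 'd ^ 'd" where
  "Theta P = (\<chi> i j. \<integral>w. obs_Z w $ i * obs_Z w $ j * (xi P w)\<^sup>2 \<partial>P)"

(* W = (X, Z) as a vector with d + 1 entries: index None carries X, Some j carries Z_j. *)
definition obs_W :: "'d::finite obs \<Rightarrow> real ^ 'd option" where
  "obs_W w = (\<chi> i. case i of None \<Rightarrow> obs_X w | Some j \<Rightarrow> obs_Z w $ j)"

definition Sigma_XZ :: "'d::finite obs measure \<Rightarrow> real ^ 'd option ^ 'd option" where
  "Sigma_XZ P = (\<chi> i j. \<integral>w. obs_W w $ i * obs_W w $ j \<partial>P)"

definition rss :: "nat set \<Rightarrow> (nat \<Rightarrow> 'a::euclidean_space) \<Rightarrow> (nat \<Rightarrow> real) \<Rightarrow> 'a \<Rightarrow> real" where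
  "rss I W y b = (\<Sum>i\<in>I. (y i - b \<bullet> W i)\<^sup>2)"

(* When the design is collinear there is no unique least-squares fit; the coefficient is then 0. *)
definition ols :: "nat set \<Rightarrow> (nat \<Rightarrow> 'a::euclidean_space) \<Rightarrow> (nat \<Rightarrow> real) \<Rightarrow> 'a" where
  "ols I W y =
     (if \<exists>!b. is_arg_min (rss I W y) (\<lambda>_. True) b
      then THE b. is_arg_min (rss I W y) (\<lambda>_. True) b
      else 0)"

text \<open>A sample is a map \<open>S\<close> from indices to observations; \<open>I\<close> (or \<open>I1\<close>, \<open>I2\<close>) is the
  set of indices a step is allowed to use.\<close>

definition regress_on_Z ::
    "nat set \<Rightarrow> (nat \<Rightarrow> 'd::finite obs) \<Rightarrow> (nat \<Rightarrow> real) \<Rightarrow> real ^ 'd \<Rightarrow> real" where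
  "regress_on_Z I S y z = ols I (\<lambda>i. obs_Z (S i)) y \<bullet> z"

definition coef_hat :: "nat set \<Rightarrow> (nat \<Rightarrow> 'd::finite obs) \<Rightarrow> real \<times> (real ^ 'd)" where
  "coef_hat I S = ols I (\<lambda>i. (obs_X (S i), obs_Z (S i))) (\<lambda>i. obs_Y (S i))"

definition g_hat :: "nat set \<Rightarrow> (nat \<Rightarrow> 'd::finite obs) \<Rightarrow> real \<Rightarrow> real ^ 'd \<Rightarrow> real" where
  "g_hat I S x z = fst (coef_hat I S) * x + snd (coef_hat I S) \<bullet> z"

definition g_tilde :: "nat set \<Rightarrow> (nat \<Rightarrow> 'd::finite obs) \<Rightarrow> real \<Rightarrow> real ^ 'd \<Rightarrow> real" where
  "g_tilde I S x z = fst (coef_hat I S) * x"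

definition m_tilde :: "nat set \<Rightarrow> (nat \<Rightarrow> 'd::finite obs) \<Rightarrow> real ^ 'd \<Rightarrow> real" where
  "m_tilde I S = regress_on_Z I S (\<lambda>i. g_tilde I S (obs_X (S i)) (obs_Z (S i)))"

definition h_tilde :: "nat set \<Rightarrow> (nat \<Rightarrow> 'd::finite obs) \<Rightarrow> real \<Rightarrow> real ^ 'd \<Rightarrow> real" where
  "h_tilde I S x z = g_tilde I S x z - m_tilde I S z"

definition rho_hat :: "nat set \<Rightarrow> (nat \<Rightarrow> 'd::finite obs) \<Rightarrow> real" where
  "rho_hat I S =
     (1 / real (card I)) *
     (\<Sum>i\<in>I. (obs_Y (S i) - g_hat I S (obs_X (S i)) (obs_Z (S i))
              + g_tilde I S (obs_X (S i)) (obs_Z (S i)) - m_tilde I S (obs_Z (S i)))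
            * h_tilde I S (obs_X (S i)) (obs_Z (S i)))"

definition f_hat :: "nat set \<Rightarrow> (nat \<Rightarrow> 'd::finite obs) \<Rightarrow> real \<Rightarrow> real ^ 'd \<Rightarrow> real" where
  "f_hat I S x z = sgn (rho_hat I S) * h_tilde I S x z"

definition m_f_hat ::
    "nat set \<Rightarrow> nat set \<Rightarrow> (nat \<Rightarrow> 'd::finite obs) \<Rightarrow> real ^ 'd \<Rightarrow> real" where
  "m_f_hat I1 I2 S = regress_on_Z I1 S (\<lambda>i. f_hat I2 S (obs_X (S i)) (obs_Z (S i)))"

definition m_hat :: "nat set \<Rightarrow> (nat \<Rightarrow> 'd::finite obs) \<Rightarrow> real ^ 'd \<Rightarrow> real" where
  "m_hat I S = regress_on_Z I S (\<lambda>i. obs_Y (S i))"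

definition L_stat :: "nat set \<Rightarrow> nat set \<Rightarrow> (nat \<Rightarrow> 'd::finite obs) \<Rightarrow> nat \<Rightarrow> real" where
  "L_stat I1 I2 S i =
     (obs_Y (S i) - m_hat I1 S (obs_Z (S i))) *
     (f_hat I2 S (obs_X (S i)) (obs_Z (S i)) - m_f_hat I1 I2 S (obs_Z (S i)))"

definition T_stat :: "nat set \<Rightarrow> nat set \<Rightarrow> (nat \<Rightarrow> 'd::finite obs) \<Rightarrow> real" where
  "T_stat I1 I2 S =
     (let n = real (card I1) in
      ((1 / sqrt n) * (\<Sum>i\<in>I1. L_stat I1 I2 S i)) /
      sqrt ((1 / n) * (\<Sum>i\<in>I1. (L_stat I1 I2 S i)\<^sup>2)
            - ((1 / n) * (\<Sum>i\<in>I1. L_stat I1 I2 S i))\<^sup>2))"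

definition alternatives ::
    "'d::finite obs measure set \<Rightarrow> ('d obs measure \<Rightarrow> real) \<Rightarrow> nat \<Rightarrow> real \<Rightarrow> 'd obs measure set" where
  "alternatives \<P>s \<beta> n \<kappa> = {P \<in> \<P>s. \<bar>\<beta> P\<bar> \<ge> \<kappa> / sqrt (real n)}"

(* The infimum is taken in [0,1], so that it is 1 over an empty set of alternatives;
   over a nonempty set the cap at 1 has no effect. *)
definition worst_power ::
    "'d::finite obs measure set \<Rightarrow> nat set \<Rightarrow> nat set \<Rightarrow> nat \<Rightarrow> real \<Rightarrow> ereal" where
  "worst_power \<A> I1 I2 n \<alpha> =
     min 1 (INF P\<in>\<A>. ereal (\<P>(S in PiM {1..2 * n} (\<lambda>_. P).
       T_stat I1 I2 S > quantile std_normal_distribution (1 - \<alpha>))))"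

end

theory Submission
  imports Defs
begin

text \<open>
  On each half of the sample the Gram matrix of \<open>(X, Z)\<close> is uniformly well conditioned with high
  probability. There the algorithm collapses: \<open>rho_hat\<close> is the mean square of \<open>h_tilde\<close>, hence
  positive, and \<open>f_hat\<close> minus its regression on \<open>Z\<close> is the coefficient \<open>\<beta>_hat\<close> from the second half
  times the residual of \<open>X\<close> on \<open>Z\<close> in the first half. So \<open>T\<close> is \<open>sgn \<beta>_hat\<close> times a studentised mean
  of products of residuals of \<open>Y\<close> and \<open>X\<close>, and that mean is at least \<open>\<bar>\<beta>\<bar> c / 2\<close> up to a term of
  order \<open>1 / sqrt n\<close>; the sign is correct for the same reason.

  The studentising variance is bounded above by fourth moments. It must also be nonzero, since
  \<open>x / 0 = 0\<close>: otherwise all products would coincide, while their average absolute deviation is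
  close to that of \<open>(\<zeta> + \<beta> \<xi>) \<xi>\<close>, which is bounded below because its variance is at least
  \<open>E (\<zeta>\<^sup>2 \<xi>\<^sup>2) \<ge> c\<^sup>2\<close> and its moment of order \<open>2 + \<delta> / 2\<close> is bounded. All averages are
  controlled by Chebyshev's and Markov's inequalities, so every estimate is uniform in \<open>P\<close>.
\<close>

text \<open>Two obstacles shape the estimates. First, Chebyshev's inequality for the sample variance
  of the products of residuals would need eight moments of an observation, while little more than
  four are given. The variance is therefore only shown to be nonzero, through an average absolute
  deviation whose summands do have a bounded second moment; for its upper bound Markov's inequality
  suffices. Second, |\<beta>| may be as small as \<kappa> / sqrt n, so the averages of noise times
  predictors must be controlled on that scale. They get a tolerance T0 / sqrt n, at which the
  failure probability does not decay in n but is small for large T0; \<kappa> is then taken large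
  compared with T0. All other averages get a fixed tolerance \<epsilon>, and their failure
  probability is of order 1 / n. Measurability is a genuine obligation: \<open>measure\<close> is 0
  on nonmeasurable sets, so a lower bound for the probability of a large statistic presupposes that
  least-squares coefficients, defined through \<open>THE\<close>, are measurable in the
  data.\<close>

definition avg :: "nat set \<Rightarrow> (nat \<Rightarrow> real) \<Rightarrow> real" where
  "avg J f = (\<Sum>i\<in>J. f i) / real (card J)"

lemma avg_mono: "(\<And>i. i \<in> J \<Longrightarrow> f i \<le> g i) \<Longrightarrow> avg J f \<le> avg J g"
  unfolding avg_def by (intro divide_right_mono sum_mono) auto

lemma avg_cong: "(\<And>i. i \<in> J \<Longrightarrow> f i = g i) \<Longrightarrow> avg J f = avg J g"
  unfolding avg_def by (intro arg_cong2[where f = "(/)"] sum.cong) auto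

lemma avg_add: "avg J (\<lambda>i. f i + g i) = avg J f + avg J g"
  unfolding avg_def by (simp add: sum.distrib add_divide_distrib)

lemma avg_diff: "avg J (\<lambda>i. f i - g i) = avg J f - avg J g"
  unfolding avg_def by (simp add: sum_subtractf diff_divide_distrib)

lemma avg_cmult: "avg J (\<lambda>i. a * f i) = a * avg J f"
  unfolding avg_def by (simp add: sum_distrib_left)

lemma avg_const: "finite J \<Longrightarrow> J \<noteq> {} \<Longrightarrow> avg J (\<lambda>_. a) = a"
  unfolding avg_def by simp

lemma avg_sum: "avg J (\<lambda>i. \<Sum>u\<in>B. f u i) = (\<Sum>u\<in>B. avg J (f u))"
  unfolding avg_def by (subst sum.swap) (simp add: sum_divide_distrib)

lemma avg_abs: "\<bar>avg J f\<bar> \<le> avg J (\<lambda>i. \<bar>f i\<bar>)"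
  unfolding avg_def by (simp add: abs_divide divide_right_mono)

lemma avg_nonneg: "(\<And>i. i \<in> J \<Longrightarrow> 0 \<le> f i) \<Longrightarrow> 0 \<le> avg J f"
  unfolding avg_def by (simp add: sum_nonneg)

text \<open>Turns the studentising variance into a mean of squares: it is nonnegative, and it
  vanishes only when all summands agree.\<close>

lemma avg_centered_square:
  assumes "finite J" "J \<noteq> {}"
  shows "avg J (\<lambda>i. (f i - avg J f)\<^sup>2) = avg J (\<lambda>i. (f i)\<^sup>2) - (avg J f)\<^sup>2"
proof -
  have "avg J (\<lambda>i. (f i - avg J f)\<^sup>2)
      = avg J (\<lambda>i. (f i)\<^sup>2 - ((2 * avg J f) * f i - (avg J f)\<^sup>2))"
    by (intro avg_cong) (simp add: power2_diff)
  also have "\<dots> = avg J (\<lambda>i. (f i)\<^sup>2) - (avg J f)\<^sup>2"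
    using assms by (simp add: avg_diff avg_cmult avg_const power2_eq_square[of "avg J f"])
  finally show ?thesis .
qed

section \<open>Averages of independent observations\<close>

lemma PiM_component_integral:
  fixes f :: "'a \<Rightarrow> real"
  assumes "prob_space P" "i \<in> I" "integrable P f"
  shows "integrable (PiM I (\<lambda>_. P)) (\<lambda>S. f (S i))"
    and "(\<integral>S. f (S i) \<partial>PiM I (\<lambda>_. P)) = integral\<^sup>L P f"
proof -
  have D: "distr (PiM I (\<lambda>_. P)) P (\<lambda>S. S i) = P"
    using assms by (intro distr_PiM_component) auto
  have m: "(\<lambda>S. S i) \<in> measurable (PiM I (\<lambda>_. P)) P"
    using assms(2) by (rule measurable_component_singleton)
  have f: "f \<in> borel_measurable P"
    using assms(3) by simp
  show "integrable (PiM I (\<lambda>_. P)) (\<lambda>S. f (S i))"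
    using integrable_distr_eq[OF m f] assms(3) D by simp
  show "(\<integral>S. f (S i) \<partial>PiM I (\<lambda>_. P)) = integral\<^sup>L P f"
    using integral_distr[OF m f] D by simp
qed

text \<open>Fubini for a product over all of \<open>I\<close>: the coordinates other than
  \<open>i\<close> and \<open>j\<close> carry the constant factor 1, whose integral is 1 under a
  probability measure.\<close>

lemma PiM_pair_integral:
  fixes f h :: "'a \<Rightarrow> real"
  assumes P: "prob_space P" and I: "finite I" and ij: "i \<in> I" "j \<in> I" "i \<noteq> j"
    and f: "integrable P f" and h: "integrable P h"
  shows "integrable (PiM I (\<lambda>_. P)) (\<lambda>S. f (S i) * h (S j))"
    and "(\<integral>S. f (S i) * h (S j) \<partial>PiM I (\<lambda>_. P)) = integral\<^sup>L P f * integral\<^sup>L P h"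
proof -
  interpret P: prob_space P by fact
  interpret PS: product_sigma_finite "\<lambda>_. P" by standard
  define F where "F k = (if k = i then f else if k = j then h else (\<lambda>_. 1))" for k
  have F: "integrable P (F k)" for k
    using f h by (simp add: F_def)
  have I': "I = insert i (insert j (I - {i, j}))"
    using ij by auto
  \<comment> \<open>\<open>G\<close> is generic because the splitting is used twice: with evaluation
    at \<open>S k\<close> and with integration against \<open>P\<close>.\<close>
  have prod: "(\<Prod>k\<in>I. G (F k) k) = G f i * G h j * (\<Prod>k\<in>I - {i, j}. G (\<lambda>_. 1) k)"
    for G :: "('a \<Rightarrow> real) \<Rightarrow> _ \<Rightarrow> real"
  proof -
    have "(\<Prod>k\<in>I. G (F k) k) = (\<Prod>k\<in>insert i (insert j (I - {i, j})). G (F k) k)"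
      using I' by metis
    also have "\<dots> = G f i * (G h j * (\<Prod>k\<in>I - {i, j}. G (F k) k))"
      using ij I by (subst prod.insert, simp, simp, subst prod.insert) (auto simp: F_def)
    also have "(\<Prod>k\<in>I - {i, j}. G (F k) k) = (\<Prod>k\<in>I - {i, j}. G (\<lambda>_. 1) k)"
      by (intro prod.cong) (auto simp: F_def)
    finally show ?thesis by simp
  qed
  have eq: "(\<Prod>k\<in>I. F k (S k)) = f (S i) * h (S j)" for S
    using prod[of "\<lambda>a k. a (S k)"] by simp
  show "integrable (PiM I (\<lambda>_. P)) (\<lambda>S. f (S i) * h (S j))"
    using PS.product_integrable_prod[of I F, OF I F] by (simp add: eq)
  show "(\<integral>S. f (S i) * h (S j) \<partial>PiM I (\<lambda>_. P)) = integral\<^sup>L P f * integral\<^sup>L P h"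
    using PS.product_integral_prod[of I F, OF I F] prod[of "\<lambda>a k. integral\<^sup>L P a"]
    by (simp add: eq P.prob_space)
qed

text \<open>After expanding the square, independence and the zero mean kill the off-diagonal
  terms.\<close>

lemma sum_square_integral:
  fixes g :: "'a \<Rightarrow> real"
  assumes P: "prob_space P" and I: "finite I" and J: "J \<subseteq> I"
    and g: "integrable P g" and g2: "integrable P (\<lambda>w. (g w)\<^sup>2)" and mean: "integral\<^sup>L P g = 0"
  shows "integrable (PiM I (\<lambda>_. P)) (\<lambda>S. (\<Sum>i\<in>J. g (S i))\<^sup>2)"
    and "(\<integral>S. (\<Sum>i\<in>J. g (S i))\<^sup>2 \<partial>PiM I (\<lambda>_. P)) = real (card J) * (\<integral>w. (g w)\<^sup>2 \<partial>P)"
proof -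
  let ?M = "PiM I (\<lambda>_. P)"
  have sq: "(\<Sum>i\<in>J. g (S i))\<^sup>2 = (\<Sum>i\<in>J. \<Sum>j\<in>J. g (S i) * g (S j))" for S
    by (simp add: power2_eq_square sum_product)
  have int: "integrable ?M (\<lambda>S. g (S i) * g (S j))" if "i \<in> J" "j \<in> J" for i j
  proof (cases "i = j")
    case True
    then show ?thesis
      using PiM_component_integral(1)[OF P _ g2, of i I] that J by (auto simp: power2_eq_square)
  next
    case False
    then show ?thesis
      using PiM_pair_integral(1)[OF P I _ _ _ g g] that J by auto
  qed
  have val: "(\<integral>S. g (S i) * g (S j) \<partial>?M) = (if i = j then \<integral>w. (g w)\<^sup>2 \<partial>P else 0)"
    if "i \<in> J" "j \<in> J" for i j
  proof (cases "i = j")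
    case True
    then show ?thesis
      using PiM_component_integral(2)[OF P _ g2, of i I] that J by (auto simp: power2_eq_square)
  next
    case False
    then show ?thesis
      using PiM_pair_integral(2)[OF P I _ _ _ g g] that J mean by auto
  qed
  show "integrable ?M (\<lambda>S. (\<Sum>i\<in>J. g (S i))\<^sup>2)"
    unfolding sq using int by (intro Bochner_Integration.integrable_sum)
  have "(\<integral>S. (\<Sum>i\<in>J. g (S i))\<^sup>2 \<partial>?M) = (\<Sum>i\<in>J. \<Sum>j\<in>J. \<integral>S. g (S i) * g (S j) \<partial>?M)"
    unfolding sq using int by (simp add: Bochner_Integration.integral_sum)
  also have "\<dots> = (\<Sum>i\<in>J. \<Sum>j\<in>J. if i = j then \<integral>w. (g w)\<^sup>2 \<partial>P else 0)"
    using val by (intro sum.cong) auto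
  also have "\<dots> = real (card J) * (\<integral>w. (g w)\<^sup>2 \<partial>P)"
    using finite_subset[OF J I] by simp
  finally show "(\<integral>S. (\<Sum>i\<in>J. g (S i))\<^sup>2 \<partial>?M) = real (card J) * (\<integral>w. (g w)\<^sup>2 \<partial>P)" .
qed

lemma avg_PiM_measurable:
  fixes g :: "'a \<Rightarrow> real"
  assumes "J \<subseteq> I" "g \<in> borel_measurable P"
  shows "(\<lambda>S. avg J (\<lambda>i. g (S i))) \<in> borel_measurable (PiM I (\<lambda>_. P))"
proof -
  have "(\<lambda>S. g (S i)) \<in> borel_measurable (PiM I (\<lambda>_. P))" if "i \<in> J" for i
    using that assms by (auto intro!: measurable_compose[of "\<lambda>S. S i" _ P g] measurable_component_singleton)
  then show ?thesis
    unfolding avg_def by measurable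
qed

text \<open>Chebyshev's inequality. Centring only lowers the second moment, so \<open>B\<close> also
  bounds the variance of one summand, and the average has variance at most
  \<open>B / card J\<close>.\<close>

lemma avg_deviation_prob:
  fixes g :: "'a \<Rightarrow> real"
  assumes P: "prob_space P" and I: "finite I" and J: "J \<subseteq> I" "J \<noteq> {}"
    and g: "g \<in> borel_measurable P" and g2: "integrable P (\<lambda>w. (g w)\<^sup>2)"
    and B: "(\<integral>w. (g w)\<^sup>2 \<partial>P) \<le> B" and t: "t > 0"
  shows "measure (PiM I (\<lambda>_. P)) {S \<in> space (PiM I (\<lambda>_. P)).
      \<not> \<bar>avg J (\<lambda>i. g (S i)) - integral\<^sup>L P g\<bar> < t} \<le> B / (real (card J) * t\<^sup>2)"
proof -
  interpret P: prob_space P by fact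
  let ?M = "PiM I (\<lambda>_. P)"
  interpret M: prob_space ?M by (intro prob_space_PiM P)
  have fJ: "finite J" using J I finite_subset by auto
  let ?n = "real (card J)"
  have n: "?n > 0" using J fJ by (simp add: card_gt_0_iff)
  have gi: "integrable P g"
    using g g2 by (rule P.square_integrable_imp_integrable)
  define m where "m = integral\<^sup>L P g"
  define h where "h w = g w - m" for w
  have h: "integrable P h" unfolding h_def using gi by simp
  have h2: "integrable P (\<lambda>w. (h w)\<^sup>2)"
    unfolding h_def power2_diff using gi g2 by simp
  have h0: "integral\<^sup>L P h = 0"
    unfolding h_def using gi by (simp add: m_def P.prob_space)
  have hB: "(\<integral>w. (h w)\<^sup>2 \<partial>P) \<le> B"
  proof -
    have "(\<integral>w. (h w)\<^sup>2 \<partial>P) = (\<integral>w. (g w)\<^sup>2 \<partial>P) - m\<^sup>2"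
      unfolding h_def m_def using P.variance_eq[OF gi g2] by simp
    then show ?thesis using B by (smt (verit) zero_le_power2)
  qed
  let ?A = "\<lambda>S. avg J (\<lambda>i. g (S i)) - m"
  have A: "?A S = (\<Sum>i\<in>J. h (S i)) / ?n" for S
    using n by (simp add: avg_def h_def sum_subtractf diff_divide_distrib)
  have A2: "(?A S)\<^sup>2 = (1 / ?n\<^sup>2) * (\<Sum>i\<in>J. h (S i))\<^sup>2" for S
    by (simp add: A power_divide)
  note SI = sum_square_integral[OF P I J(1) h h2 h0]
  have meas: "?A \<in> borel_measurable ?M"
    using avg_PiM_measurable[OF J(1) g] by measurable
  have "M.prob {S \<in> space ?M. t \<le> \<bar>?A S\<bar>} \<le> (\<integral>S. (?A S)\<^sup>2 \<partial>?M) / t\<^sup>2"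
    using SI(1) by (intro M.second_moment_method meas t) (unfold A2, simp)
  also have "(\<integral>S. (?A S)\<^sup>2 \<partial>?M) = (1 / ?n\<^sup>2) * (?n * (\<integral>w. (h w)\<^sup>2 \<partial>P))"
    unfolding A2 using SI(2) by simp
  also have "\<dots> / t\<^sup>2 \<le> (1 / ?n\<^sup>2) * (?n * B) / t\<^sup>2"
    using hB n by (intro divide_right_mono mult_left_mono) auto
  also have "\<dots> = B / (?n * t\<^sup>2)"
    using n by (simp add: power2_eq_square)
  finally show ?thesis
    by (simp add: m_def not_less)
qed

text \<open>For the fourth power of the envelope, whose square need not be integrable, so that
  Chebyshev's inequality does not apply.\<close>

lemma avg_Markov:
  fixes g :: "'a \<Rightarrow> real"
  assumes P: "prob_space P" and I: "finite I" and J: "J \<subseteq> I" "J \<noteq> {}"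
    and g: "integrable P g" and nonneg: "\<And>w. 0 \<le> g w"
    and B: "integral\<^sup>L P g \<le> B" and t: "t > 0"
  shows "measure (PiM I (\<lambda>_. P)) {S \<in> space (PiM I (\<lambda>_. P)). \<not> avg J (\<lambda>i. g (S i)) < t} \<le> B / t"
proof -
  let ?M = "PiM I (\<lambda>_. P)"
  interpret M: prob_space ?M by (intro prob_space_PiM P)
  have fJ: "finite J" using J I finite_subset by auto
  have n: "real (card J) > 0" using J fJ by (simp add: card_gt_0_iff)
  have gi: "integrable ?M (\<lambda>S. g (S i))" if "i \<in> J" for i
    using that J by (intro PiM_component_integral(1)[OF P _ g]) auto
  have int: "integrable ?M (\<lambda>S. avg J (\<lambda>i. g (S i)))"
    unfolding avg_def using gi by (intro integrable_divide Bochner_Integration.integrable_sum)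
  have "(\<integral>S. avg J (\<lambda>i. g (S i)) \<partial>?M) = (\<Sum>i\<in>J. \<integral>S. g (S i) \<partial>?M) / real (card J)"
    unfolding avg_def using gi by (simp add: Bochner_Integration.integral_sum)
  also have "(\<Sum>i\<in>J. \<integral>S. g (S i) \<partial>?M) = (\<Sum>i\<in>J. integral\<^sup>L P g)"
    using J by (intro sum.cong refl PiM_component_integral(2)[OF P _ g]) auto
  also have "\<dots> / real (card J) = integral\<^sup>L P g"
    using n by simp
  finally have E: "(\<integral>S. avg J (\<lambda>i. g (S i)) \<partial>?M) = integral\<^sup>L P g" .
  have "M.prob {S \<in> space ?M. t \<le> avg J (\<lambda>i. g (S i))} \<le> (\<integral>S. avg J (\<lambda>i. g (S i)) \<partial>?M) / t"
    using nonneg by (intro integral_Markov_inequality_measure[OF int _ _ t, where A = "{}"])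
      (auto intro!: avg_nonneg)
  also have "\<dots> \<le> B / t" unfolding E using B t by (intro divide_right_mono) auto
  finally show ?thesis by (simp add: not_less)
qed

section \<open>Least squares\<close>

text \<open>Pythagoras: the normal equations \<open>ne\<close> annihilate the cross term.\<close>

lemma rss_expand:
  assumes "finite J" and ne: "\<And>v. (\<Sum>i\<in>J. (y i - b \<bullet> W i) * (v \<bullet> W i)) = 0"
  shows "rss J W y a = rss J W y b + (\<Sum>i\<in>J. ((a - b) \<bullet> W i)\<^sup>2)"
proof -
  have "rss J W y a = (\<Sum>i\<in>J. (y i - b \<bullet> W i)\<^sup>2 + ((a - b) \<bullet> W i)\<^sup>2
      - 2 * ((y i - b \<bullet> W i) * ((a - b) \<bullet> W i)))"
    unfolding rss_def by (intro sum.cong) (auto simp: inner_diff_left power2_eq_square algebra_simps)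
  also have "\<dots> = rss J W y b + (\<Sum>i\<in>J. ((a - b) \<bullet> W i)\<^sup>2)
      - 2 * (\<Sum>i\<in>J. (y i - b \<bullet> W i) * ((a - b) \<bullet> W i))"
    by (simp add: rss_def sum.distrib sum_subtractf sum_distrib_left)
  finally show ?thesis using ne by simp
qed

text \<open>Positive definiteness of the Gram matrix. For finite \<open>J\<close> it separates the
  designs with a unique least-squares fit from those where \<open>ols\<close> takes its default
  value.\<close>

definition posdef_design :: "nat set \<Rightarrow> (nat \<Rightarrow> 'a::euclidean_space) \<Rightarrow> bool" where
  "posdef_design J W \<longleftrightarrow> (\<forall>v. v \<noteq> 0 \<longrightarrow> 0 < (\<Sum>i\<in>J. (v \<bullet> W i)\<^sup>2))"

lemma ols_eqI:
  fixes W :: "nat \<Rightarrow> 'a::euclidean_space"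
  assumes J: "finite J" and pd: "posdef_design J W"
    and ne: "\<And>v. (\<Sum>i\<in>J. (y i - b \<bullet> W i) * (v \<bullet> W i)) = 0"
  shows "ols J W y = b"
proof -
  have lt: "rss J W y b < rss J W y a" if "a \<noteq> b" for a
    using pd that rss_expand[OF J ne, of a] by (auto simp: posdef_design_def)
  have am: "is_arg_min (rss J W y) (\<lambda>_. True) a \<longleftrightarrow> a = b" for a
    unfolding is_arg_min_def using lt by (metis order_less_asym order_less_irrefl)
  show ?thesis
    unfolding ols_def am by simp
qed

text \<open>Positive definiteness makes the Gram operator injective, hence surjective in finite
  dimension.\<close>

lemma normal_equations_solvable:
  fixes W :: "nat \<Rightarrow> 'a::euclidean_space"
  assumes J: "finite J" and pd: "posdef_design J W"
  shows "\<exists>b. \<forall>v. (\<Sum>i\<in>J. (y i - b \<bullet> W i) * (v \<bullet> W i)) = 0"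
proof -
  define G where "G b = (\<Sum>i\<in>J. (b \<bullet> W i) *\<^sub>R W i)" for b
  have lin: "linear G"
    unfolding G_def by (intro linearI)
      (simp_all add: inner_add_left scaleR_add_left sum.distrib scaleR_sum_right)
  have Gv: "v \<bullet> G b = (\<Sum>i\<in>J. (b \<bullet> W i) * (v \<bullet> W i))" for v b
    by (simp add: G_def inner_sum_right)
  have "b = 0" if "G b = 0" for b
  proof (rule ccontr)
    assume "b \<noteq> 0"
    then have "0 < b \<bullet> G b"
      using pd by (simp add: Gv posdef_design_def power2_eq_square)
    then show False using that by simp
  qed
  then have "inj G" using lin by (simp add: linear_injective_0)
  then have "surj G" using linear_injective_imp_surjective[OF lin] by blast
  then obtain b where b: "G b = (\<Sum>i\<in>J. y i *\<^sub>R W i)" by (metis surjD)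
  have "(\<Sum>i\<in>J. (y i - b \<bullet> W i) * (v \<bullet> W i)) = 0" for v
  proof -
    have "(\<Sum>i\<in>J. y i * (v \<bullet> W i)) = v \<bullet> G b"
      unfolding b by (simp add: inner_sum_right)
    then show ?thesis
      by (simp add: Gv left_diff_distrib sum_subtractf)
  qed
  then show ?thesis by blast
qed

lemma ols_normal_equations:
  fixes W :: "nat \<Rightarrow> 'a::euclidean_space"
  assumes "finite J" "posdef_design J W"
  shows "(\<Sum>i\<in>J. (y i - ols J W y \<bullet> W i) * (v \<bullet> W i)) = 0"
  using normal_equations_solvable[OF assms, of y] ols_eqI[OF assms, of y] by metis

text \<open>Translation along a null vector of the Gram form leaves the residual sum of squares
  unchanged, so a minimiser is never unique and the default 0 applies.\<close>

lemma ols_not_posdef: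
  fixes W :: "nat \<Rightarrow> 'a::euclidean_space"
  assumes J: "finite J" and pd: "\<not> posdef_design J W"
  shows "ols J W y = 0"
proof -
  obtain v where v: "v \<noteq> 0" "\<not> 0 < (\<Sum>i\<in>J. (v \<bullet> W i)\<^sup>2)"
    using pd by (auto simp: posdef_design_def)
  have "(\<Sum>i\<in>J. (v \<bullet> W i)\<^sup>2) = 0"
    using v(2) sum_nonneg[of J "\<lambda>i. (v \<bullet> W i)\<^sup>2"] by auto
  then have "\<forall>i\<in>J. v \<bullet> W i = 0"
    using J by (simp add: sum_nonneg_eq_0_iff)
  then have "rss J W y (b + v) = rss J W y b" for b
    unfolding rss_def by (intro sum.cong) (auto simp: inner_add_left)
  then have "is_arg_min (rss J W y) (\<lambda>_. True) (b + v)" if "is_arg_min (rss J W y) (\<lambda>_. True) b" for b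
    using that by (simp add: is_arg_min_def)
  then have "\<not> (\<exists>!b. is_arg_min (rss J W y) (\<lambda>_. True) b)"
    using v(1) by (metis add_cancel_right_right)
  then show ?thesis by (simp add: ols_def)
qed

lemma posdef_designI:
  fixes W :: "nat \<Rightarrow> 'a::euclidean_space"
  assumes "k > 0" "\<And>v. k * (norm v)\<^sup>2 \<le> avg J (\<lambda>i. (v \<bullet> W i)\<^sup>2)"
  shows "posdef_design J W"
  unfolding posdef_design_def
proof (intro allI impI)
  fix v :: 'a assume "v \<noteq> 0"
  then have "0 < avg J (\<lambda>i. (v \<bullet> W i)\<^sup>2)"
    using assms(1) assms(2)[of v] by (smt (verit) zero_less_mult_iff zero_less_norm_iff zero_less_power)
  then show "0 < (\<Sum>i\<in>J. (v \<bullet> W i)\<^sup>2)"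
    by (simp add: avg_def zero_less_divide_iff)
qed

text \<open>With \<open>d\<close> the estimation error, the normal equations equate the mean of
  \<open>(d \<bullet> W i)\<^sup>2\<close> with the mean of the residuals of \<open>b\<close> times
  \<open>d \<bullet> W i\<close>. The former is at least \<open>k\<close> times the squared norm of
  \<open>d\<close>, the latter at most \<open>DIM('a) * t\<close> times its norm.\<close>

lemma ols_deviation:
  fixes W :: "nat \<Rightarrow> 'a::euclidean_space"
  assumes J: "finite J" and k: "k > 0" "\<And>v. k * (norm v)\<^sup>2 \<le> avg J (\<lambda>i. (v \<bullet> W i)\<^sup>2)"
    and t: "\<And>u. u \<in> Basis \<Longrightarrow> \<bar>avg J (\<lambda>i. (y i - b \<bullet> W i) * (u \<bullet> W i))\<bar> \<le> t"
  shows "norm (ols J W y - b) \<le> real DIM('a) * t / k"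
proof -
  define d where "d = ols J W y - b"
  have pd: "posdef_design J W" using k by (rule posdef_designI)
  have ne: "avg J (\<lambda>i. (y i - ols J W y \<bullet> W i) * (d \<bullet> W i)) = 0"
    using ols_normal_equations[OF J pd] by (simp add: avg_def)
  have "avg J (\<lambda>i. (d \<bullet> W i)\<^sup>2) = avg J (\<lambda>i. (y i - b \<bullet> W i) * (d \<bullet> W i)
      - (y i - ols J W y \<bullet> W i) * (d \<bullet> W i))"
    by (intro avg_cong) (simp add: d_def inner_diff_left power2_eq_square algebra_simps)
  also have "\<dots> = avg J (\<lambda>i. (y i - b \<bullet> W i) * (d \<bullet> W i))"
    by (simp add: avg_diff ne)
  also have "\<dots> = avg J (\<lambda>i. \<Sum>u\<in>Basis. (d \<bullet> u) * ((y i - b \<bullet> W i) * (u \<bullet> W i)))"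
  proof (intro avg_cong)
    fix i
    have "d \<bullet> W i = (\<Sum>u\<in>Basis. (d \<bullet> u) * (W i \<bullet> u))" by (rule euclidean_inner)
    then show "(y i - b \<bullet> W i) * (d \<bullet> W i) = (\<Sum>u\<in>Basis. (d \<bullet> u) * ((y i - b \<bullet> W i) * (u \<bullet> W i)))"
      by (simp add: sum_distrib_left algebra_simps inner_commute)
  qed
  also have "\<dots> = (\<Sum>u\<in>Basis. (d \<bullet> u) * avg J (\<lambda>i. (y i - b \<bullet> W i) * (u \<bullet> W i)))"
    by (simp add: avg_sum avg_cmult)
  also have "\<dots> \<le> (\<Sum>u\<in>(Basis::'a set). norm d * t)"
  proof (intro sum_mono)
    fix u :: 'a assume u: "u \<in> Basis"
    have "(d \<bullet> u) * avg J (\<lambda>i. (y i - b \<bullet> W i) * (u \<bullet> W i))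
        \<le> \<bar>d \<bullet> u\<bar> * \<bar>avg J (\<lambda>i. (y i - b \<bullet> W i) * (u \<bullet> W i))\<bar>"
      by (subst abs_mult[symmetric]) (rule abs_ge_self)
    also have "\<dots> \<le> norm d * t"
      using u t by (intro mult_mono Basis_le_norm) auto
    finally show "(d \<bullet> u) * avg J (\<lambda>i. (y i - b \<bullet> W i) * (u \<bullet> W i)) \<le> norm d * t" .
  qed
  finally have "k * (norm d)\<^sup>2 \<le> real DIM('a) * (norm d * t)"
    using k(2)[of d] by (simp add: order_trans)
  then have "norm d * (k * norm d) \<le> norm d * (real DIM('a) * t)"
    by (simp add: power2_eq_square algebra_simps)
  moreover have "0 \<le> t"
    using t[OF SOME_Basis] by (meson abs_ge_zero order_trans)
  ultimately have "k * norm d \<le> real DIM('a) * t"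
    by (cases "d = 0") auto
  then show ?thesis
    using k(1) by (simp add: d_def field_simps)
qed

text \<open>An entrywise error \<open>t\<close> moves the quadratic form by at most \<open>t\<close>
  times the squared dimension times the squared norm of \<open>b\<close>; hypothesis
  \<open>t\<close> lets this cost at most half of \<open>c\<close>.\<close>

lemma gram_lower_bound:
  fixes W :: "nat \<Rightarrow> 'a::euclidean_space" and G :: "'a \<Rightarrow> 'a \<Rightarrow> real"
  assumes close: "\<And>u v. u \<in> Basis \<Longrightarrow> v \<in> Basis \<Longrightarrow>
      \<bar>avg J (\<lambda>i. (u \<bullet> W i) * (v \<bullet> W i)) - G u v\<bar> \<le> t"
    and G: "\<And>b. c * (norm b)\<^sup>2 \<le> (\<Sum>u\<in>Basis. \<Sum>v\<in>Basis. (b \<bullet> u) * (b \<bullet> v) * G u v)"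
    and t: "t * (real DIM('a))\<^sup>2 \<le> c / 2"
  shows "(c / 2) * (norm b)\<^sup>2 \<le> avg J (\<lambda>i. (b \<bullet> W i)\<^sup>2)"
proof -
  let ?A = "\<lambda>u v. avg J (\<lambda>i. (u \<bullet> W i) * (v \<bullet> W i))"
  have "avg J (\<lambda>i. (b \<bullet> W i)\<^sup>2)
      = avg J (\<lambda>i. \<Sum>u\<in>Basis. \<Sum>v\<in>Basis. (b \<bullet> u) * (b \<bullet> v) * ((u \<bullet> W i) * (v \<bullet> W i)))"
  proof (intro avg_cong)
    fix i
    have "b \<bullet> W i = (\<Sum>u\<in>Basis. (b \<bullet> u) * (u \<bullet> W i))"
      by (subst euclidean_inner) (simp add: inner_commute)
    then show "(b \<bullet> W i)\<^sup>2 = (\<Sum>u\<in>Basis. \<Sum>v\<in>Basis. (b \<bullet> u) * (b \<bullet> v) * ((u \<bullet> W i) * (v \<bullet> W i)))"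
      by (simp add: power2_eq_square sum_product algebra_simps)
  qed
  also have "\<dots> = (\<Sum>u\<in>Basis. \<Sum>v\<in>Basis. (b \<bullet> u) * (b \<bullet> v) * ?A u v)"
    by (simp add: avg_sum avg_cmult)
  finally have A: "avg J (\<lambda>i. (b \<bullet> W i)\<^sup>2) = (\<Sum>u\<in>Basis. \<Sum>v\<in>Basis. (b \<bullet> u) * (b \<bullet> v) * ?A u v)" .
  have t0: "0 \<le> t"
    using close[OF SOME_Basis SOME_Basis] by (meson abs_ge_zero order_trans)
  have "(\<Sum>u\<in>Basis. \<Sum>v\<in>Basis. (b \<bullet> u) * (b \<bullet> v) * G u v) - avg J (\<lambda>i. (b \<bullet> W i)\<^sup>2)
      = (\<Sum>u\<in>Basis. \<Sum>v\<in>Basis. (b \<bullet> u) * (b \<bullet> v) * (G u v - ?A u v))"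
    unfolding A by (simp add: sum_subtractf right_diff_distrib)
  also have "\<dots> \<le> (\<Sum>u\<in>(Basis::'a set). \<Sum>v\<in>(Basis::'a set). norm b * norm b * t)"
  proof (intro sum_mono)
    fix u v :: 'a assume uv: "u \<in> Basis" "v \<in> Basis"
    have "(b \<bullet> u) * (b \<bullet> v) * (G u v - ?A u v) \<le> \<bar>b \<bullet> u\<bar> * \<bar>b \<bullet> v\<bar> * \<bar>G u v - ?A u v\<bar>"
      by (simp only: abs_mult[symmetric] abs_ge_self)
    also have "\<dots> \<le> norm b * norm b * t"
      using uv close[OF uv] by (intro mult_mono Basis_le_norm) (auto simp: abs_minus_commute)
    finally show "(b \<bullet> u) * (b \<bullet> v) * (G u v - ?A u v) \<le> norm b * norm b * t" .
  qed
  also have "\<dots> = (t * (real DIM('a))\<^sup>2) * (norm b)\<^sup>2"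
    by (simp add: power2_eq_square)
  also have "\<dots> \<le> (c / 2) * (norm b)\<^sup>2"
    using t by (intro mult_right_mono) auto
  finally show ?thesis using G[of b] by simp
qed

section \<open>Measurability of the least-squares coefficient\<close>

text \<open>Compactness of the unit sphere, followed by homogeneity.\<close>

lemma posdef_design_bound:
  fixes W :: "nat \<Rightarrow> 'a::euclidean_space"
  assumes pd: "posdef_design J W"
  obtains k where "k > 0" "\<And>v. k * (norm v)\<^sup>2 \<le> (\<Sum>i\<in>J. (v \<bullet> W i)\<^sup>2)"
proof -
  let ?q = "\<lambda>v. \<Sum>i\<in>J. (v \<bullet> W i)\<^sup>2"
  have "compact (sphere (0::'a) 1)" "sphere (0::'a) 1 \<noteq> {}"
    by (auto intro: exI[of _ "SOME u. u \<in> Basis"] simp: SOME_Basis)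
  moreover have "continuous_on (sphere 0 1) ?q"
    by (intro continuous_intros)
  ultimately obtain v0 where v0: "v0 \<in> sphere 0 1" "\<And>v. v \<in> sphere 0 1 \<Longrightarrow> ?q v0 \<le> ?q v"
    using continuous_attains_inf[of "sphere 0 1" ?q] by blast
  have "?q v0 * (norm v)\<^sup>2 \<le> ?q v" for v
  proof (cases "v = 0")
    case False
    have "?q v0 \<le> ?q ((1 / norm v) *\<^sub>R v)"
      using False by (intro v0(2)) simp
    also have "\<dots> = ?q v / (norm v)\<^sup>2"
      by (simp add: power_divide sum_divide_distrib)
    finally show ?thesis using False by (simp add: field_simps)
  qed simp
  moreover have "?q v0 > 0"
    
  proof -
    have "v0 \<noteq> 0" using v0(1) by auto
    then show ?thesis using pd by (simp add: posdef_design_def)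
  qed
  ultimately show ?thesis using that by blast
qed

text \<open>Replaces the quantifier over all vectors by countable ones once \<open>D\<close> is
  countable, as measurability requires. The quantitative bound with \<open>Suc m\<close> is
  essential: plain positivity on a dense set would not pass to limits.\<close>

lemma posdef_design_iff_dense:
  fixes W :: "nat \<Rightarrow> 'a::euclidean_space"
  assumes dense: "\<And>X::'a set. open X \<Longrightarrow> X \<noteq> {} \<Longrightarrow> \<exists>d\<in>D. d \<in> X"
  shows "posdef_design J W \<longleftrightarrow> (\<exists>m::nat. \<forall>v\<in>D. (norm v)\<^sup>2 / real (Suc m) \<le> (\<Sum>i\<in>J. (v \<bullet> W i)\<^sup>2))"
proof
  assume "posdef_design J W"
  then obtain k where k: "k > 0" "\<And>v. k * (norm v)\<^sup>2 \<le> (\<Sum>i\<in>J. (v \<bullet> W i)\<^sup>2)"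
    using posdef_design_bound by blast
  obtain m :: nat where m: "inverse (real (Suc m)) < k"
    using k(1) reals_Archimedean by blast
  have "(norm v)\<^sup>2 / real (Suc m) \<le> (\<Sum>i\<in>J. (v \<bullet> W i)\<^sup>2)" for v
  proof -
    have "(norm v)\<^sup>2 / real (Suc m) \<le> k * (norm v)\<^sup>2"
      using m by (simp add: divide_inverse mult.commute[of "(norm v)\<^sup>2"] mult_right_mono del: of_nat_Suc)
    then show ?thesis using k(2)[of v] by linarith
  qed
  then show "\<exists>m::nat. \<forall>v\<in>D. (norm v)\<^sup>2 / real (Suc m) \<le> (\<Sum>i\<in>J. (v \<bullet> W i)\<^sup>2)" by blast
next
  assume "\<exists>m::nat. \<forall>v\<in>D. (norm v)\<^sup>2 / real (Suc m) \<le> (\<Sum>i\<in>J. (v \<bullet> W i)\<^sup>2)"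
  then obtain m :: nat where m: "\<And>v. v \<in> D \<Longrightarrow> (norm v)\<^sup>2 / real (Suc m) \<le> (\<Sum>i\<in>J. (v \<bullet> W i)\<^sup>2)"
    by blast
  \<comment> \<open>The vectors violating the bound form an open set, which would meet
    \<open>D\<close> if it were nonempty.\<close>
  let ?B = "{v. (\<Sum>i\<in>J. (v \<bullet> W i)\<^sup>2) < (norm v)\<^sup>2 / real (Suc m)}"
  have "open ?B"
    by (intro open_Collect_less continuous_intros) auto
  then have B: "?B = {}"
    using dense[of ?B] m by force
  show "posdef_design J W"
    unfolding posdef_design_def
  proof (intro allI impI)
    fix v :: 'a assume "v \<noteq> 0"
    then have "0 < (norm v)\<^sup>2 / real (Suc m)" by simp
    also have "\<dots> \<le> (\<Sum>i\<in>J. (v \<bullet> W i)\<^sup>2)" using B by (force simp: not_less)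
    finally show "0 < (\<Sum>i\<in>J. (v \<bullet> W i)\<^sup>2)" .
  qed
qed

text \<open>Gradient iteration for half the residual sum of squares. Each iterate is an explicit
  expression in the data, hence measurable. The step is the inverse of 1 plus the trace of the Gram
  operator: the trace dominates its largest eigenvalue, and the 1 covers a zero design.\<close>

primrec gradient_descent :: "nat set \<Rightarrow> (nat \<Rightarrow> 'a::euclidean_space) \<Rightarrow> (nat \<Rightarrow> real) \<Rightarrow> nat \<Rightarrow> 'a" where
  "gradient_descent J W y 0 = 0"
| "gradient_descent J W y (Suc m) = gradient_descent J W y m +
     (1 / (1 + (\<Sum>i\<in>J. (norm (W i))\<^sup>2))) *\<^sub>R
       (\<Sum>i\<in>J. (y i - gradient_descent J W y m \<bullet> W i) *\<^sub>R W i)"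

text \<open>The error evolves by \<open>d (Suc m) = d m - s *\<^sub>R G (d m)\<close>. By
  Cauchy-Schwarz the squared norm of \<open>G v\<close> is at most
  \<open>tr * (v \<bullet> G v)\<close>, and \<open>s * tr \<le> 1\<close>, so each step contracts
  the squared error.\<close>

lemma gradient_descent_LIMSEQ:
  fixes W :: "nat \<Rightarrow> 'a::euclidean_space"
  assumes J: "finite J" and pd: "posdef_design J W"
  shows "gradient_descent J W y \<longlonglongrightarrow> ols J W y"
proof -
  obtain k where k: "k > 0" "\<And>v. k * (norm v)\<^sup>2 \<le> (\<Sum>i\<in>J. (v \<bullet> W i)\<^sup>2)"
    using posdef_design_bound[OF pd] by blast
  define tr where "tr = (\<Sum>i\<in>J. (norm (W i))\<^sup>2)"
  have tr: "tr \<ge> 0" unfolding tr_def by (simp add: sum_nonneg)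
  define s where "s = 1 / (1 + tr)"
  have s: "s > 0" "s * tr \<le> 1" using tr by (auto simp: s_def)
  define b where "b = ols J W y"
  define d where "d m = gradient_descent J W y m - b" for m
  define G where "G v = (\<Sum>i\<in>J. (v \<bullet> W i) *\<^sub>R W i)" for v
  have nb: "(\<Sum>i\<in>J. (y i - b \<bullet> W i) *\<^sub>R W i) = 0"
  proof -
    have "v \<bullet> (\<Sum>i\<in>J. (y i - b \<bullet> W i) *\<^sub>R W i) = 0" for v
      using ols_normal_equations[OF J pd, of y v] by (simp add: inner_sum_right b_def)
    then show ?thesis by (metis inner_eq_zero_iff)
  qed
  have step: "d (Suc m) = d m - s *\<^sub>R G (d m)" for m
  proof -
    have "(\<Sum>i\<in>J. (y i - gradient_descent J W y m \<bullet> W i) *\<^sub>R W i)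
        = (\<Sum>i\<in>J. (y i - b \<bullet> W i) *\<^sub>R W i) - G (d m)"
      by (simp add: G_def d_def inner_diff_left algebra_simps sum_subtractf sum.distrib)
    then show ?thesis by (simp add: nb d_def s_def tr_def)
  qed
  have Gq: "v \<bullet> G v = (\<Sum>i\<in>J. (v \<bullet> W i)\<^sup>2)" for v
    by (simp add: G_def inner_sum_right power2_eq_square)
  have Gn: "(norm (G v))\<^sup>2 \<le> tr * (v \<bullet> G v)" for v
  proof -
    have "norm (G v) \<le> (\<Sum>i\<in>J. \<bar>v \<bullet> W i\<bar> * norm (W i))"
      unfolding G_def by (rule order_trans[OF norm_sum]) simp
    then have "(norm (G v))\<^sup>2 \<le> (\<Sum>i\<in>J. \<bar>v \<bullet> W i\<bar> * norm (W i))\<^sup>2"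
      by (intro power_mono) auto
    also have "\<dots> \<le> (\<Sum>i\<in>J. \<bar>v \<bullet> W i\<bar>\<^sup>2) * (\<Sum>i\<in>J. (norm (W i))\<^sup>2)"
      by (rule Cauchy_Schwarz_ineq_sum)
    finally show ?thesis by (simp add: Gq tr_def mult.commute)
  qed
  \<comment> \<open>The maximum with 0 makes \<theta> nonnegative without a proof that
    \<open>s * k\<close> is at most 1.\<close>
  define \<theta> where "\<theta> = max 0 (1 - s * k)"
  have \<theta>: "0 \<le> \<theta>" "\<theta> < 1" using s k by (auto simp: \<theta>_def)
  have contr: "(norm (d (Suc m)))\<^sup>2 \<le> \<theta> * (norm (d m))\<^sup>2" for m
  proof -
    let ?v = "d m"
    have "(norm (d (Suc m)))\<^sup>2 = (norm ?v)\<^sup>2 - 2 * s * (?v \<bullet> G ?v) + s\<^sup>2 * (norm (G ?v))\<^sup>2"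
      unfolding step by (simp add: power2_norm_eq_inner inner_diff_left inner_diff_right inner_commute)
        (simp add: power2_eq_square algebra_simps)
    also have "\<dots> \<le> (norm ?v)\<^sup>2 - 2 * s * (?v \<bullet> G ?v) + s\<^sup>2 * (tr * (?v \<bullet> G ?v))"
      using Gn by (intro add_left_mono mult_left_mono) auto
    also have "s\<^sup>2 * (tr * (?v \<bullet> G ?v)) = (s * tr) * (s * (?v \<bullet> G ?v))"
      by (simp add: power2_eq_square)
    also have "(s * tr) * (s * (?v \<bullet> G ?v)) \<le> 1 * (s * (?v \<bullet> G ?v))"
      using s by (intro mult_right_mono) (auto simp: Gq sum_nonneg)
    also have "(norm ?v)\<^sup>2 - 2 * s * (?v \<bullet> G ?v) + 1 * (s * (?v \<bullet> G ?v)) = (norm ?v)\<^sup>2 - s * (?v \<bullet> G ?v)"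
      by simp
    also have "\<dots> \<le> (norm ?v)\<^sup>2 - s * (k * (norm ?v)\<^sup>2)"
      using k(2)[of ?v] s(1) by (simp add: Gq)
    also have "\<dots> = (1 - s * k) * (norm ?v)\<^sup>2" by (simp add: algebra_simps)
    also have "\<dots> \<le> \<theta> * (norm ?v)\<^sup>2"
      unfolding \<theta>_def by (intro mult_right_mono) auto
    finally show ?thesis by simp
  qed
  have "(norm (d m))\<^sup>2 \<le> \<theta> ^ m * (norm (d 0))\<^sup>2" for m
  proof (induction m)
    case (Suc m)
    have "(norm (d (Suc m)))\<^sup>2 \<le> \<theta> * (norm (d m))\<^sup>2" by (rule contr)
    also have "\<dots> \<le> \<theta> * (\<theta> ^ m * (norm (d 0))\<^sup>2)"
      using Suc \<theta> by (intro mult_left_mono) auto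
    finally show ?case by simp
  qed simp
  moreover have "(\<lambda>m. \<theta> ^ m * (norm (d 0))\<^sup>2) \<longlonglongrightarrow> 0"
    using \<theta> by (intro tendsto_mult_left_zero LIMSEQ_power_zero) auto
  ultimately have "(\<lambda>m. (norm (d m))\<^sup>2) \<longlonglongrightarrow> 0"
    by (intro real_tendsto_sandwich[of "\<lambda>_. 0" "\<lambda>m. (norm (d m))\<^sup>2" sequentially
        "\<lambda>m. \<theta> ^ m * (norm (d 0))\<^sup>2" 0] always_eventually allI) simp_all
  then have "(\<lambda>m. norm (d m)) \<longlonglongrightarrow> 0"
    using tendsto_real_sqrt[of "\<lambda>m. (norm (d m))\<^sup>2" 0 sequentially] by simp
  then have "d \<longlonglongrightarrow> 0" by (rule tendsto_norm_zero_cancel)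
  then show ?thesis
    unfolding d_def b_def by (rule LIM_zero_cancel)
qed

text \<open>\<open>ols\<close> is a pointwise limit of measurable maps: gradient descent on the
  measurable event of a positive definite design, and 0 elsewhere, which matches the default in its
  definition.\<close>

lemma ols_measurable:
  fixes W :: "nat \<Rightarrow> 's \<Rightarrow> 'a::euclidean_space"
  assumes J: "finite J"
    and W: "\<And>i. i \<in> J \<Longrightarrow> W i \<in> borel_measurable M"
    and y: "\<And>i. i \<in> J \<Longrightarrow> y i \<in> borel_measurable M"
  shows "(\<lambda>S. ols J (\<lambda>i. W i S) (\<lambda>i. y i S)) \<in> borel_measurable M"
proof -
  obtain D :: "'a set" where D: "countable D" "\<And>X. open X \<Longrightarrow> X \<noteq> {} \<Longrightarrow> \<exists>d\<in>D. d \<in> X"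
    by (rule countable_dense_setE) auto
  have gd: "(\<lambda>S. gradient_descent J (\<lambda>i. W i S) (\<lambda>i. y i S) m) \<in> borel_measurable M" for m
  proof (induction m)
    case (Suc m)
    note [measurable] = Suc
    have [measurable]: "(\<lambda>S. \<Sum>i\<in>J. (norm (W i S))\<^sup>2) \<in> borel_measurable M"
      using W by (intro borel_measurable_sum) measurable
    have [measurable]: "(\<lambda>S. \<Sum>i\<in>J. (y i S - gradient_descent J (\<lambda>i. W i S) (\<lambda>i. y i S) m \<bullet> W i S) *\<^sub>R W i S)
        \<in> borel_measurable M"
    proof (intro borel_measurable_sum)
      fix i assume "i \<in> J"
      note [measurable] = W[OF this] y[OF this]
      show "(\<lambda>S. (y i S - gradient_descent J (\<lambda>i. W i S) (\<lambda>i. y i S) m \<bullet> W i S) *\<^sub>R W i S)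
        \<in> borel_measurable M" by measurable
    qed
    show ?case by simp
  qed simp
  have q: "(\<lambda>S. \<Sum>i\<in>J. (v \<bullet> W i S)\<^sup>2) \<in> borel_measurable M" for v
    using W by (intro borel_measurable_sum) measurable
  have pd_iff: "posdef_design J V \<longleftrightarrow> (\<exists>m::nat. \<forall>v\<in>D. (norm v)\<^sup>2 / real (Suc m) \<le> (\<Sum>i\<in>J. (v \<bullet> V i)\<^sup>2))"
    for V by (rule posdef_design_iff_dense) (rule D(2))
  have pd: "Measurable.pred M (\<lambda>S. posdef_design J (\<lambda>i. W i S))"
    unfolding pd_iff
  proof (intro pred_intros_countable(2) measurable_pred_countable(1)[OF D(1)])
    fix m v
    note [measurable] = q[of v]
    show "Measurable.pred M (\<lambda>S. (norm v)\<^sup>2 / real (Suc m) \<le> (\<Sum>i\<in>J. (v \<bullet> W i S)\<^sup>2))"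
      by measurable
  qed
  have "(\<lambda>S. lim (\<lambda>m. if posdef_design J (\<lambda>i. W i S)
      then gradient_descent J (\<lambda>i. W i S) (\<lambda>i. y i S) m else 0)) \<in> borel_measurable M"
    using gd pd by (intro borel_measurable_lim_metric measurable_If) auto
  also have "(\<lambda>S. lim (\<lambda>m. if posdef_design J (\<lambda>i. W i S)
      then gradient_descent J (\<lambda>i. W i S) (\<lambda>i. y i S) m else 0))
      = (\<lambda>S. ols J (\<lambda>i. W i S) (\<lambda>i. y i S))"
  proof
    fix S
    show "lim (\<lambda>m. if posdef_design J (\<lambda>i. W i S)
      then gradient_descent J (\<lambda>i. W i S) (\<lambda>i. y i S) m else 0) = ols J (\<lambda>i. W i S) (\<lambda>i. y i S)"
    proof (cases "posdef_design J (\<lambda>i. W i S)")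
      case True
      then show ?thesis using gradient_descent_LIMSEQ[OF J True] by (simp add: limI)
    next
      case False
      then show ?thesis using ols_not_posdef[OF J False] by (simp add: lim_const)
    qed
  qed
  finally show ?thesis .
qed

section \<open>The least eigenvalue\<close>

text \<open>\<open>lambda_min\<close> is a \<open>LEAST\<close>, so a least eigenvalue must be
  exhibited before anything can be said about it. It is the minimum \<mu> of the quadratic form on
  the unit sphere, and the minimiser is an eigenvector by a variational argument.\<close>

lemma Rayleigh_lower_bound:
  fixes A :: "real ^ 'n ^ 'n"
  assumes sym: "transpose A = A" and c: "c \<le> lambda_min A"
  shows "c * (norm v)\<^sup>2 \<le> v \<bullet> (A *v v)"
proof -
  let ?q = "\<lambda>v. v \<bullet> (A *v v)"
  have bil: "x \<bullet> (A *v y) = y \<bullet> (A *v x)" for x y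
    using dot_lmul_matrix[of x A y] sym by (metis inner_commute transpose_matrix_vector)
  have "compact (sphere (0::real^'n) 1)" "sphere (0::real^'n) 1 \<noteq> {}"
    by auto
  moreover have "continuous_on (sphere 0 1) ?q"
    by (intro continuous_intros linear_continuous_on matrix_vector_mul_bounded_linear)
  ultimately obtain v0 where v0: "v0 \<in> sphere 0 1" "\<And>v. v \<in> sphere 0 1 \<Longrightarrow> ?q v0 \<le> ?q v"
    using continuous_attains_inf[of "sphere 0 1" ?q] by blast
  define \<mu> where "\<mu> = ?q v0"
  have low: "\<mu> * (norm v)\<^sup>2 \<le> ?q v" for v
  proof (cases "v = 0")
    case False
    have "\<mu> \<le> ?q ((1 / norm v) *\<^sub>R v)"
      unfolding \<mu>_def using False by (intro v0(2)) simp
    also have "\<dots> = ?q v / (norm v)\<^sup>2"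
      by (simp add: matrix_vector_mult_scaleR power2_eq_square)
    finally show ?thesis using False by (simp add: field_simps)
  qed simp
  have n0: "norm v0 = 1" using v0(1) by simp
  define r where "r = A *v v0 - \<mu> *\<^sub>R v0"
  define p where "p = ?q r - \<mu> * (norm r)\<^sup>2"
  have p: "p \<ge> 0" using low[of r] by (simp add: p_def)
  \<comment> \<open>The form \<open>?q v - \<mu> * (norm v)\<^sup>2\<close> is nonnegative and
    vanishes at \<open>v0\<close>; this is its value at \<open>v0 + t *\<^sub>R r\<close>, and its
    linear term forces \<open>r = 0\<close>.\<close>
  have quad: "0 \<le> 2 * t * (norm r)\<^sup>2 + t\<^sup>2 * p" for t
  proof -
    have "?q (v0 + t *\<^sub>R r) = \<mu> + 2 * t * (r \<bullet> (A *v v0)) + t\<^sup>2 * ?q r"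
      unfolding \<mu>_def
      by (simp add: matrix_vector_right_distrib matrix_vector_mult_scaleR inner_add_left
          inner_add_right bil[of v0 r] power2_eq_square algebra_simps)
    moreover have "(norm (v0 + t *\<^sub>R r))\<^sup>2 = 1 + 2 * t * (r \<bullet> v0) + t\<^sup>2 * (norm r)\<^sup>2"
      using n0 by (simp add: power2_norm_eq_inner inner_add_left inner_add_right inner_commute)
        (simp add: power2_norm_eq_inner[symmetric] power2_eq_square algebra_simps)
    moreover have "r \<bullet> (A *v v0) - \<mu> * (r \<bullet> v0) = (norm r)\<^sup>2"
      by (subst power2_norm_eq_inner, subst (4) r_def) (simp add: inner_diff_right)
    ultimately show ?thesis
      using low[of "v0 + t *\<^sub>R r"] by (simp add: p_def algebra_simps)
  qed
  have "norm r = 0"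
  proof (rule ccontr)
    assume "norm r \<noteq> 0"
    then have R: "(norm r)\<^sup>2 > 0" by simp
    \<comment> \<open>The best \<open>t\<close> would be minus the squared norm over
      \<open>p\<close>; dividing by \<open>p + 1\<close> also covers \<open>p = 0\<close>.\<close>
    have q1: "0 \<le> 2 * (- ((norm r)\<^sup>2 / (p + 1))) * (norm r)\<^sup>2 + ((norm r)\<^sup>2 / (p + 1))\<^sup>2 * p"
      using quad[of "- ((norm r)\<^sup>2 / (p + 1))"] by simp
    have "((norm r)\<^sup>2 / (p + 1))\<^sup>2 * p = ((norm r)\<^sup>2 / (p + 1)) * (norm r)\<^sup>2 * (p / (p + 1))"
      by (simp add: power2_eq_square)
    also have "\<dots> \<le> ((norm r)\<^sup>2 / (p + 1)) * (norm r)\<^sup>2 * 1"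
      using p by (intro mult_left_mono) auto
    finally have "((norm r)\<^sup>2 / (p + 1)) * (norm r)\<^sup>2 \<le> 0" using q1 by argo
    moreover have "((norm r)\<^sup>2 / (p + 1)) * (norm r)\<^sup>2 > 0"
      using R p by (intro mult_pos_pos divide_pos_pos) auto
    ultimately show False by simp
  qed
  then have ev: "is_eigenvalue A \<mu>"
    unfolding is_eigenvalue_def r_def using n0 by (intro exI[of _ v0]) auto
  have "lambda_min A = \<mu>"
    unfolding lambda_min_def
  proof (rule Least_equality, rule ev)
    fix a assume "is_eigenvalue A a"
    then obtain v where v: "v \<noteq> 0" "A *v v = a *\<^sub>R v" by (auto simp: is_eigenvalue_def)
    have "\<mu> * (norm v)\<^sup>2 \<le> a * (norm v)\<^sup>2"
      using low[of v] v by (simp add: power2_norm_eq_inner)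
    then show "\<mu> \<le> a" using v(1) by simp
  qed
  then have "c * (norm v)\<^sup>2 \<le> \<mu> * (norm v)\<^sup>2"
    using c by (intro mult_right_mono) auto
  then show ?thesis using low[of v] by linarith
qed

section \<open>The test statistic\<close>

lemma obs_measurable [measurable]:
  "obs_X \<in> borel_measurable borel" "obs_Y \<in> borel_measurable borel" "obs_Z \<in> borel_measurable borel"
  unfolding obs_X_def obs_Y_def obs_Z_def
  by (intro borel_measurable_continuous_onI continuous_intros)+

text \<open>The vector \<open>obs_W\<close> in the product type that \<open>coef_hat\<close>
  regresses on; \<open>gram_of_lambda_min\<close> translates between the two.\<close>

definition design :: "'d::finite obs \<Rightarrow> real \<times> (real ^ 'd)" where
  "design w = (obs_X w, obs_Z w)"

lemma design_measurable [measurable]: "design \<in> borel_measurable borel"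
  unfolding design_def obs_X_def obs_Z_def by (intro borel_measurable_continuous_onI continuous_intros)

text \<open>Allows the power to be computed as 1 minus the probability of the complementary event.
  The proof follows the algorithm, each regression being an instance of
  \<open>ols_measurable\<close>.\<close>

lemma T_stat_measurable:
  fixes P :: "'d::finite obs measure"
  assumes P: "sets P = sets borel" and fin: "finite I1" "finite I2" and K: "I1 \<subseteq> K" "I2 \<subseteq> K"
  shows "T_stat I1 I2 \<in> borel_measurable (PiM K (\<lambda>_. P))"
proof -
  let ?M = "PiM K (\<lambda>_. P)"
  have comp: "(\<lambda>S. f (S i)) \<in> borel_measurable ?M"
    if "i \<in> I1 \<union> I2" "f \<in> borel_measurable borel" for i and f :: "'d obs \<Rightarrow> 'z::topological_space"
  proof (rule measurable_compose[of "\<lambda>S. S i" _ P])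
    show "(\<lambda>S. S i) \<in> measurable ?M P"
      using that K by (intro measurable_component_singleton) auto
    show "f \<in> borel_measurable P"
      using that(2) P by (simp cong: measurable_cong_sets)
  qed
  have X: "(\<lambda>S. obs_X (S i)) \<in> borel_measurable ?M" and Y: "(\<lambda>S. obs_Y (S i)) \<in> borel_measurable ?M"
    and Z: "(\<lambda>S. obs_Z (S i)) \<in> borel_measurable ?M" and D: "(\<lambda>S. design (S i)) \<in> borel_measurable ?M"
    if "i \<in> I1 \<union> I2" for i
    using that by (auto intro!: comp)
  have coef: "(\<lambda>S. coef_hat I2 S) \<in> borel_measurable ?M"
    unfolding coef_hat_def design_def[symmetric] using D Y fin by (intro ols_measurable) auto
  have fst_meas: "(\<lambda>S. fst (coef_hat I2 S)) \<in> borel_measurable ?M"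
    by (rule measurable_compose[OF coef]) (intro borel_measurable_continuous_onI continuous_intros)
  have snd_meas: "(\<lambda>S. snd (coef_hat I2 S)) \<in> borel_measurable ?M"
    by (rule measurable_compose[OF coef]) (intro borel_measurable_continuous_onI continuous_intros)
  have g_hat_meas: "(\<lambda>S. g_hat I2 S (obs_X (S i)) (obs_Z (S i))) \<in> borel_measurable ?M" if "i \<in> I1 \<union> I2" for i
    unfolding g_hat_def using X[OF that] Z[OF that] fst_meas snd_meas by measurable
  have g_tilde_meas: "(\<lambda>S. g_tilde I2 S (obs_X (S i)) (obs_Z (S i))) \<in> borel_measurable ?M" if "i \<in> I1 \<union> I2" for i
    unfolding g_tilde_def using X[OF that] fst_meas by measurable
  have m_tilde_meas: "(\<lambda>S. m_tilde I2 S (obs_Z (S i))) \<in> borel_measurable ?M" if "i \<in> I1 \<union> I2" for i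
    unfolding m_tilde_def regress_on_Z_def using g_tilde_meas Z fin that
    by (intro borel_measurable_inner ols_measurable) auto
  have h_tilde_meas: "(\<lambda>S. h_tilde I2 S (obs_X (S i)) (obs_Z (S i))) \<in> borel_measurable ?M" if "i \<in> I1 \<union> I2" for i
    unfolding h_tilde_def using g_tilde_meas[OF that] m_tilde_meas[OF that] by measurable
  have rho_meas: "(\<lambda>S. rho_hat I2 S) \<in> borel_measurable ?M"
    unfolding rho_hat_def using Y g_hat_meas g_tilde_meas m_tilde_meas h_tilde_meas
    by (intro borel_measurable_times borel_measurable_sum borel_measurable_add borel_measurable_diff) auto
  have f_meas: "(\<lambda>S. f_hat I2 S (obs_X (S i)) (obs_Z (S i))) \<in> borel_measurable ?M" if "i \<in> I1 \<union> I2" for i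
    unfolding f_hat_def using rho_meas h_tilde_meas[OF that]
    by (intro borel_measurable_times measurable_compose[OF rho_meas borel_measurable_sgn]) auto
  have L_meas: "(\<lambda>S. L_stat I1 I2 S i) \<in> borel_measurable ?M" if "i \<in> I1" for i
    unfolding L_stat_def m_hat_def m_f_hat_def regress_on_Z_def using Y Z f_meas fin that
    by (intro borel_measurable_times borel_measurable_diff borel_measurable_inner ols_measurable) auto
  have [measurable]: "(\<lambda>S. \<Sum>i\<in>I1. L_stat I1 I2 S i) \<in> borel_measurable ?M"
    "(\<lambda>S. \<Sum>i\<in>I1. (L_stat I1 I2 S i)\<^sup>2) \<in> borel_measurable ?M"
    using L_meas by (auto intro!: borel_measurable_sum borel_measurable_power)
  have "(\<lambda>S. T_stat I1 I2 S) \<in> borel_measurable ?M"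
    unfolding T_stat_def Let_def by measurable
  then show ?thesis by simp
qed

section \<open>Algebraic form of the statistic\<close>

lemma posdef_design_Z:
  assumes "posdef_design J (\<lambda>i. design (S i))"
  shows "posdef_design J (\<lambda>i. obs_Z (S i))"
  unfolding posdef_design_def
proof (intro allI impI)
  fix v :: "real ^ 'a" assume "v \<noteq> 0"
  then have "(0 :: real, v) \<noteq> 0" by (simp add: zero_prod_def)
  then show "0 < (\<Sum>i\<in>J. (v \<bullet> obs_Z (S i))\<^sup>2)"
    using assms unfolding posdef_design_def by (force simp: design_def)
qed

definition resid_X :: "nat set \<Rightarrow> (nat \<Rightarrow> 'd::finite obs) \<Rightarrow> nat \<Rightarrow> real" where
  "resid_X J S i = obs_X (S i) - ols J (\<lambda>i. obs_Z (S i)) (\<lambda>i. obs_X (S i)) \<bullet> obs_Z (S i)"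

definition resid_Y :: "nat set \<Rightarrow> (nat \<Rightarrow> 'd::finite obs) \<Rightarrow> nat \<Rightarrow> real" where
  "resid_Y J S i = obs_Y (S i) - ols J (\<lambda>i. obs_Z (S i)) (\<lambda>i. obs_Y (S i)) \<bullet> obs_Z (S i)"

text \<open>The full-regression residual is orthogonal to \<open>h_tilde\<close>, so \<open>rho_hat\<close> is the mean square
  of \<open>h_tilde\<close> and the sign step is void.\<close>

lemma sgn_rho_hat:
  assumes fin: "finite J" "J \<noteq> {}" and pd: "posdef_design J (\<lambda>i. design (S i))"
    and b: "fst (coef_hat J S) \<noteq> 0"
  shows "sgn (rho_hat J S) = 1"
proof -
  let ?b = "fst (coef_hat J S)"
  obtain a where a: "\<And>z. m_tilde J S z = a \<bullet> z"
    unfolding m_tilde_def regress_on_Z_def by blast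
  let ?h = "\<lambda>i. (?b, - a) \<bullet> design (S i)"
  have h: "h_tilde J S (obs_X (S i)) (obs_Z (S i)) = ?h i" for i
    by (simp add: h_tilde_def g_tilde_def a design_def)
  have g: "g_hat J S (obs_X (S i)) (obs_Z (S i)) = coef_hat J S \<bullet> design (S i)" for i
    by (simp add: g_hat_def design_def inner_prod_def)
  have ne: "(\<Sum>i\<in>J. (obs_Y (S i) - coef_hat J S \<bullet> design (S i)) * ?h i) = 0"
    using ols_normal_equations[OF fin(1) pd, of "\<lambda>i. obs_Y (S i)" "(?b, - a)"]
    by (simp add: coef_hat_def design_def)
  have "rho_hat J S = (1 / real (card J)) *
      (\<Sum>i\<in>J. (obs_Y (S i) - coef_hat J S \<bullet> design (S i)) * ?h i + (?h i)\<^sup>2)"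
    unfolding rho_hat_def h g
    by (intro arg_cong2[where f = "(*)"] sum.cong)
      (auto simp: g_tilde_def a design_def power2_eq_square algebra_simps)
  also have "\<dots> = (1 / real (card J)) * (\<Sum>i\<in>J. (?h i)\<^sup>2)"
    by (simp add: sum.distrib ne)
  finally have eq: "rho_hat J S = (1 / real (card J)) * (\<Sum>i\<in>J. (?h i)\<^sup>2)" .
  have "(?b, - a) \<noteq> 0" using b by (simp add: zero_prod_def)
  then have "0 < (\<Sum>i\<in>J. (?h i)\<^sup>2)" using pd unfolding posdef_design_def by blast
  then have "0 < rho_hat J S" unfolding eq using fin by (simp add: card_gt_0_iff)
  then show ?thesis by simp
qed

text \<open>Least squares is linear and reproduces linear functions of \<open>Z\<close>. Hence the
  correction \<open>m_tilde\<close> fitted on \<open>I2\<close> is removed exactly by the regression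
  on \<open>I1\<close>, and only the slope from \<open>I2\<close> survives.\<close>

lemma L_stat_eq:
  assumes fin: "finite I1" "finite I2" "I2 \<noteq> {}"
    and pd1: "posdef_design I1 (\<lambda>i. design (S i))" and pd2: "posdef_design I2 (\<lambda>i. design (S i))"
    and b: "fst (coef_hat I2 S) \<noteq> 0"
  shows "L_stat I1 I2 S i = fst (coef_hat I2 S) * (resid_Y I1 S i * resid_X I1 S i)"
proof -
  let ?b = "fst (coef_hat I2 S)"
  let ?e = "ols I1 (\<lambda>i. obs_Z (S i)) (\<lambda>i. obs_X (S i))"
  obtain a where a: "\<And>z. m_tilde I2 S z = a \<bullet> z"
    unfolding m_tilde_def regress_on_Z_def by blast
  have f: "f_hat I2 S (obs_X (S i)) (obs_Z (S i)) = ?b * obs_X (S i) - a \<bullet> obs_Z (S i)" for i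
    unfolding f_hat_def sgn_rho_hat[OF fin(2,3) pd2 b]
    by (simp add: h_tilde_def g_tilde_def a)
  note pdZ = posdef_design_Z[OF pd1]
  have "ols I1 (\<lambda>i. obs_Z (S i)) (\<lambda>i. ?b * obs_X (S i) - a \<bullet> obs_Z (S i)) = ?b *\<^sub>R ?e - a"
  proof (rule ols_eqI[OF fin(1) pdZ])
    fix v
    have "(\<Sum>i\<in>I1. (?b * obs_X (S i) - a \<bullet> obs_Z (S i) - (?b *\<^sub>R ?e - a) \<bullet> obs_Z (S i)) * (v \<bullet> obs_Z (S i)))
        = ?b * (\<Sum>i\<in>I1. (obs_X (S i) - ?e \<bullet> obs_Z (S i)) * (v \<bullet> obs_Z (S i)))"
      by (simp add: sum_distrib_left inner_diff_left algebra_simps)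
    then show "(\<Sum>i\<in>I1. (?b * obs_X (S i) - a \<bullet> obs_Z (S i) - (?b *\<^sub>R ?e - a) \<bullet> obs_Z (S i)) * (v \<bullet> obs_Z (S i))) = 0"
      using ols_normal_equations[OF fin(1) pdZ] by simp
  qed
  then have "L_stat I1 I2 S i = resid_Y I1 S i * (?b * obs_X (S i) - a \<bullet> obs_Z (S i) - (?b *\<^sub>R ?e - a) \<bullet> obs_Z (S i))"
    by (simp only: L_stat_def f m_f_hat_def m_hat_def regress_on_Z_def resid_Y_def)
  then show ?thesis
    by (simp add: resid_X_def inner_diff_left algebra_simps)
qed

text \<open>A studentised mean is invariant under scaling, so the estimated slope cancels up to its
  sign.\<close>

lemma T_stat_eq:
  assumes fin: "finite I1" "I1 \<noteq> {}" "finite I2" "I2 \<noteq> {}"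
    and pd1: "posdef_design I1 (\<lambda>i. design (S i))" and pd2: "posdef_design I2 (\<lambda>i. design (S i))"
    and b: "fst (coef_hat I2 S) \<noteq> 0"
  defines "L \<equiv> \<lambda>i. resid_Y I1 S i * resid_X I1 S i"
  shows "T_stat I1 I2 S = sgn (fst (coef_hat I2 S)) * (sqrt (real (card I1)) * avg I1 L)
      / sqrt (avg I1 (\<lambda>i. (L i)\<^sup>2) - (avg I1 L)\<^sup>2)"
proof -
  let ?b = "fst (coef_hat I2 S)"
  have n: "real (card I1) > 0" using fin by (simp add: card_gt_0_iff)
  have L: "L_stat I1 I2 S i = ?b * L i" for i
    unfolding L_def by (rule L_stat_eq[OF fin(1,3,4) pd1 pd2 b])
  have "(1 / sqrt (real (card I1))) * (\<Sum>i\<in>I1. ?b * L i) = ?b * (sqrt (real (card I1)) * avg I1 L)"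
    using n real_div_sqrt[of "real (card I1)"]
    by (simp add: avg_def sum_distrib_left[symmetric]) (simp add: field_simps)
  moreover have "(1 / real (card I1)) * (\<Sum>i\<in>I1. (?b * L i)\<^sup>2) - ((1 / real (card I1)) * (\<Sum>i\<in>I1. ?b * L i))\<^sup>2
      = ?b\<^sup>2 * (avg I1 (\<lambda>i. (L i)\<^sup>2) - (avg I1 L)\<^sup>2)"
    by (simp add: avg_def sum_distrib_left[symmetric] power_mult_distrib power_divide right_diff_distrib)
  ultimately have "T_stat I1 I2 S = ?b * (sqrt (real (card I1)) * avg I1 L)
      / (\<bar>?b\<bar> * sqrt (avg I1 (\<lambda>i. (L i)\<^sup>2) - (avg I1 L)\<^sup>2))"
    unfolding T_stat_def Let_def L by (simp add: real_sqrt_mult)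
  then show ?thesis using b by (cases "?b > 0") simp_all
qed

lemma avg_inner_bound:
  fixes W :: "nat \<Rightarrow> 'a::euclidean_space"
  assumes t: "\<And>u. u \<in> Basis \<Longrightarrow> \<bar>avg J (\<lambda>i. y i * (u \<bullet> W i))\<bar> \<le> t"
  shows "\<bar>avg J (\<lambda>i. y i * (v \<bullet> W i))\<bar> \<le> real DIM('a) * t * norm v"
proof -
  have "avg J (\<lambda>i. y i * (v \<bullet> W i)) = avg J (\<lambda>i. \<Sum>u\<in>Basis. (v \<bullet> u) * (y i * (u \<bullet> W i)))"
  proof (intro avg_cong)
    fix i
    have "v \<bullet> W i = (\<Sum>u\<in>Basis. (v \<bullet> u) * (W i \<bullet> u))" by (rule euclidean_inner)
    then show "y i * (v \<bullet> W i) = (\<Sum>u\<in>Basis. (v \<bullet> u) * (y i * (u \<bullet> W i)))"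
      by (simp add: sum_distrib_left algebra_simps inner_commute)
  qed
  also have "\<dots> = (\<Sum>u\<in>Basis. (v \<bullet> u) * avg J (\<lambda>i. y i * (u \<bullet> W i)))"
    by (simp add: avg_sum avg_cmult)
  also have "\<bar>\<dots>\<bar> \<le> (\<Sum>u\<in>(Basis::'a set). norm v * t)"
  proof (rule order_trans[OF sum_abs sum_mono])
    fix u :: 'a assume "u \<in> Basis"
    then show "\<bar>(v \<bullet> u) * avg J (\<lambda>i. y i * (u \<bullet> W i))\<bar> \<le> norm v * t"
      unfolding abs_mult using t by (intro mult_mono Basis_le_norm) auto
  qed
  finally show ?thesis by (simp add: mult_ac)
qed

text \<open>A form of the Frisch--Waugh--Lovell identity: the numerator of the statistic estimates
  \<open>\<beta>\<close> times the residual variance of \<open>X\<close>.\<close>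

lemma avg_resid_product:
  assumes fin: "finite J" and pd: "posdef_design J (\<lambda>i. design (S i))"
  shows "avg J (\<lambda>i. resid_Y J S i * resid_X J S i)
    = b * avg J (\<lambda>i. (resid_X J S i)\<^sup>2) + avg J (\<lambda>i. noise b g (S i) * resid_X J S i)"
proof -
  let ?m = "ols J (\<lambda>i. obs_Z (S i)) (\<lambda>i. obs_Y (S i))"
  let ?e = "ols J (\<lambda>i. obs_Z (S i)) (\<lambda>i. obs_X (S i))"
  \<comment> \<open>The residual of \<open>Y\<close> is the noise plus \<open>b\<close> times the
    residual of \<open>X\<close> plus \<open>?a \<bullet> obs_Z\<close>, and the last term is
    orthogonal to the residual of \<open>X\<close>.\<close>
  let ?a = "g + b *\<^sub>R ?e - ?m"
  have "avg J (\<lambda>i. resid_X J S i * (?a \<bullet> obs_Z (S i))) = 0"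
    using ols_normal_equations[OF fin posdef_design_Z[OF pd]]
    by (simp add: avg_def resid_X_def)
  moreover have "avg J (\<lambda>i. resid_Y J S i * resid_X J S i) = avg J (\<lambda>i. b * (resid_X J S i)\<^sup>2
      + noise b g (S i) * resid_X J S i + resid_X J S i * (?a \<bullet> obs_Z (S i)))"
    by (intro avg_cong) (simp add: resid_Y_def resid_X_def noise_def inner_add_left inner_diff_left
        power2_eq_square algebra_simps)
  ultimately show ?thesis by (simp add: avg_add avg_cmult)
qed

text \<open>The residual of \<open>X\<close> is \<open>u \<bullet> design\<close> with first
  coordinate of \<open>u\<close> equal to 1. The signal grows with the square of the norm of
  \<open>u\<close> and the noise only linearly, so the worst case is norm 1 and the bound is free of
  the fitted coefficient.\<close>

lemma resid_product_lower_bound: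
  fixes S :: "nat \<Rightarrow> 'd::finite obs"
  assumes fin: "finite J"
    and k: "k > 0" "\<And>v. k * (norm v)\<^sup>2 \<le> avg J (\<lambda>i. (v \<bullet> design (S i))\<^sup>2)"
    and t: "\<And>u. u \<in> Basis \<Longrightarrow> \<bar>avg J (\<lambda>i. noise b g (S i) * (u \<bullet> design (S i)))\<bar> \<le> t"
    and b: "real DIM(real \<times> (real ^ 'd)) * t \<le> k * \<bar>b\<bar>"
  shows "k * \<bar>b\<bar> - real DIM(real \<times> (real ^ 'd)) * t \<le> sgn b * avg J (\<lambda>i. resid_Y J S i * resid_X J S i)"
proof -
  let ?D = "real DIM(real \<times> (real ^ 'd))"
  define u where "u = (1 :: real, - ols J (\<lambda>i. obs_Z (S i)) (\<lambda>i. obs_X (S i)))"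
  have e: "resid_X J S i = u \<bullet> design (S i)" for i
    by (simp add: resid_X_def u_def design_def)
  have u1: "1 \<le> norm u"
    using norm_fst_le[of "1 :: real" "- ols J (\<lambda>i. obs_Z (S i)) (\<lambda>i. obs_X (S i))"] by (simp add: u_def)
  have pd: "posdef_design J (\<lambda>i. design (S i))" using k by (rule posdef_designI)
  have "\<bar>b\<bar> * (k * (norm u)\<^sup>2) \<le> \<bar>b\<bar> * avg J (\<lambda>i. (resid_X J S i)\<^sup>2)"
    unfolding e using k(2) by (intro mult_left_mono) auto
  moreover have "\<bar>sgn b * avg J (\<lambda>i. noise b g (S i) * resid_X J S i)\<bar> \<le> ?D * t * norm u"
  proof -
    have "\<bar>sgn b\<bar> \<le> 1" by (simp add: sgn_if)
    then have "\<bar>sgn b * avg J (\<lambda>i. noise b g (S i) * resid_X J S i)\<bar> \<le> 1 * \<bar>avg J (\<lambda>i. noise b g (S i) * resid_X J S i)\<bar>"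
      unfolding abs_mult by (intro mult_right_mono) auto
    also have "\<dots> \<le> ?D * t * norm u"
      unfolding e using avg_inner_bound[OF t] by simp
    finally show ?thesis .
  qed
  moreover have "sgn b * avg J (\<lambda>i. resid_Y J S i * resid_X J S i)
      = \<bar>b\<bar> * avg J (\<lambda>i. (resid_X J S i)\<^sup>2) + sgn b * avg J (\<lambda>i. noise b g (S i) * resid_X J S i)"
    unfolding avg_resid_product[OF fin pd, of b g] by (simp add: distrib_left sgn_if)
  ultimately have "\<bar>b\<bar> * (k * (norm u)\<^sup>2) - ?D * t * norm u \<le> sgn b * avg J (\<lambda>i. resid_Y J S i * resid_X J S i)"
    by linarith
  moreover have "k * \<bar>b\<bar> - ?D * t \<le> \<bar>b\<bar> * (k * (norm u)\<^sup>2) - ?D * t * norm u"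
  proof -
    have "1 * (k * \<bar>b\<bar> - ?D * t) \<le> norm u * (k * \<bar>b\<bar> - ?D * t)"
      using b u1 by (intro mult_right_mono) auto
    also have "\<dots> \<le> norm u * (k * \<bar>b\<bar> * norm u - ?D * t)"
    proof (intro mult_left_mono diff_right_mono)
      have "k * \<bar>b\<bar> * 1 \<le> k * \<bar>b\<bar> * norm u"
        using k(1) u1 by (intro mult_left_mono) auto
      then show "k * \<bar>b\<bar> \<le> k * \<bar>b\<bar> * norm u" by simp
    qed simp
    finally show ?thesis by (simp add: power2_eq_square algebra_simps)
  qed
  ultimately show ?thesis by linarith
qed

section \<open>Lower bound for the statistic on a well-behaved sample\<close>

text \<open>One function that dominates \<open>X\<close>, \<open>Y\<close>, the norm of
  \<open>Z\<close> and, up to constants, all linear residuals, so that all moment bounds reduce to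
  its own. The summand 1 makes its powers increase with the exponent.\<close>

definition envelope :: "'d::finite obs \<Rightarrow> real" where
  "envelope w = 1 + norm w"

lemma envelope_ge_1: "1 \<le> envelope w"
  by (simp add: envelope_def)

lemma obs_le_envelope:
  "\<bar>obs_X w\<bar> \<le> envelope w" "\<bar>obs_Y w\<bar> \<le> envelope w" "norm (obs_Z w) \<le> envelope w"
  "norm (design w) \<le> envelope w"
proof -
  obtain x y z where w: "w = (x, y, z)" by (cases w)
  have n: "norm w = sqrt (x\<^sup>2 + (y\<^sup>2 + (norm z)\<^sup>2))" by (simp add: w norm_prod_def)
  have "\<bar>x\<bar> \<le> norm w" "\<bar>y\<bar> \<le> norm w" "norm z \<le> norm w" "norm (design w) \<le> norm w"
    unfolding n by (auto simp: w design_def obs_X_def obs_Z_def norm_prod_def intro!: real_le_rsqrt)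
  then show "\<bar>obs_X w\<bar> \<le> envelope w" "\<bar>obs_Y w\<bar> \<le> envelope w" "norm (obs_Z w) \<le> envelope w"
    "norm (design w) \<le> envelope w"
    by (auto simp: w obs_X_def obs_Y_def obs_Z_def envelope_def)
qed

lemma linear_residual_le_envelope:
  assumes "norm a \<le> A" and "\<bar>x\<bar> \<le> envelope w"
  shows "\<bar>x - a \<bullet> obs_Z w\<bar> \<le> (1 + A) * envelope w"
proof -
  have "\<bar>a \<bullet> obs_Z w\<bar> \<le> norm a * norm (obs_Z w)" by (rule Cauchy_Schwarz_ineq2)
  also have "\<dots> \<le> A * envelope w"
    using assms(1) obs_le_envelope(3)[of w] envelope_ge_1[of w]
    by (intro mult_mono) (auto intro: order_trans[OF norm_ge_zero])
  finally show ?thesis using assms(2) by (simp add: distrib_right)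
qed

text \<open>The deterministic core: what holds on one good sample. In the application
  \<open>h\<close> is \<open>eta P\<close>, so \<open>r0\<close> and \<open>x0\<close> are the
  population residuals of \<open>Y\<close> and \<open>X\<close> on \<open>Z\<close>;
  \<open>A\<close> bounds their coefficients, \<open>K\<close> the empirical fourth moment, and
  \<tau> bounds the mean absolute deviation of \<open>r0 * x0\<close> from below. The tolerance
  \<open>\<epsilon>'\<close> is what \<epsilon> becomes for the fitted coefficients on
  \<open>Z\<close>. Hypothesis \<open>z\<close> sets the numerator against an upper bound for the
  denominator.\<close>

lemma T_stat_exceeds:
  fixes S :: "nat \<Rightarrow> 'd::finite obs" and b :: real and g h :: "real ^ 'd"
  defines "r0 \<equiv> \<lambda>w. obs_Y w - (g + b *\<^sub>R h) \<bullet> obs_Z w"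
  defines "x0 \<equiv> \<lambda>w. obs_X w - h \<bullet> obs_Z w"
  assumes fin: "finite I1" "I1 \<noteq> {}" "finite I2" "I2 \<noteq> {}"
    and k: "k > 0"
      "\<And>v. k * (norm v)\<^sup>2 \<le> avg I1 (\<lambda>i. (v \<bullet> design (S i))\<^sup>2)"
      "\<And>v. k * (norm v)\<^sup>2 \<le> avg I2 (\<lambda>i. (v \<bullet> design (S i))\<^sup>2)"
    and t:
      "\<And>u. u \<in> Basis \<Longrightarrow> \<bar>avg I1 (\<lambda>i. noise b g (S i) * (u \<bullet> design (S i)))\<bar> \<le> t"
      "\<And>u. u \<in> Basis \<Longrightarrow> \<bar>avg I2 (\<lambda>i. noise b g (S i) * (u \<bullet> design (S i)))\<bar> \<le> t"
    and A: "norm (g + b *\<^sub>R h) \<le> A" "norm h \<le> A"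
    and K: "avg I1 (\<lambda>i. (envelope (S i)) ^ 4) \<le> K"
    and coef: "\<And>u. u \<in> Basis \<Longrightarrow> \<bar>avg I1 (\<lambda>i. r0 (S i) * (u \<bullet> obs_Z (S i)))\<bar> \<le> \<epsilon>"
      "\<And>u. u \<in> Basis \<Longrightarrow> \<bar>avg I1 (\<lambda>i. x0 (S i) * (u \<bullet> obs_Z (S i)))\<bar> \<le> \<epsilon>"
    and V: "\<bar>avg I1 (\<lambda>i. r0 (S i) * x0 (S i)) - \<mu>\<bar> \<le> \<epsilon>"
      "\<tau> - \<epsilon> \<le> avg I1 (\<lambda>i. \<bar>r0 (S i) * x0 (S i) - \<mu>\<bar>)"
    and \<epsilon>': "real CARD('d) * \<epsilon> / k \<le> \<epsilon>'" "\<epsilon>' \<le> 1"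
    and \<tau>: "2 * (\<epsilon>' * (3 + 2 * A) * K) + 2 * \<epsilon> < \<tau>"
    and b: "real DIM(real \<times> (real ^ 'd)) * t < k * \<bar>b\<bar>"
    and z: "\<bar>z\<bar> * ((2 + A)\<^sup>2 * sqrt K) < sqrt (real (card I1)) * (k * \<bar>b\<bar> - real DIM(real \<times> (real ^ 'd)) * t)"
  shows "z < T_stat I1 I2 S"
proof -
  let ?D = "real DIM(real \<times> (real ^ 'd))"
  let ?N = "sqrt (real (card I1)) * (k * \<bar>b\<bar> - ?D * t)"
  have pd1: "posdef_design I1 (\<lambda>i. design (S i))" using k(1,2) by (rule posdef_designI)
  have pd2: "posdef_design I2 (\<lambda>i. design (S i))" using k(1,3) by (rule posdef_designI)
  have A0: "0 \<le> A" using A(2) norm_ge_zero order_trans by blast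
  have \<epsilon>'0: "0 \<le> \<epsilon>'"
  proof -
    have "0 \<le> \<epsilon>" using V(1) by linarith
    then show ?thesis using \<epsilon>'(1) k(1) by (meson divide_nonneg_pos mult_nonneg_nonneg of_nat_0_le_iff order_trans)
  qed

  define bh where "bh = fst (coef_hat I2 S)"
  \<comment> \<open>The error of the slope from the second half is below |b|, so the estimate lies
    on the same side of 0.\<close>
  have sgn: "bh \<noteq> 0 \<and> sgn bh = sgn b"
  proof -
    have "norm (coef_hat I2 S - (b, g)) \<le> ?D * t / k"
      unfolding coef_hat_def design_def[symmetric]
      using t(2) by (intro ols_deviation[OF fin(3) k(1,3)])
        (simp_all add: noise_def design_def algebra_simps)
    then have "\<bar>bh - b\<bar> \<le> ?D * t / k"
      unfolding bh_def using norm_fst_le[of "fst (coef_hat I2 S) - b" "snd (coef_hat I2 S) - g"]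
      by (cases "coef_hat I2 S") (auto simp: minus_prod_def)
    also have "\<dots> < \<bar>b\<bar>" using b k(1) by (simp add: field_simps)
    finally show ?thesis by (auto simp: sgn_if split: if_splits)
  qed

  have kZ: "k * (norm v)\<^sup>2 \<le> avg I1 (\<lambda>i. (v \<bullet> obs_Z (S i))\<^sup>2)" for v :: "real ^ 'd"
    using k(2)[of "(0, v)"] by (simp add: design_def norm_prod_def)
  define mh where "mh = ols I1 (\<lambda>i. obs_Z (S i)) (\<lambda>i. obs_Y (S i))"
  define eh where "eh = ols I1 (\<lambda>i. obs_Z (S i)) (\<lambda>i. obs_X (S i))"
  have "norm (mh - (g + b *\<^sub>R h)) \<le> real DIM(real ^ 'd) * \<epsilon> / k"
    unfolding mh_def using coef(1) by (intro ols_deviation[OF fin(1) k(1) kZ]) (simp add: r0_def)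
  then have mh: "norm (mh - (g + b *\<^sub>R h)) \<le> \<epsilon>'" using \<epsilon>'(1) by simp
  have "norm (eh - h) \<le> real DIM(real ^ 'd) * \<epsilon> / k"
    unfolding eh_def using coef(2) by (intro ols_deviation[OF fin(1) k(1) kZ]) (simp add: x0_def)
  then have eh: "norm (eh - h) \<le> \<epsilon>'" using \<epsilon>'(1) by simp
  have mhA: "norm mh \<le> 1 + A" and ehA: "norm eh \<le> 1 + A"
    using mh eh A \<epsilon>'(2) norm_triangle_sub[of mh "g + b *\<^sub>R h"] norm_triangle_sub[of eh h] by linarith+

  define L where "L i = resid_Y I1 S i * resid_X I1 S i" for i
  define Q where "Q i = envelope (S i)" for i
  have Q: "1 \<le> Q i" for i by (simp add: Q_def envelope_ge_1)
  have rY: "\<bar>resid_Y I1 S i\<bar> \<le> (2 + A) * Q i" for i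
    using linear_residual_le_envelope[OF mhA obs_le_envelope(2), of "S i"]
    by (simp add: resid_Y_def mh_def Q_def)
  have rX: "\<bar>resid_X I1 S i\<bar> \<le> (2 + A) * Q i" for i
    using linear_residual_le_envelope[OF ehA obs_le_envelope(1), of "S i"]
    by (simp add: resid_X_def eh_def Q_def)
  have r0Q: "\<bar>r0 (S i)\<bar> \<le> (1 + A) * Q i" for i
    using linear_residual_le_envelope[OF A(1) obs_le_envelope(2), of "S i"] by (simp add: r0_def Q_def)
  have dY: "\<bar>resid_Y I1 S i - r0 (S i)\<bar> \<le> \<epsilon>' * Q i" for i
  proof -
    have "\<bar>(mh - (g + b *\<^sub>R h)) \<bullet> obs_Z (S i)\<bar> \<le> norm (mh - (g + b *\<^sub>R h)) * norm (obs_Z (S i))"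
      by (rule Cauchy_Schwarz_ineq2)
    also have "\<dots> \<le> \<epsilon>' * Q i"
      unfolding Q_def using mh obs_le_envelope(3)[of "S i"] \<epsilon>'0 by (intro mult_mono) auto
    finally show ?thesis by (simp add: resid_Y_def r0_def mh_def inner_diff_left)
  qed
  have dX: "\<bar>resid_X I1 S i - x0 (S i)\<bar> \<le> \<epsilon>' * Q i" for i
  proof -
    have "\<bar>(eh - h) \<bullet> obs_Z (S i)\<bar> \<le> norm (eh - h) * norm (obs_Z (S i))"
      by (rule Cauchy_Schwarz_ineq2)
    also have "\<dots> \<le> \<epsilon>' * Q i"
      unfolding Q_def using eh obs_le_envelope(3)[of "S i"] \<epsilon>'0 by (intro mult_mono) auto
    finally show ?thesis by (simp add: resid_X_def x0_def eh_def inner_diff_left)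
  qed
  have dL: "\<bar>L i - r0 (S i) * x0 (S i)\<bar> \<le> \<epsilon>' * (3 + 2 * A) * (Q i) ^ 4" for i
  proof -
    have "L i - r0 (S i) * x0 (S i) = (resid_Y I1 S i - r0 (S i)) * resid_X I1 S i
        + r0 (S i) * (resid_X I1 S i - x0 (S i))"
      by (simp add: L_def algebra_simps)
    also have "\<bar>\<dots>\<bar> \<le> \<bar>resid_Y I1 S i - r0 (S i)\<bar> * \<bar>resid_X I1 S i\<bar>
        + \<bar>r0 (S i)\<bar> * \<bar>resid_X I1 S i - x0 (S i)\<bar>"
      unfolding abs_mult[symmetric] by (rule abs_triangle_ineq)
    also have "\<dots> \<le> (\<epsilon>' * Q i) * ((2 + A) * Q i) + ((1 + A) * Q i) * (\<epsilon>' * Q i)"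
      using dY dX rX r0Q \<epsilon>'0 Q[of i] A0 by (intro add_mono mult_mono) auto
    also have "\<dots> = \<epsilon>' * (3 + 2 * A) * (Q i) ^ 2"
      by (simp add: power2_eq_square algebra_simps)
    \<comment> \<open>Raised to the fourth power because that is the empirical moment bounded by
      \<open>K\<close>.\<close>
    also have "\<dots> \<le> \<epsilon>' * (3 + 2 * A) * (Q i) ^ 4"
      using \<epsilon>'0 A0 Q by (intro mult_left_mono power_increasing) auto
    finally show ?thesis .
  qed
  define \<omega> where "\<omega> = \<epsilon>' * (3 + 2 * A) * K"
  have avg_dL: "avg I1 (\<lambda>i. \<bar>L i - r0 (S i) * x0 (S i)\<bar>) \<le> \<omega>"
  proof -
    have "avg I1 (\<lambda>i. \<bar>L i - r0 (S i) * x0 (S i)\<bar>) \<le> avg I1 (\<lambda>i. \<epsilon>' * (3 + 2 * A) * (Q i) ^ 4)"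
      using dL by (rule avg_mono)
    also have "\<dots> = \<epsilon>' * (3 + 2 * A) * avg I1 (\<lambda>i. (Q i) ^ 4)" by (rule avg_cmult)
    also have "\<dots> \<le> \<omega>"
      unfolding \<omega>_def Q_def using K \<epsilon>'0 A0 by (intro mult_left_mono) auto
    finally show ?thesis .
  qed

  define v where "v = avg I1 (\<lambda>i. (L i)\<^sup>2) - (avg I1 L)\<^sup>2"
  have v_eq: "v = avg I1 (\<lambda>i. (L i - avg I1 L)\<^sup>2)"
    unfolding v_def using avg_centered_square[OF fin(1,2), of L] by simp
  \<comment> \<open>If all \<open>L i\<close> equal their average, which is within
    \<open>\<omega> + \<epsilon>\<close> of \<mu>, then the mean absolute deviation of
    \<open>r0 * x0\<close> from \<mu> is at most \<open>2 * \<omega> + \<epsilon>\<close>, against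
    the lower bound \<open>\<tau> - \<epsilon>\<close>.\<close>
  have "v \<noteq> 0"
  proof
    assume "v = 0"
    then have "(\<Sum>i\<in>I1. (L i - avg I1 L)\<^sup>2) = 0"
      using fin by (simp add: v_eq avg_def)
    then have La: "L i = avg I1 L" if "i \<in> I1" for i
      using that fin(1) by (simp add: sum_nonneg_eq_0_iff)
    have "\<bar>avg I1 L - avg I1 (\<lambda>i. r0 (S i) * x0 (S i))\<bar> \<le> \<omega>"
      unfolding avg_diff[symmetric] using avg_abs avg_dL by (rule order_trans)
    then have am: "\<bar>avg I1 L - \<mu>\<bar> \<le> \<omega> + \<epsilon>" using V(1) by linarith
    have "avg I1 (\<lambda>i. \<bar>r0 (S i) * x0 (S i) - \<mu>\<bar>)
        \<le> avg I1 (\<lambda>i. \<bar>L i - r0 (S i) * x0 (S i)\<bar> + \<bar>avg I1 L - \<mu>\<bar>)"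
    proof (rule avg_mono)
      fix i assume "i \<in> I1"
      then show "\<bar>r0 (S i) * x0 (S i) - \<mu>\<bar> \<le> \<bar>L i - r0 (S i) * x0 (S i)\<bar> + \<bar>avg I1 L - \<mu>\<bar>"
        using La[of i] by linarith
    qed
    also have "\<dots> \<le> \<omega> + (\<omega> + \<epsilon>)"
      unfolding avg_add avg_const[OF fin(1,2)] using avg_dL am by (rule add_mono)
    finally show False using V(2) \<tau> unfolding \<omega>_def by linarith
  qed
  moreover have "0 \<le> v" unfolding v_eq by (rule avg_nonneg) simp
  ultimately have v: "0 < v" by simp
  have "avg I1 (\<lambda>i. (L i)\<^sup>2) \<le> avg I1 (\<lambda>i. (2 + A) ^ 4 * (Q i) ^ 4)"
  proof (rule avg_mono)
    fix i
    have "\<bar>L i\<bar> \<le> ((2 + A) * Q i) * ((2 + A) * Q i)"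
      unfolding L_def abs_mult using rX rY A0 Q[of i] by (intro mult_mono) auto
    then have "\<bar>L i\<bar>\<^sup>2 \<le> (((2 + A) * Q i) * ((2 + A) * Q i))\<^sup>2" by (intro power_mono) auto
    then show "(L i)\<^sup>2 \<le> (2 + A) ^ 4 * (Q i) ^ 4"
      by (simp add: power_mult_distrib power2_eq_square[symmetric] flip: power_mult)
  qed
  also have "\<dots> \<le> (2 + A) ^ 4 * K"
    unfolding avg_cmult Q_def using K by (intro mult_left_mono) auto
  finally have vK: "v \<le> (2 + A) ^ 4 * K" unfolding v_def using zero_le_power2[of "avg I1 L"] by linarith
  define B where "B = (2 + A)\<^sup>2 * sqrt K"
  have sB: "sqrt v \<le> B"
  proof -
    have "sqrt v \<le> sqrt (((2 + A)\<^sup>2)\<^sup>2 * K)" using vK by (simp flip: power_mult)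
    also have "\<dots> = B" by (simp only: real_sqrt_mult real_sqrt_abs B_def) simp
    finally show ?thesis .
  qed
  have "k * \<bar>b\<bar> - ?D * t \<le> sgn b * avg I1 L"
    unfolding L_def using b by (intro resid_product_lower_bound[OF fin(1) k(1,2) t(1)]) auto
  then have "?N \<le> sqrt (real (card I1)) * (sgn b * avg I1 L)"
    by (intro mult_left_mono) auto
  moreover have "\<bar>z\<bar> * sqrt v \<le> \<bar>z\<bar> * B"
    using sB by (intro mult_left_mono) auto
  ultimately have "\<bar>z\<bar> * sqrt v < sgn bh * (sqrt (real (card I1)) * avg I1 L)"
    using z sgn unfolding B_def by (simp add: mult_ac)
  then have "\<bar>z\<bar> < sgn bh * (sqrt (real (card I1)) * avg I1 L) / sqrt v"
    using v by (simp add: pos_less_divide_eq)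
  moreover have "T_stat I1 I2 S = sgn bh * (sqrt (real (card I1)) * avg I1 L) / sqrt v"
    unfolding bh_def v_def L_def using sgn by (intro T_stat_eq[OF fin pd1 pd2]) (simp add: bh_def)
  ultimately show ?thesis by linarith
qed

section \<open>Population moments\<close>

lemma envelope_measurable [measurable]: "envelope \<in> borel_measurable borel"
  unfolding envelope_def by (intro borel_measurable_continuous_onI continuous_intros)

lemma Z_component_measurable [measurable]: "(\<lambda>w. obs_Z w $ i) \<in> borel_measurable borel"
  unfolding obs_Z_def by (intro borel_measurable_continuous_onI continuous_intros)

lemma noise_measurable [measurable]: "noise b g \<in> borel_measurable borel"
  unfolding noise_def by measurable

lemma xi_measurable [measurable]: "xi P \<in> borel_measurable borel"
  unfolding xi_def by measurable

lemma xi_eq_design: "xi P w = (1, - eta P) \<bullet> design w"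
  by (simp add: xi_def design_def)

text \<open>The moment hypothesis in the form used throughout. Uniformity over the family comes from
  later constants depending on \<open>P\<close> only through \<open>K\<close>, \<delta>,
  \<open>c\<close> and the dimension.\<close>

locale envelope_law = prob_space P
  for P :: "'d::finite obs measure" +
  fixes K \<delta> :: real
  assumes sets_P: "sets P = sets borel"
    and \<delta>_pos: "\<delta> > 0"
    and env_int: "integrable P (\<lambda>w. envelope w powr (4 + \<delta>))"
    and env_le: "(\<integral>w. envelope w powr (4 + \<delta>) \<partial>P) \<le> K"
begin

lemma measurable_P: "f \<in> borel_measurable borel \<Longrightarrow> f \<in> borel_measurable P"
  using sets_P by (simp cong: measurable_cong_sets)

lemma env4_le: "(envelope w) ^ 4 \<le> envelope w powr (4 + \<delta>)"
proof -
  have "(envelope w) ^ 4 = envelope w powr 4"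
    using envelope_ge_1[of w] by simp
  also have "\<dots> \<le> envelope w powr (4 + \<delta>)"
    using envelope_ge_1[of w] \<delta>_pos by (intro powr_mono) auto
  finally show ?thesis .
qed

lemma env4_integrable: "integrable P (\<lambda>w. (envelope w) ^ 4)"
proof (rule Bochner_Integration.integrable_bound[OF env_int])
  show "(\<lambda>w. (envelope w) ^ 4) \<in> borel_measurable P" by (rule measurable_P) measurable
  show "AE w in P. norm ((envelope w) ^ 4) \<le> norm (envelope w powr (4 + \<delta>))"
  proof (rule AE_I2)
    fix w
    show "norm ((envelope w) ^ 4) \<le> norm (envelope w powr (4 + \<delta>))"
      using env4_le[of w] by simp
  qed
qed

lemma env4_integral: "(\<integral>w. (envelope w) ^ 4 \<partial>P) \<le> K"
  using integral_mono[OF env4_integrable env_int env4_le] env_le by linarith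

lemma K_ge_1: "1 \<le> K"
proof -
  have "(\<integral>w. 1 \<partial>P) \<le> (\<integral>w. (envelope w) ^ 4 \<partial>P)"
  proof (intro integral_mono env4_integrable)
    fix w :: "'d obs"
    show "1 \<le> (envelope w) ^ 4" using envelope_ge_1[of w] by (rule one_le_power)
  qed simp
  then show ?thesis using env4_integral by (simp add: prob_space)
qed

lemma integrable_of_env4:
  assumes f: "f \<in> borel_measurable borel" and M: "\<And>w. \<bar>f w\<bar> \<le> M * (envelope w) ^ 4"
  shows "integrable P f"
proof (rule Bochner_Integration.integrable_bound)
  show "integrable P (\<lambda>w. M * (envelope w) ^ 4)" by (intro integrable_mult_right env4_integrable)
  show "f \<in> borel_measurable P" using f by (rule measurable_P)
  show "AE w in P. norm (f w) \<le> norm (M * (envelope w) ^ 4)"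
  proof (rule AE_I2)
    fix w :: "'d obs"
    show "norm (f w) \<le> norm (M * (envelope w) ^ 4)" using M[of w] by simp
  qed
qed

lemma integrable_of_env2:
  assumes "f \<in> borel_measurable borel" and M: "\<And>w. \<bar>f w\<bar> \<le> M * (envelope w)\<^sup>2"
  shows "integrable P f"
proof (rule integrable_of_env4[OF assms(1)])
  fix w :: "'d obs"
  have "0 \<le> M * (envelope w)\<^sup>2" using M[of w] by linarith
  then have M0: "0 \<le> M" using envelope_ge_1[of w] by (simp add: zero_le_mult_iff)
  have "\<bar>f w\<bar> \<le> M * (envelope w)\<^sup>2" by (rule M)
  also have "\<dots> \<le> M * (envelope w) ^ 4"
    using M0 envelope_ge_1[of w] by (intro mult_left_mono power_increasing) auto
  finally show "\<bar>f w\<bar> \<le> M * (envelope w) ^ 4" .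
qed

lemma square_le_env4:
  assumes "\<bar>x\<bar> \<le> M * (envelope w)\<^sup>2"
  shows "x\<^sup>2 \<le> M\<^sup>2 * (envelope w) ^ 4"
proof -
  have "\<bar>x\<bar>\<^sup>2 \<le> (M * (envelope w)\<^sup>2)\<^sup>2" using assms by (intro power_mono) auto
  then show ?thesis by (simp add: power_mult_distrib flip: power_mult)
qed

text \<open>Supplies the second-moment hypothesis of \<open>avg_deviation_prob\<close> for functions
  of quadratic growth.\<close>

lemma square_integrable_of_env2:
  assumes f: "f \<in> borel_measurable borel" "\<And>w. \<bar>f w\<bar> \<le> M * (envelope w)\<^sup>2"
  shows "integrable P (\<lambda>w. (f w)\<^sup>2)" "(\<integral>w. (f w)\<^sup>2 \<partial>P) \<le> M\<^sup>2 * K"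
proof -
  have le: "(f w)\<^sup>2 \<le> M\<^sup>2 * (envelope w) ^ 4" for w
    using f(2) by (rule square_le_env4)
  show int: "integrable P (\<lambda>w. (f w)\<^sup>2)"
    using f(1) le by (intro integrable_of_env4[of _ "M\<^sup>2"]) auto
  have "(\<integral>w. (f w)\<^sup>2 \<partial>P) \<le> (\<integral>w. M\<^sup>2 * (envelope w) ^ 4 \<partial>P)"
    using le by (intro integral_mono int integrable_mult_right env4_integrable)
  also have "\<dots> \<le> M\<^sup>2 * K" using env4_integral by (simp add: mult_left_mono)
  finally show "(\<integral>w. (f w)\<^sup>2 \<partial>P) \<le> M\<^sup>2 * K" .
qed

lemma env_mult:
  assumes "\<bar>x\<bar> \<le> M * envelope w" "\<bar>y\<bar> \<le> N * envelope w"
  shows "\<bar>x * y\<bar> \<le> (M * N) * (envelope w)\<^sup>2"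
proof -
  have "\<bar>x\<bar> * \<bar>y\<bar> \<le> (M * envelope w) * (N * envelope w)"
    using assms by (intro mult_mono) auto
  then show ?thesis by (simp add: abs_mult power2_eq_square mult_ac)
qed

lemma inner_design_le: "\<bar>v \<bullet> design w\<bar> \<le> norm v * envelope w"
  using Cauchy_Schwarz_ineq2[of v "design w"] obs_le_envelope(4)[of w]
  by (meson mult_left_mono norm_ge_zero order_trans)

lemma inner_Z_le: "\<bar>v \<bullet> obs_Z w\<bar> \<le> norm v * envelope w"
  using Cauchy_Schwarz_ineq2[of v "obs_Z w"] obs_le_envelope(3)[of w]
  by (meson mult_left_mono norm_ge_zero order_trans)

lemma Z_component_le: "\<bar>obs_Z w $ i\<bar> \<le> 1 * envelope w"
  using component_le_norm_cart[of "obs_Z w" i] obs_le_envelope(3)[of w] by simp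

end

section \<open>Population coefficients in the linear model\<close>

text \<open>\<open>K / c\<close> bounds \<open>(b, g)\<close> and \<open>eta P\<close>; the sum
  covers the coefficient \<open>g + b *\<^sub>R eta P\<close> of \<open>Y\<close> on
  \<open>Z\<close>.\<close>

definition coef_bound :: "real \<Rightarrow> real \<Rightarrow> real" where
  "coef_bound K c = K / c + (K / c)\<^sup>2"

text \<open>The factor \<open>1 + coef_bound K c\<close> bounds each of the two residuals relative
  to the envelope; the 1 in \<open>1 + K\<close> stands for the score and \<open>K\<close> for its
  mean.\<close>

definition score_bound :: "real \<Rightarrow> real \<Rightarrow> real" where
  "score_bound K c = (1 + coef_bound K c)\<^sup>2 * (1 + K)"

text \<open>\<open>c\<^sup>2 / (2 * M * R)\<close>, with \<open>M\<close> the score bound and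
  \<open>R\<close> the truncation parameter found in \<open>score_abs_deviation\<close>.\<close>

definition deviation_bound :: "real \<Rightarrow> real \<Rightarrow> real \<Rightarrow> real" where
  "deviation_bound K \<delta> c = c\<^sup>2 /
     (2 * (score_bound K c * (2 * (score_bound K c)\<^sup>2 * K / c\<^sup>2) powr (2 / \<delta>)))"

locale linear_law = envelope_law P K \<delta>
  for P :: "'d::finite obs measure" and K \<delta> :: real +
  fixes b :: real and g :: "real ^ 'd" and c :: real
  assumes lin: "linear_model P b g"
    and c_pos: "c > 0"
    and cond_var: "AE w in P. cond_variance P (sigma_XZ P) (noise b g) w \<ge> c"
    and gram: "\<And>v. c * (norm v)\<^sup>2 \<le> (\<integral>w. (v \<bullet> design w)\<^sup>2 \<partial>P)"
    and inv: "invertible (E_ZZ P)"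
begin

abbreviation A :: real where
  "A \<equiv> coef_bound K c"

abbreviation M :: real where
  "M \<equiv> score_bound K c"

abbreviation \<tau> :: real where
  "\<tau> \<equiv> deviation_bound K \<delta> c"

lemmas pos = \<delta>_pos c_pos

text \<open>A provisional bound whose constant depends on \<open>P\<close>. It yields the
  integrability on which \<open>coefficient_bound\<close> rests; the uniform version is
  \<open>noise_le\<close>.\<close>

lemma noise_le_raw: "\<bar>noise b g w\<bar> \<le> (1 + norm (b, g)) * envelope w"
proof -
  have "noise b g w = obs_Y w - (b, g) \<bullet> design w" by (simp add: noise_def design_def)
  then show ?thesis
    using inner_design_le[of "(b, g)" w] obs_le_envelope(2)[of w] by (simp add: distrib_right)
qed

lemma subalgebra_XZ: "subalgebra P (sigma_XZ P)"
proof -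
  have "(\<lambda>w. (obs_X w, obs_Z w)) \<in> borel_measurable P"
    using design_measurable by (intro measurable_P) (simp add: design_def[abs_def])
  then have "sets (sigma_XZ P) \<subseteq> sets P"
    unfolding sigma_XZ_def by (intro sets_image_in_sets) simp_all
  then show ?thesis by (simp add: subalgebra_def sigma_XZ_def)
qed

sublocale XZ: finite_measure_subalgebra P "sigma_XZ P"
  by unfold_locales (rule subalgebra_XZ)

lemma design_measurable_XZ: "h \<in> borel_measurable borel \<Longrightarrow> (\<lambda>w. h (design w)) \<in> borel_measurable (sigma_XZ P)"
  unfolding sigma_XZ_def design_def by (rule measurable_compose[OF measurable_vimage_algebra1]) auto

text \<open>A function of \<open>(X, Z)\<close> can be pulled into the conditional expectation of
  the noise, which vanishes.\<close>

lemma noise_orthogonal: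
  assumes h: "h \<in> borel_measurable borel" and int: "integrable P (\<lambda>w. h (design w) * noise b g w)"
  shows "(\<integral>w. h (design w) * noise b g w \<partial>P) = 0"
proof -
  have z: "AE w in P. real_cond_exp P (sigma_XZ P) (noise b g) w = 0"
    using lin by (simp add: linear_model_def)
  have "(\<integral>w. h (design w) * noise b g w \<partial>P) = (\<integral>w. h (design w) * real_cond_exp P (sigma_XZ P) (noise b g) w \<partial>P)"
    by (rule XZ.real_cond_exp_intg(2)[OF int design_measurable_XZ[OF h] measurable_P[OF noise_measurable], symmetric])
  also have "\<dots> = (\<integral>w. 0 \<partial>P)"
    using z by (intro integral_cong_AE) 
      (intro borel_measurable_times borel_measurable_cond_exp2 measurable_P measurable_compose[OF design_measurable h], auto)
  finally show ?thesis by simp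
qed

lemma noise_square_lower_bound:
  assumes h: "h \<in> borel_measurable borel" "\<And>x. 0 \<le> h x" and int: "integrable P (\<lambda>w. h (design w))"
    and int2: "integrable P (\<lambda>w. h (design w) * (noise b g w)\<^sup>2)"
  shows "c * (\<integral>w. h (design w) \<partial>P) \<le> (\<integral>w. h (design w) * (noise b g w)\<^sup>2 \<partial>P)"
proof -
  let ?F = "sigma_XZ P"
  have z: "AE w in P. real_cond_exp P ?F (noise b g) w = 0"
    using lin by (simp add: linear_model_def)
  have n2: "(\<lambda>w. (noise b g w)\<^sup>2) \<in> borel_measurable P" by (intro measurable_P) measurable
  \<comment> \<open>As the conditional mean is 0, the conditional variance is the conditional
    expectation of the squared noise.\<close>
  have "AE w in P. real_cond_exp P ?F (\<lambda>w. (noise b g w - real_cond_exp P ?F (noise b g) w)\<^sup>2) w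
      = real_cond_exp P ?F (\<lambda>w. (noise b g w)\<^sup>2) w"
    using z by (intro XZ.real_cond_exp_cong n2) 
      (auto intro!: borel_measurable_power borel_measurable_diff borel_measurable_cond_exp2 measurable_P[OF noise_measurable])
  then have low: "AE w in P. c \<le> real_cond_exp P ?F (\<lambda>w. (noise b g w)\<^sup>2) w"
    using cond_var by (auto simp: cond_variance_def)
  note I = XZ.real_cond_exp_intg[OF int2 design_measurable_XZ[OF h(1)] n2]
  have "c * (\<integral>w. h (design w) \<partial>P) = (\<integral>w. h (design w) * c \<partial>P)" by simp
  also have "\<dots> \<le> (\<integral>w. h (design w) * real_cond_exp P ?F (\<lambda>w. (noise b g w)\<^sup>2) w \<partial>P)"
  proof (intro integral_mono_AE I(1) integrable_mult_left int)
    show "AE w in P. h (design w) * c \<le> h (design w) * real_cond_exp P ?F (\<lambda>w. (noise b g w)\<^sup>2) w"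
      using low by eventually_elim (rule mult_left_mono[OF _ h(2)])
  qed
  also have "\<dots> = (\<integral>w. h (design w) * (noise b g w)\<^sup>2 \<partial>P)" by (rule I(2))
  finally show ?thesis .
qed

lemma noise_design_mean: "(\<integral>w. noise b g w * (v \<bullet> design w) \<partial>P) = 0"
  "integrable P (\<lambda>w. noise b g w * (v \<bullet> design w))"
proof -
  show int: "integrable P (\<lambda>w. noise b g w * (v \<bullet> design w))"
    by (intro integrable_of_env2[OF _ env_mult[OF noise_le_raw inner_design_le]]) measurable
  show "(\<integral>w. noise b g w * (v \<bullet> design w) \<partial>P) = 0"
    using noise_orthogonal[of "\<lambda>x. v \<bullet> x"] int by (simp add: mult.commute)
qed

lemma gram_bilinear:
  "integrable P (\<lambda>w. (u \<bullet> design w) * (v \<bullet> design w))"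
  by (intro integrable_of_env2[OF _ env_mult[OF inner_design_le inner_design_le]]) measurable

lemma gram_expand:
  "(\<integral>w. (v \<bullet> design w)\<^sup>2 \<partial>P) = (\<Sum>i\<in>Basis. \<Sum>j\<in>Basis. (v \<bullet> i) * (v \<bullet> j) * (\<integral>w. (i \<bullet> design w) * (j \<bullet> design w) \<partial>P))"
proof -
  have "(v \<bullet> design w)\<^sup>2 = (\<Sum>i\<in>Basis. \<Sum>j\<in>Basis. (v \<bullet> i) * (v \<bullet> j) * ((i \<bullet> design w) * (j \<bullet> design w)))" for w
  proof -
    have "v \<bullet> design w = (\<Sum>u\<in>Basis. (v \<bullet> u) * (u \<bullet> design w))"
      by (subst euclidean_inner) (simp add: inner_commute)
    then show ?thesis by (simp add: power2_eq_square sum_product algebra_simps)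
  qed
  then show ?thesis
    using gram_bilinear by (simp add: Bochner_Integration.integral_sum)
qed

text \<open>With \<open>?v = (b, g)\<close>, orthogonality of the noise gives \<open>E (?v \<bullet>
  design)\<^sup>2 = E (Y * (?v \<bullet> design))\<close>. The left side is at least
  \<open>c\<close> times the squared norm of \<open>?v\<close>, the right side at most
  \<open>K\<close> times its norm.\<close>

lemma coefficient_bound: "norm (b, g) \<le> K / c"
proof -
  let ?v = "(b, g)"
  have Y: "\<bar>obs_Y w\<bar> \<le> 1 * envelope w" for w using obs_le_envelope(2) by simp
  have int: "integrable P (\<lambda>w. obs_Y w * (?v \<bullet> design w))"
    by (intro integrable_of_env2[OF _ env_mult[OF Y inner_design_le]]) measurable
  have "c * (norm ?v)\<^sup>2 \<le> (\<integral>w. (?v \<bullet> design w)\<^sup>2 \<partial>P)" by (rule gram)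
  also have "\<dots> = (\<integral>w. obs_Y w * (?v \<bullet> design w) - noise b g w * (?v \<bullet> design w) \<partial>P)"
    by (intro Bochner_Integration.integral_cong) (auto simp: noise_def design_def power2_eq_square algebra_simps)
  also have "\<dots> = (\<integral>w. obs_Y w * (?v \<bullet> design w) \<partial>P)"
    using int noise_design_mean[of ?v] by simp
  also have "\<dots> \<le> (\<integral>w. norm ?v * (envelope w) ^ 4 \<partial>P)"
  proof (intro integral_mono int integrable_mult_right env4_integrable)
    fix w :: "'d obs"
    have "obs_Y w * (?v \<bullet> design w) \<le> \<bar>obs_Y w * (?v \<bullet> design w)\<bar>" by simp
    also have "\<dots> \<le> (1 * norm ?v) * (envelope w)\<^sup>2"
      by (rule env_mult[OF Y inner_design_le])
    also have "\<dots> \<le> norm ?v * (envelope w) ^ 4"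
      using envelope_ge_1[of w] by (simp add: mult_left_mono power_increasing)
    finally show "obs_Y w * (?v \<bullet> design w) \<le> norm ?v * (envelope w) ^ 4" .
  qed
  also have "\<dots> \<le> norm ?v * K"
    using env4_integral by (simp add: mult_left_mono)
  finally have "norm ?v * (c * norm ?v) \<le> norm ?v * K" by (simp add: power2_eq_square mult_ac)
  then have "c * norm ?v \<le> K" using K_ge_1 by (cases "norm ?v = 0") auto
  then show ?thesis using pos by (simp add: field_simps)
qed

lemma XZ_product_integrable:
  "integrable P (\<lambda>w. obs_X w * obs_Z w $ i)" "integrable P (\<lambda>w. obs_Z w $ i * obs_Z w $ j)"
proof -
  note Z = Z_component_le
  have X: "\<bar>obs_X w\<bar> \<le> 1 * envelope w" for w using obs_le_envelope(1) by simp
  show "integrable P (\<lambda>w. obs_X w * obs_Z w $ i)"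
    by (rule integrable_of_env2[OF _ env_mult[OF X Z]]) (intro borel_measurable_times obs_measurable Z_component_measurable)
  show "integrable P (\<lambda>w. obs_Z w $ i * obs_Z w $ j)"
    by (rule integrable_of_env2[OF _ env_mult[OF Z Z]]) (intro borel_measurable_times Z_component_measurable)
qed

text \<open>The definition of \<open>eta\<close> solves the population normal equations of
  \<open>X\<close> on \<open>Z\<close>.\<close>

lemma xi_Z_mean: "(\<integral>w. xi P w * (v \<bullet> obs_Z w) \<partial>P) = 0"
proof -
  have comp: "(\<integral>w. xi P w * obs_Z w $ i \<partial>P) = 0" for i
  proof -
    \<comment> \<open>\<open>matrix_inv\<close> is a choice operator, so its inverse property has to
      be drawn from invertibility.\<close>
    have "\<exists>B. E_ZZ P ** B = mat 1 \<and> B ** E_ZZ P = mat 1" using inv by (simp add: invertible_def)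
    then have inv_r: "E_ZZ P ** matrix_inv (E_ZZ P) = mat 1"
      unfolding matrix_inv_def by (rule someI2_ex) simp
    have "E_ZZ P *v eta P = (E_ZZ P ** matrix_inv (E_ZZ P)) *v E_XZ P"
      by (simp add: eta_def matrix_vector_mul_assoc)
    also have "\<dots> = E_XZ P"
      by (simp add: inv_r)
    finally have "(E_ZZ P *v eta P) $ i = E_XZ P $ i" by simp
    then have e: "(\<Sum>j\<in>UNIV. (\<integral>w. obs_Z w $ i * obs_Z w $ j \<partial>P) * eta P $ j) = (\<integral>w. obs_X w * obs_Z w $ i \<partial>P)"
      by (simp add: matrix_vector_mult_def E_ZZ_def E_XZ_def)
    have "xi P w * obs_Z w $ i = obs_X w * obs_Z w $ i - (\<Sum>j\<in>UNIV. (obs_Z w $ i * obs_Z w $ j) * eta P $ j)" for w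
      by (simp add: xi_def inner_vec_def sum_distrib_left sum_distrib_right algebra_simps)
    then show ?thesis
      using XZ_product_integrable e by (simp add: Bochner_Integration.integral_sum)
  qed
  have "integrable P (\<lambda>w. xi P w * obs_Z w $ i)" for i
    unfolding xi_eq_design by (intro integrable_of_env2[OF _ env_mult[OF inner_design_le Z_component_le]]) measurable
  moreover have "xi P w * (v \<bullet> obs_Z w) = (\<Sum>i\<in>UNIV. v $ i * (xi P w * obs_Z w $ i))" for w
    by (simp add: inner_vec_def sum_distrib_left mult_ac)
  ultimately show ?thesis
    using comp by (simp add: Bochner_Integration.integral_sum)
qed

lemma xi_Z_integrable: "integrable P (\<lambda>w. xi P w * (v \<bullet> obs_Z w))"
  unfolding xi_eq_design
  by (intro integrable_of_env2[OF _ env_mult[OF inner_design_le inner_Z_le]]) measurable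

text \<open>The argument of \<open>coefficient_bound\<close> for the regression of \<open>X\<close>
  on \<open>Z\<close>, testing the Gram form with \<open>(0, eta P)\<close>.\<close>

lemma eta_bound: "norm (eta P) \<le> K / c"
proof -
  let ?h = "eta P"
  let ?v = "(0 :: real, ?h)"
  have v: "?v \<bullet> design w = ?h \<bullet> obs_Z w" for w by (simp add: design_def)
  have X: "\<bar>obs_X w\<bar> \<le> 1 * envelope w" for w using obs_le_envelope(1) by simp
  have int: "integrable P (\<lambda>w. obs_X w * (?h \<bullet> obs_Z w))"
    by (intro integrable_of_env2[OF _ env_mult[OF X inner_Z_le]]) measurable
  have "c * (norm ?h)\<^sup>2 \<le> (\<integral>w. (?h \<bullet> obs_Z w)\<^sup>2 \<partial>P)"
    using gram[of ?v] by (simp add: v norm_prod_def)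
  also have "\<dots> = (\<integral>w. obs_X w * (?h \<bullet> obs_Z w) - xi P w * (?h \<bullet> obs_Z w) \<partial>P)"
    by (intro Bochner_Integration.integral_cong) (auto simp: xi_def power2_eq_square algebra_simps)
  also have "\<dots> = (\<integral>w. obs_X w * (?h \<bullet> obs_Z w) \<partial>P)"
    using int xi_Z_integrable xi_Z_mean by simp
  also have "\<dots> \<le> (\<integral>w. norm ?h * (envelope w) ^ 4 \<partial>P)"
  proof (intro integral_mono int integrable_mult_right env4_integrable)
    fix w :: "'d obs"
    have "obs_X w * (?h \<bullet> obs_Z w) \<le> \<bar>obs_X w * (?h \<bullet> obs_Z w)\<bar>" by simp
    also have "\<dots> \<le> (1 * norm ?h) * (envelope w)\<^sup>2"
      by (rule env_mult[OF X inner_Z_le])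
    also have "\<dots> \<le> norm ?h * (envelope w) ^ 4"
      using envelope_ge_1[of w] by (simp add: mult_left_mono power_increasing)
    finally show "obs_X w * (?h \<bullet> obs_Z w) \<le> norm ?h * (envelope w) ^ 4" .
  qed
  also have "\<dots> \<le> norm ?h * K"
    using env4_integral by (simp add: mult_left_mono)
  finally have "norm ?h * (c * norm ?h) \<le> norm ?h * K" by (simp add: power2_eq_square mult_ac)
  then have "c * norm ?h \<le> K" using K_ge_1 by (cases "norm ?h = 0") auto
  then show ?thesis using pos by (simp add: field_simps)
qed

text \<open>The population residual of \<open>Y\<close> on \<open>Z\<close>:
  \<open>r0_Z_mean\<close> shows that it satisfies the normal equations.\<close>

definition r0 :: "'d obs \<Rightarrow> real" where
  "r0 w = obs_Y w - (g + b *\<^sub>R eta P) \<bullet> obs_Z w"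

lemma r0_eq: "r0 w = noise b g w + b * xi P w"
  by (simp add: r0_def noise_def xi_def inner_add_left algebra_simps)

lemma r0_measurable [measurable]: "r0 \<in> borel_measurable borel"
  unfolding r0_def by measurable

lemma A_nonneg: "0 \<le> A"
  using K_ge_1 pos by (simp add: coef_bound_def)

lemma b_le: "\<bar>b\<bar> \<le> K / c" and g_le: "norm g \<le> K / c"
  using coefficient_bound norm_fst_le[of b g] norm_snd_le[of g b] by auto

lemma eta_le_A: "norm (eta P) \<le> A"
  using eta_bound by (simp add: coef_bound_def add_increasing2)

lemma r0_coef_le_A: "norm (g + b *\<^sub>R eta P) \<le> A"
proof -
  have "norm (g + b *\<^sub>R eta P) \<le> norm g + \<bar>b\<bar> * norm (eta P)"
    using norm_triangle_ineq[of g "b *\<^sub>R eta P"] by simp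
  also have "\<dots> \<le> K / c + (K / c) * (K / c)"
    using g_le b_le eta_bound K_ge_1 pos by (intro add_mono mult_mono) auto
  finally show ?thesis by (simp add: coef_bound_def power2_eq_square)
qed

lemma r0_le: "\<bar>r0 w\<bar> \<le> (1 + A) * envelope w"
  unfolding r0_def by (intro linear_residual_le_envelope r0_coef_le_A obs_le_envelope)

lemma xi_le: "\<bar>xi P w\<bar> \<le> (1 + A) * envelope w"
  unfolding xi_def by (intro linear_residual_le_envelope eta_le_A obs_le_envelope)

lemma noise_le: "\<bar>noise b g w\<bar> \<le> (1 + A) * envelope w"
proof (rule order_trans[OF noise_le_raw mult_right_mono])
  have "norm (b, g) \<le> A" using coefficient_bound by (simp add: coef_bound_def add_increasing2)
  then show "1 + norm (b, g) \<le> 1 + A" by simp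
  show "0 \<le> envelope w" using envelope_ge_1[of w] by simp
qed

lemma r0_Z_mean: "(\<integral>w. r0 w * (v \<bullet> obs_Z w) \<partial>P) = 0"
proof -
  have "(\<integral>w. r0 w * (v \<bullet> obs_Z w) \<partial>P)
      = (\<integral>w. noise b g w * ((0, v) \<bullet> design w) + b * (xi P w * (v \<bullet> obs_Z w)) \<partial>P)"
    by (intro Bochner_Integration.integral_cong) (auto simp: r0_eq design_def algebra_simps)
  then show ?thesis
    using noise_design_mean[of "(0, v)"] xi_Z_integrable xi_Z_mean by simp
qed

section \<open>Variance and absolute deviation of the score\<close>

text \<open>Population counterpart of the products of residuals in \<open>T_stat_eq\<close>.\<close>

definition score :: "'d obs \<Rightarrow> real" where
  "score w = r0 w * xi P w"

definition \<mu> :: real where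
  "\<mu> = integral\<^sup>L P score"

lemma score_measurable [measurable]: "score \<in> borel_measurable borel"
  unfolding score_def by measurable

lemma score_le: "\<bar>score w\<bar> \<le> (1 + A)\<^sup>2 * (envelope w)\<^sup>2"
  unfolding score_def using env_mult[OF r0_le xi_le, of w] by (simp add: power2_eq_square)

lemma score_integrable: "integrable P score"
  using score_measurable score_le by (rule integrable_of_env2)

lemma \<mu>_le: "\<bar>\<mu>\<bar> \<le> (1 + A)\<^sup>2 * K"
proof -
  have "\<bar>\<mu>\<bar> \<le> (\<integral>w. \<bar>score w\<bar> \<partial>P)"
    unfolding \<mu>_def by (rule integral_abs_bound)
  also have "\<dots> \<le> (\<integral>w. (1 + A)\<^sup>2 * (envelope w) ^ 4 \<partial>P)"
  proof (intro integral_mono integrable_abs score_integrable integrable_mult_right env4_integrable)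
    fix w :: "'d obs"
    have "(envelope w)\<^sup>2 \<le> (envelope w) ^ 4"
      using envelope_ge_1[of w] by (intro power_increasing) auto
    then have "(1 + A)\<^sup>2 * (envelope w)\<^sup>2 \<le> (1 + A)\<^sup>2 * (envelope w) ^ 4"
      by (intro mult_left_mono) auto
    then show "\<bar>score w\<bar> \<le> (1 + A)\<^sup>2 * (envelope w) ^ 4"
      using score_le[of w] by linarith
  qed
  also have "\<dots> \<le> (1 + A)\<^sup>2 * K"
    using env4_integral by (simp add: mult_left_mono)
  finally show ?thesis .
qed

lemma centered_score_le: "\<bar>score w - \<mu>\<bar> \<le> M * (envelope w)\<^sup>2"
proof -
  have "1 \<le> (envelope w)\<^sup>2" using envelope_ge_1[of w] by (simp add: one_le_power)
  then have "(1 + A)\<^sup>2 * K * 1 \<le> (1 + A)\<^sup>2 * K * (envelope w)\<^sup>2"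
    using K_ge_1 by (intro mult_left_mono) auto
  then show ?thesis
    using score_le[of w] \<mu>_le by (simp add: score_bound_def algebra_simps)
qed

lemma M_pos: "0 < M"
  using A_nonneg K_ge_1 unfolding score_bound_def by (intro mult_pos_pos) auto

lemma score_variance: "c\<^sup>2 \<le> (\<integral>w. (score w - \<mu>)\<^sup>2 \<partial>P)"
proof -
  let ?z = "noise b g" and ?x = "xi P"
  have x: "?x w = (1, - eta P) \<bullet> design w" for w by (rule xi_eq_design)
  have zz: "integrable P (\<lambda>w. (?x w)\<^sup>2 * (?z w)\<^sup>2)"
    using square_integrable_of_env2(1)[OF _ env_mult[OF xi_le noise_le]] by (simp add: power_mult_distrib)
  have xx: "integrable P (\<lambda>w. (?x w)\<^sup>2)"
    using integrable_of_env2[OF _ env_mult[OF xi_le xi_le]] by (simp add: power2_eq_square)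
  have x4: "integrable P (\<lambda>w. (b * (?x w)\<^sup>2 - \<mu>)\<^sup>2)"
  proof -
    have "integrable P (\<lambda>w. ((?x w)\<^sup>2)\<^sup>2)"
      using square_integrable_of_env2(1)[OF _ env_mult[OF xi_le xi_le]] by (simp add: power2_eq_square)
    then show ?thesis using xx by (simp add: power2_diff power_mult_distrib mult_ac)
  qed
  have cross: "integrable P (\<lambda>w. (?x w * (b * (?x w)\<^sup>2 - \<mu>)) * ?z w)"
  proof -
    have "(\<lambda>w. (?x w * (b * (?x w)\<^sup>2 - \<mu>)) * ?z w)
        = (\<lambda>w. ((score w - \<mu>)\<^sup>2 - (?x w)\<^sup>2 * (?z w)\<^sup>2 - (b * (?x w)\<^sup>2 - \<mu>)\<^sup>2) / 2)"
    proof
      fix w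
      show "(?x w * (b * (?x w)\<^sup>2 - \<mu>)) * ?z w
          = ((score w - \<mu>)\<^sup>2 - (?x w)\<^sup>2 * (?z w)\<^sup>2 - (b * (?x w)\<^sup>2 - \<mu>)\<^sup>2) / 2"
        by (simp add: score_def r0_eq power2_eq_square algebra_simps)
    qed
    moreover have "integrable P (\<lambda>w. (score w - \<mu>)\<^sup>2)"
      by (intro square_integrable_of_env2(1)[OF _ centered_score_le]) measurable
    ultimately show ?thesis using zz x4 by simp
  qed
  define h where "h v = ((1 :: real, - eta P) \<bullet> v) * (b * ((1, - eta P) \<bullet> v)\<^sup>2 - \<mu>)" for v
  have h: "h \<in> borel_measurable borel" 
    unfolding h_def by (intro borel_measurable_continuous_onI continuous_intros)
  have hd: "?x w * (b * (?x w)\<^sup>2 - \<mu>) = h (design w)" for w unfolding x h_def ..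
  have c0: "(\<integral>w. h (design w) * ?z w \<partial>P) = 0"
    using cross unfolding hd by (intro noise_orthogonal h)
  have "c * c \<le> c * (\<integral>w. (?x w)\<^sup>2 \<partial>P)"
  proof (intro mult_left_mono)
    have "1 \<le> norm (1 :: real, - eta P)" using norm_fst_le[of "1 :: real" "- eta P"] by simp
    then have "c * 1 \<le> c * (norm (1 :: real, - eta P))\<^sup>2"
      using pos by (intro mult_left_mono) (auto simp: one_le_power)
    also have "\<dots> \<le> (\<integral>w. (?x w)\<^sup>2 \<partial>P)" unfolding x by (rule gram)
    finally show "c \<le> (\<integral>w. (?x w)\<^sup>2 \<partial>P)" by simp
  qed (use pos in auto)
  also have "\<dots> \<le> (\<integral>w. (?x w)\<^sup>2 * (?z w)\<^sup>2 \<partial>P)"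
    using xx zz unfolding x by (intro noise_square_lower_bound[of "\<lambda>v. ((1, - eta P) \<bullet> v)\<^sup>2"]) auto
  also have "\<dots> = (\<integral>w. (?x w)\<^sup>2 * (?z w)\<^sup>2 + 2 * (h (design w) * ?z w) \<partial>P)"
    using zz cross c0 unfolding hd by simp
  also have "\<dots> \<le> (\<integral>w. (score w - \<mu>)\<^sup>2 \<partial>P)"
  proof (intro integral_mono)
    show "integrable P (\<lambda>w. (?x w)\<^sup>2 * (?z w)\<^sup>2 + 2 * (h (design w) * ?z w))"
      using zz cross unfolding hd by simp
    show "integrable P (\<lambda>w. (score w - \<mu>)\<^sup>2)"
      by (intro square_integrable_of_env2(1)[OF _ centered_score_le]) measurable
    fix w
    have "(score w - \<mu>)\<^sup>2 = (?x w)\<^sup>2 * (?z w)\<^sup>2 + 2 * (h (design w) * ?z w) + (b * (?x w)\<^sup>2 - \<mu>)\<^sup>2"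
      unfolding hd[symmetric] by (simp add: score_def r0_eq power2_eq_square algebra_simps)
    then show "(?x w)\<^sup>2 * (?z w)\<^sup>2 + 2 * (h (design w) * ?z w) \<le> (score w - \<mu>)\<^sup>2" by simp
  qed
  finally show ?thesis by (simp add: power2_eq_square)
qed

text \<open>Truncation at the level \<open>M * R\<close>: the moment of order \<open>4 + \<delta>\<close> makes the
  truncated part of the second moment at most half of it.\<close>

lemma score_abs_deviation: "\<tau> \<le> (\<integral>w. \<bar>score w - \<mu>\<bar> \<partial>P)"
proof -
  \<comment> \<open>\<open>H\<close> solves \<open>M\<^sup>2 / H * K = c\<^sup>2 / 2\<close>. Then
    \<open>R powr (\<delta> / 2) = H\<close>, so wherever the centred score exceeds
    \<open>M * R\<close> the envelope to the power \<delta> is at least \<open>H\<close>.\<close>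
  define H where "H = 2 * M\<^sup>2 * K / c\<^sup>2"
  define R where "R = H powr (2 / \<delta>)"
  have H: "0 < H" using M_pos K_ge_1 pos unfolding H_def by auto
  have R: "0 < R" "R powr (\<delta> / 2) = H"
    using H pos by (auto simp: R_def powr_powr)
  let ?D = "\<lambda>w. score w - \<mu>"
  have point: "(?D w)\<^sup>2 \<le> (M * R) * \<bar>?D w\<bar> + M\<^sup>2 / H * envelope w powr (4 + \<delta>)" for w
  proof (cases "\<bar>?D w\<bar> \<le> M * R")
    case True
    have "(?D w)\<^sup>2 = \<bar>?D w\<bar> * \<bar>?D w\<bar>" by (simp add: power2_eq_square)
    also have "\<dots> \<le> (M * R) * \<bar>?D w\<bar>" using True by (intro mult_right_mono) auto
    also have "\<dots> \<le> (M * R) * \<bar>?D w\<bar> + M\<^sup>2 / H * envelope w powr (4 + \<delta>)" using H by simp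
    finally show ?thesis .
  next
    case False
    let ?Q = "envelope w"
    have Q: "1 \<le> ?Q" by (rule envelope_ge_1)
    have "M * R < M * ?Q\<^sup>2" using False centered_score_le[of w] by linarith
    then have "R \<le> ?Q\<^sup>2" using M_pos by simp
    then have le: "R powr (\<delta> / 2) \<le> (?Q\<^sup>2) powr (\<delta> / 2)"
      using R pos by (intro powr_mono2) auto
    have HQ: "H \<le> ?Q powr \<delta>"
    proof -
      have "?Q\<^sup>2 = ?Q powr 2" using Q by simp
      then have "(?Q\<^sup>2) powr (\<delta> / 2) = ?Q powr \<delta>" by (simp only: powr_powr) simp
      then show ?thesis using le R(2) by simp
    qed
    have "(?D w)\<^sup>2 \<le> M\<^sup>2 * ?Q ^ 4" by (rule square_le_env4[OF centered_score_le])
    also have "\<dots> = M\<^sup>2 / H * (?Q ^ 4 * H)" using H by simp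
    also have "\<dots> \<le> M\<^sup>2 / H * (?Q ^ 4 * ?Q powr \<delta>)"
      using HQ H Q by (intro mult_left_mono) auto
    also have "?Q ^ 4 * ?Q powr \<delta> = ?Q powr (4 + \<delta>)"
      using Q by (simp add: powr_add)
    also have "M\<^sup>2 / H * ?Q powr (4 + \<delta>) \<le> (M * R) * \<bar>?D w\<bar> + M\<^sup>2 / H * ?Q powr (4 + \<delta>)"
      using M_pos R by simp
    finally show ?thesis .
  qed
  have D1: "integrable P (\<lambda>w. \<bar>?D w\<bar>)"
    using score_integrable by simp
  have "c\<^sup>2 \<le> (\<integral>w. (?D w)\<^sup>2 \<partial>P)" by (rule score_variance)
  also have "\<dots> \<le> (\<integral>w. (M * R) * \<bar>?D w\<bar> + M\<^sup>2 / H * envelope w powr (4 + \<delta>) \<partial>P)"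
    by (intro integral_mono square_integrable_of_env2(1)[OF _ centered_score_le] point
        Bochner_Integration.integrable_add integrable_mult_right D1 env_int) measurable
  also have "\<dots> = (M * R) * (\<integral>w. \<bar>?D w\<bar> \<partial>P) + M\<^sup>2 / H * (\<integral>w. envelope w powr (4 + \<delta>) \<partial>P)"
    using D1 env_int by simp
  also have "\<dots> \<le> (M * R) * (\<integral>w. \<bar>?D w\<bar> \<partial>P) + M\<^sup>2 / H * K"
    using env_le H by (intro add_left_mono mult_left_mono) auto
  also have "M\<^sup>2 / H * K = c\<^sup>2 / 2"
    using M_pos K_ge_1 pos by (simp add: H_def field_simps)
  finally have "c\<^sup>2 / 2 \<le> (M * R) * (\<integral>w. \<bar>?D w\<bar> \<partial>P)" by simp
  moreover have "\<tau> = (c\<^sup>2 / 2) / (M * R)" by (simp add: deviation_bound_def R_def H_def)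
  ultimately show ?thesis using M_pos R by (simp add: pos_divide_le_eq mult.commute)
qed

end

section \<open>Moment and eigenvalue hypotheses\<close>

lemma add4_powr_le:
  fixes x y z p :: real
  assumes "0 \<le> x" "0 \<le> y" "0 \<le> z" "0 \<le> p"
  shows "(1 + x + y + z) powr p \<le> 4 powr p * (1 + x powr p + y powr p + z powr p)"
proof -
  define m where "m = max 1 (max x (max y z))"
  have m: "1 + x + y + z \<le> 4 * m" "1 \<le> m" by (auto simp: m_def)
  have "m powr p \<le> 1 + x powr p + y powr p + z powr p"
    unfolding m_def max_def by (auto simp: add_increasing add_increasing2)
  then have "4 powr p * m powr p \<le> 4 powr p * (1 + x powr p + y powr p + z powr p)"
    by (intro mult_left_mono) auto
  moreover have "(1 + x + y + z) powr p \<le> (4 * m) powr p"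
    using assms m by (intro powr_mono2) auto
  moreover have "(4 * m) powr p = 4 powr p * m powr p" using m by (simp add: powr_mult)
  ultimately show ?thesis by linarith
qed

text \<open>The factor with \<open>sqrt d\<close> comes from comparing the Euclidean norm of
  \<open>Z\<close> with its maximum norm, the factor \<open>4 powr p\<close> from splitting a power
  of four summands.\<close>

definition moment_bound :: "real \<Rightarrow> real \<Rightarrow> real \<Rightarrow> real" where
  "moment_bound d p C = 4 powr p * (1 + C + C + sqrt d powr p * C)"

lemma envelope_moment:
  fixes P :: "'d::finite obs measure"
  assumes P: "prob_space P" "sets P = sets borel" and C: "0 \<le> C" and p: "0 \<le> p"
    and Z: "(\<integral>\<^sup>+ w. ennreal (infnorm (obs_Z w) powr p) \<partial>P) \<le> ennreal C"
    and Y: "(\<integral>\<^sup>+ w. ennreal (\<bar>obs_Y w\<bar> powr p) \<partial>P) \<le> ennreal C"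
    and X: "(\<integral>\<^sup>+ w. ennreal (\<bar>obs_X w\<bar> powr p) \<partial>P) \<le> ennreal C"
  shows "integrable P (\<lambda>w. envelope w powr p)"
    and "(\<integral>w. envelope w powr p \<partial>P) \<le> moment_bound (real CARD('d)) p C"
proof -
  interpret prob_space P by fact
  let ?s = "sqrt (real CARD('d))"
  have mP: "f \<in> borel_measurable borel \<Longrightarrow> f \<in> borel_measurable P" for f :: "'d obs \<Rightarrow> real"
    using P(2) by (simp cong: measurable_cong_sets)
  have inf: "(\<lambda>w :: 'd obs. infnorm (obs_Z w)) \<in> borel_measurable borel"
    by (rule measurable_compose[OF obs_measurable(3)]) (intro borel_measurable_continuous_onI continuous_intros)
  have meas: "(\<lambda>w. ennreal (infnorm (obs_Z w) powr p)) \<in> borel_measurable P"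
    "(\<lambda>w. ennreal (\<bar>obs_Y w\<bar> powr p)) \<in> borel_measurable P"
    "(\<lambda>w. ennreal (\<bar>obs_X w\<bar> powr p)) \<in> borel_measurable P"
    using inf by (auto intro!: measurable_compose[OF _ measurable_ennreal] mP)
  have point: "envelope w powr p \<le> 4 powr p * (1 + \<bar>obs_X w\<bar> powr p + \<bar>obs_Y w\<bar> powr p
      + ?s powr p * infnorm (obs_Z w) powr p)" for w :: "'d obs"
  proof -
    obtain x y z where w: "w = (x, y, z)" by (cases w)
    have "norm w \<le> \<bar>x\<bar> + (\<bar>y\<bar> + norm z)"
      using norm_Pair_le[of x "(y, z)"] norm_Pair_le[of y z] by (simp add: w)
    then have "envelope w \<le> 1 + \<bar>obs_X w\<bar> + \<bar>obs_Y w\<bar> + ?s * infnorm (obs_Z w)"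
      using norm_le_infnorm[of z] by (simp add: w envelope_def obs_X_def obs_Y_def obs_Z_def)
    then have "envelope w powr p \<le> (1 + \<bar>obs_X w\<bar> + \<bar>obs_Y w\<bar> + ?s * infnorm (obs_Z w)) powr p"
      using envelope_ge_1[of w] p by (intro powr_mono2) auto
    also have "\<dots> \<le> 4 powr p * (1 + \<bar>obs_X w\<bar> powr p + \<bar>obs_Y w\<bar> powr p + (?s * infnorm (obs_Z w)) powr p)"
      using p by (intro add4_powr_le) (auto simp: infnorm_pos_le)
    finally show ?thesis by (simp add: powr_mult infnorm_pos_le)
  qed
  have "(\<integral>\<^sup>+w. ennreal (envelope w powr p) \<partial>P)
      \<le> (\<integral>\<^sup>+w. ennreal (4 powr p) * (1 + ennreal (\<bar>obs_X w\<bar> powr p) + ennreal (\<bar>obs_Y w\<bar> powr p)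
          + ennreal (?s powr p) * ennreal (infnorm (obs_Z w) powr p)) \<partial>P)"
  proof (rule nn_integral_mono)
    fix w :: "'d obs"
    show "ennreal (envelope w powr p) \<le> ennreal (4 powr p) * (1 + ennreal (\<bar>obs_X w\<bar> powr p)
        + ennreal (\<bar>obs_Y w\<bar> powr p) + ennreal (?s powr p) * ennreal (infnorm (obs_Z w) powr p))"
      using ennreal_leI[OF point[of w]]
      by (simp add: ennreal_mult[symmetric] ennreal_plus[symmetric] ennreal_1[symmetric] infnorm_pos_le
          del: ennreal_plus ennreal_1)
  qed
  also have "\<dots> = ennreal (4 powr p) * (1 + (\<integral>\<^sup>+w. ennreal (\<bar>obs_X w\<bar> powr p) \<partial>P)
      + (\<integral>\<^sup>+w. ennreal (\<bar>obs_Y w\<bar> powr p) \<partial>P)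
      + ennreal (?s powr p) * (\<integral>\<^sup>+w. ennreal (infnorm (obs_Z w) powr p) \<partial>P))"
    using meas by (simp add: nn_integral_cmult nn_integral_add emeasure_space_1)
  also have "\<dots> \<le> ennreal (4 powr p) * (1 + ennreal C + ennreal C + ennreal (?s powr p) * ennreal C)"
    by (intro mult_left_mono add_mono X Y Z) auto
  also have "\<dots> = ennreal (moment_bound (real CARD('d)) p C)"
    unfolding moment_bound_def using C
    by (simp add: ennreal_mult[symmetric] ennreal_plus[symmetric] ennreal_1[symmetric]
        del: ennreal_plus ennreal_1)
  finally have le: "(\<integral>\<^sup>+w. ennreal (envelope w powr p) \<partial>P) \<le> ennreal (moment_bound (real CARD('d)) p C)" .
  show int: "integrable P (\<lambda>w. envelope w powr p)"
  proof (rule integrableI_bounded)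
    show "(\<lambda>w. envelope w powr p) \<in> borel_measurable P" by (rule mP) measurable
    show "(\<integral>\<^sup>+w. ennreal (norm (envelope w powr p)) \<partial>P) < \<infinity>"
      using le by (simp add: le_less_trans[OF _ ennreal_less_top])
  qed
  have "ennreal (\<integral>w. envelope w powr p \<partial>P) = (\<integral>\<^sup>+w. ennreal (envelope w powr p) \<partial>P)"
    using int by (simp add: nn_integral_eq_integral)
  moreover have "0 \<le> moment_bound (real CARD('d)) p C"
    using C by (simp add: moment_bound_def)
  ultimately show "(\<integral>w. envelope w powr p \<partial>P) \<le> moment_bound (real CARD('d)) p C"
    using le by (metis ennreal_le_iff)
qed

text \<open>Reindexing \<open>v\<close> from the product type to \<open>'d option\<close> preserves
  norm and inner product, so the Rayleigh bound for \<open>Sigma_XZ\<close> carries over.\<close>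

lemma (in envelope_law) gram_of_lambda_min:
  assumes "c \<le> lambda_min (Sigma_XZ P)"
  shows "c * (norm v)\<^sup>2 \<le> (\<integral>w. (v \<bullet> design w)\<^sup>2 \<partial>P)"
proof -
  let ?S = "Sigma_XZ P"
  define u :: "real ^ 'd option" where "u = (\<chi> i. case i of None \<Rightarrow> fst v | Some j \<Rightarrow> snd v $ j)"
  have sum_option: "(\<Sum>i\<in>UNIV. f i) = f None + (\<Sum>j\<in>UNIV. f (Some j))" for f :: "'d option \<Rightarrow> real"
    unfolding UNIV_option_conv by (subst sum.insert) (auto simp: sum.reindex)
  have W: "\<bar>obs_W w $ i\<bar> \<le> 1 * envelope w" for w i
    using obs_le_envelope(1)[of w] Z_component_le[of w] by (auto simp: obs_W_def split: option.split)
  have Wm: "(\<lambda>w. obs_W w $ i) \<in> borel_measurable borel" for i :: "'d option"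
    by (cases i) (simp_all add: obs_W_def)
  have int: "integrable P (\<lambda>w. obs_W w $ i * obs_W w $ j)" for i j
    by (intro integrable_of_env2[OF _ env_mult[OF W W]] borel_measurable_times Wm)
  have sym: "transpose ?S = ?S"
    by (simp add: transpose_def Sigma_XZ_def mult.commute)
  have uW: "u \<bullet> obs_W w = v \<bullet> design w" for w
    by (simp add: inner_vec_def sum_option u_def obs_W_def design_def inner_prod_def)
  have nu: "(norm u)\<^sup>2 = (norm v)\<^sup>2"
    unfolding power2_norm_eq_inner
    by (simp add: inner_vec_def sum_option u_def inner_prod_def)
  have "c * (norm u)\<^sup>2 \<le> u \<bullet> (?S *v u)"
    using sym assms by (rule Rayleigh_lower_bound)
  also have "\<dots> = (\<Sum>i\<in>UNIV. \<Sum>j\<in>UNIV. u $ i * u $ j * (\<integral>w. obs_W w $ i * obs_W w $ j \<partial>P))"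
    by (simp add: inner_vec_def matrix_vector_mult_def Sigma_XZ_def sum_distrib_left mult_ac)
  also have "\<dots> = (\<integral>w. (\<Sum>i\<in>UNIV. \<Sum>j\<in>UNIV. u $ i * u $ j * (obs_W w $ i * obs_W w $ j)) \<partial>P)"
    using int by (simp add: Bochner_Integration.integral_sum)
  also have "\<dots> = (\<integral>w. (u \<bullet> obs_W w)\<^sup>2 \<partial>P)"
    by (intro Bochner_Integration.integral_cong) (auto simp: inner_vec_def power2_eq_square sum_product mult_ac)
  finally show ?thesis by (simp add: uW nu)
qed

section \<open>Power\<close>

context linear_law
begin

text \<open>Everything averaged with the fixed tolerance \<epsilon>: Gram entries, the normal
  equations of \<open>Y\<close> and of \<open>X\<close> on \<open>Z\<close>, the score and its
  absolute deviation. Its size is bounded in terms of the dimension alone, so a union bound is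
  uniform in \<open>P\<close>.\<close>

definition limit_family :: "('d obs \<Rightarrow> real) set" where
  "limit_family = (\<lambda>(u, v) w. (u \<bullet> design w) * (v \<bullet> design w)) ` (Basis \<times> Basis)
    \<union> (\<lambda>u w. r0 w * (u \<bullet> obs_Z w)) ` Basis
    \<union> (\<lambda>u w. xi P w * (u \<bullet> obs_Z w)) ` Basis
    \<union> {score, \<lambda>w. \<bar>score w - \<mu>\<bar>}"

text \<open>Kept apart from \<open>limit_family\<close> because its tolerance has to shrink like 1 /
  sqrt n.\<close>

definition noise_family :: "('d obs \<Rightarrow> real) set" where
  "noise_family = (\<lambda>u w. noise b g w * (u \<bullet> design w)) ` Basis"

lemma card_limit_family: "finite limit_family"
  "card limit_family \<le> (1 + CARD('d)) * (1 + CARD('d)) + CARD('d) + CARD('d) + 2"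
proof -
  show "finite limit_family" by (simp add: limit_family_def)
  have "card ({score, \<lambda>w. \<bar>score w - \<mu>\<bar>}) \<le> 2" by (simp add: card_insert_if)
  moreover have "card ((\<lambda>(u, v) w. (u \<bullet> design w) * (v \<bullet> design w) :: real) `
      ((Basis :: (real \<times> (real ^ 'd)) set) \<times> (Basis :: (real \<times> (real ^ 'd)) set))) \<le> (1 + CARD('d)) * (1 + CARD('d))"
    by (rule order_trans[OF card_image_le]) (auto simp: card_cartesian_product)
  moreover have "card ((\<lambda>u w. r0 w * (u \<bullet> obs_Z w)) ` (Basis :: (real ^ 'd) set)) \<le> CARD('d)"
    by (rule order_trans[OF card_image_le]) auto
  moreover have "card ((\<lambda>u w. xi P w * (u \<bullet> obs_Z w)) ` (Basis :: (real ^ 'd) set)) \<le> CARD('d)"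
    by (rule order_trans[OF card_image_le]) auto
  ultimately show "card limit_family \<le> (1 + CARD('d)) * (1 + CARD('d)) + CARD('d) + CARD('d) + 2"
    unfolding limit_family_def by (intro order_trans[OF card_Un_le] add_mono)
qed

lemma card_noise_family: "finite noise_family" "card noise_family \<le> 1 + CARD('d)"
proof -
  show "finite noise_family" by (simp add: noise_family_def)
  show "card noise_family \<le> 1 + CARD('d)"
    unfolding noise_family_def by (rule order_trans[OF card_image_le]) auto
qed

lemma A_le_M: "1 \<le> M" "1 + A \<le> M" "(1 + A)\<^sup>2 \<le> M" "(1 + A) * (1 + A) \<le> M"
proof -
  have 1: "1 * 1 \<le> (1 + A) * (1 + A)" using A_nonneg by (intro mult_mono) auto
  have 2: "(1 + A) * 1 \<le> (1 + A) * (1 + A)" using A_nonneg by (intro mult_left_mono) auto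
  have 3: "(1 + A)\<^sup>2 * 1 \<le> M" unfolding score_bound_def using K_ge_1 by (intro mult_left_mono) auto
  then show "(1 + A)\<^sup>2 \<le> M" by simp
  with 1 2 show "1 \<le> M" "1 + A \<le> M" "(1 + A) * (1 + A) \<le> M" by (auto simp: power2_eq_square)
qed

lemma le_M_env:
  assumes "\<bar>x\<bar> \<le> N * (envelope w)\<^sup>2" "N \<le> M"
  shows "\<bar>x\<bar> \<le> M * (envelope w)\<^sup>2"
  using assms(1) mult_right_mono[OF assms(2), of "(envelope w)\<^sup>2"] by simp

lemma inner_basis_design_le: "u \<in> Basis \<Longrightarrow> \<bar>u \<bullet> design w\<bar> \<le> 1 * envelope w"
  using inner_design_le[of u w] by simp

lemma inner_basis_Z_le: "u \<in> Basis \<Longrightarrow> \<bar>u \<bullet> obs_Z w\<bar> \<le> 1 * envelope w"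
  using inner_Z_le[of u w] by simp

lemma limit_family_bound:
  assumes "f \<in> limit_family"
  shows "f \<in> borel_measurable borel" "\<bar>f w\<bar> \<le> M * (envelope w)\<^sup>2"
proof -
  show "f \<in> borel_measurable borel"
    using assms unfolding limit_family_def by auto
  from assms consider
      (gram) u v where "u \<in> Basis" "v \<in> Basis" "f = (\<lambda>w. (u \<bullet> design w) * (v \<bullet> design w))"
    | (r0) u where "u \<in> Basis" "f = (\<lambda>w. r0 w * (u \<bullet> obs_Z w))"
    | (xi) u where "u \<in> Basis" "f = (\<lambda>w. xi P w * (u \<bullet> obs_Z w))"
    | (score) "f = score" | (abs) "f = (\<lambda>w. \<bar>score w - \<mu>\<bar>)"
    unfolding limit_family_def by auto
  then show "\<bar>f w\<bar> \<le> M * (envelope w)\<^sup>2"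
  proof cases
    case gram
    then show ?thesis
      using le_M_env[OF env_mult[OF inner_basis_design_le inner_basis_design_le], of u v w] A_le_M by simp
  next
    case r0
    then show ?thesis
      using le_M_env[OF env_mult[OF r0_le inner_basis_Z_le], of u w] A_le_M by simp
  next
    case xi
    then show ?thesis
      using le_M_env[OF env_mult[OF xi_le inner_basis_Z_le], of u w] A_le_M by simp
  next
    case score
    then show ?thesis using le_M_env[OF score_le, of w] A_le_M by simp
  next
    case abs
    then show ?thesis using centered_score_le[of w] by simp
  qed
qed

lemma noise_family_bound:
  assumes "f \<in> noise_family"
  shows "f \<in> borel_measurable borel" "\<bar>f w\<bar> \<le> M * (envelope w)\<^sup>2"
proof -
  from assms obtain u where u: "u \<in> Basis" "f = (\<lambda>w. noise b g w * (u \<bullet> design w))"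
    unfolding noise_family_def by auto
  show "f \<in> borel_measurable borel" unfolding u(2) by measurable
  show "\<bar>f w\<bar> \<le> M * (envelope w)\<^sup>2"
    using le_M_env[OF env_mult[OF noise_le inner_basis_design_le[OF u(1)]], of w] A_le_M u(2) by simp
qed

definition deviates :: "nat set \<Rightarrow> nat set \<Rightarrow> ('d obs \<Rightarrow> real) set \<Rightarrow> real \<Rightarrow> (nat \<Rightarrow> 'd obs) set" where
  "deviates I J F t = (\<Union>f\<in>F. {S \<in> space (PiM I (\<lambda>_. P)). \<not> \<bar>avg J (\<lambda>i. f (S i)) - integral\<^sup>L P f\<bar> < t})"

lemma deviates_prob:
  assumes I: "finite I" and J: "J \<subseteq> I" "J \<noteq> {}" and t: "0 < t"
    and F: "finite F" "\<And>f. f \<in> F \<Longrightarrow> f \<in> borel_measurable borel"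
      "\<And>f w. f \<in> F \<Longrightarrow> \<bar>f w\<bar> \<le> M * (envelope w)\<^sup>2"
  shows "deviates I J F t \<in> sets (PiM I (\<lambda>_. P))"
    and "measure (PiM I (\<lambda>_. P)) (deviates I J F t) \<le> real (card F) * (M\<^sup>2 * K / (real (card J) * t\<^sup>2))"
proof -
  let ?PS = "PiM I (\<lambda>_. P)"
  interpret PS: prob_space ?PS by (intro prob_space_PiM prob_space_axioms)
  let ?B = "\<lambda>f. {S \<in> space ?PS. \<not> \<bar>avg J (\<lambda>i. f (S i)) - integral\<^sup>L P f\<bar> < t}"
  have meas: "?B f \<in> sets ?PS" if "f \<in> F" for f
  proof -
    have [measurable]: "(\<lambda>S. avg J (\<lambda>i. f (S i))) \<in> borel_measurable ?PS"
      using that J F by (intro avg_PiM_measurable measurable_P) auto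
    show ?thesis by measurable
  qed
  then show "deviates I J F t \<in> sets ?PS"
    unfolding deviates_def using F(1) by (intro sets.finite_UN) auto
  have "measure ?PS (deviates I J F t) \<le> (\<Sum>f\<in>F. measure ?PS (?B f))"
    unfolding deviates_def using F(1) meas by (intro PS.finite_measure_subadditive_finite) auto
  also have "\<dots> \<le> (\<Sum>f\<in>F. M\<^sup>2 * K / (real (card J) * t\<^sup>2))"
  proof (rule sum_mono)
    fix f assume f: "f \<in> F"
    note sq = square_integrable_of_env2[OF F(2)[OF f] F(3)[OF f]]
    show "measure ?PS (?B f) \<le> M\<^sup>2 * K / (real (card J) * t\<^sup>2)"
      by (rule avg_deviation_prob[OF prob_space_axioms I J measurable_P[OF F(2)[OF f]] sq t])
  qed
  finally show "measure ?PS (deviates I J F t) \<le> real (card F) * (M\<^sup>2 * K / (real (card J) * t\<^sup>2))"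
    by simp
qed

lemma gram_sample_bound:
  assumes S: "S \<in> space (PiM I (\<lambda>_. P))" "S \<notin> deviates I J limit_family \<epsilon>"
    and \<epsilon>: "\<epsilon> * (real (1 + CARD('d)))\<^sup>2 \<le> c / 2"
  shows "(c / 2) * (norm v)\<^sup>2 \<le> avg J (\<lambda>i. (v \<bullet> design (S i))\<^sup>2)"
proof (rule gram_lower_bound[where t = \<epsilon>])
  fix u v :: "real \<times> (real ^ 'd)" assume uv: "u \<in> Basis" "v \<in> Basis"
  have "(\<lambda>w. (u \<bullet> design w) * (v \<bullet> design w)) \<in> limit_family"
    using uv by (auto simp: limit_family_def)
  then show "\<bar>avg J (\<lambda>i. (u \<bullet> design (S i)) * (v \<bullet> design (S i)))
      - (\<integral>w. (u \<bullet> design w) * (v \<bullet> design w) \<partial>P)\<bar> \<le> \<epsilon>"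
    using S unfolding deviates_def by force
next
  fix v :: "real \<times> (real ^ 'd)"
  show "c * (norm v)\<^sup>2 \<le> (\<Sum>i\<in>Basis. \<Sum>j\<in>Basis. (v \<bullet> i) * (v \<bullet> j) * (\<integral>w. (i \<bullet> design w) * (j \<bullet> design w) \<partial>P))"
    using gram[of v] by (simp only: gram_expand)
next
  show "\<epsilon> * (real DIM(real \<times> (real ^ 'd)))\<^sup>2 \<le> c / 2" using \<epsilon> by simp
qed

lemma noise_sample_bound:
  assumes S: "S \<in> space (PiM I (\<lambda>_. P))" "S \<notin> deviates I J noise_family t" and u: "u \<in> Basis"
  shows "\<bar>avg J (\<lambda>i. noise b g (S i) * (u \<bullet> design (S i)))\<bar> \<le> t"
proof -
  have "(\<lambda>w. noise b g w * (u \<bullet> design w)) \<in> noise_family"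
    using u by (auto simp: noise_family_def)
  then have "\<bar>avg J (\<lambda>i. noise b g (S i) * (u \<bullet> design (S i))) - (\<integral>w. noise b g w * (u \<bullet> design w) \<partial>P)\<bar> \<le> t"
    using S unfolding deviates_def by force
  then show ?thesis by (simp add: noise_design_mean)
qed

text \<open>Union bound over five bad events: \<open>limit_family\<close> and
  \<open>noise_family\<close> on each half, and a large empirical fourth moment of the envelope on
  the first. Off these events \<open>T_stat_exceeds\<close> applies with \<open>k = c / 2\<close>,
  and with \<open>L\<close> as the empirical moment bound.\<close>

lemma power_lower_bound:
  fixes n :: nat
  defines "D \<equiv> 1 + CARD('d)"
  assumes I: "finite I" "I1 \<subseteq> I" "I2 \<subseteq> I" "card I1 = n" "card I2 = n" and n: "0 < n"
    and \<epsilon>: "0 < \<epsilon>" "\<epsilon> * (real D)\<^sup>2 \<le> c / 2" "\<epsilon>' = real CARD('d) * \<epsilon> / (c / 2)" "\<epsilon>' \<le> 1"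
      "2 * (\<epsilon>' * (3 + 2 * A) * L) + 2 * \<epsilon> < \<tau>"
    and t: "0 < t" and L: "0 < L"
    and b: "real D * t < (c / 2) * \<bar>b\<bar>"
    and z: "\<bar>z\<bar> * ((2 + A)\<^sup>2 * sqrt L) < sqrt (real n) * ((c / 2) * \<bar>b\<bar> - real D * t)"
  shows "1 - (2 * (real (D * D + CARD('d) + CARD('d) + 2) * (M\<^sup>2 * K / (real n * \<epsilon>\<^sup>2)))
      + 2 * (real D * (M\<^sup>2 * K / (real n * t\<^sup>2))) + K / L)
    \<le> measure (PiM I (\<lambda>_. P)) {S \<in> space (PiM I (\<lambda>_. P)). z < T_stat I1 I2 S}"
proof -
  let ?PS = "PiM I (\<lambda>_. P)"
  interpret PS: prob_space ?PS by (intro prob_space_PiM prob_space_axioms)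
  have fin: "finite I1" "I1 \<noteq> {}" "finite I2" "I2 \<noteq> {}"
    using I n by (auto intro: finite_subset)
  define B1 where "B1 = deviates I I1 limit_family \<epsilon>"
  define B2 where "B2 = deviates I I2 limit_family \<epsilon>"
  define B3 where "B3 = deviates I I1 noise_family t"
  define B4 where "B4 = deviates I I2 noise_family t"
  define B5 where "B5 = {S \<in> space ?PS. \<not> avg I1 (\<lambda>i. (envelope (S i)) ^ 4) < L}"
  have lim: "deviates I J limit_family \<epsilon> \<in> sets ?PS"
    "measure ?PS (deviates I J limit_family \<epsilon>) \<le> real (card limit_family) * (M\<^sup>2 * K / (real (card J) * \<epsilon>\<^sup>2))"
    if "J \<subseteq> I" "J \<noteq> {}" for J
    by (intro deviates_prob I(1) that \<epsilon>(1) card_limit_family(1) limit_family_bound; assumption)+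
  have noi: "deviates I J noise_family t \<in> sets ?PS"
    "measure ?PS (deviates I J noise_family t) \<le> real (card noise_family) * (M\<^sup>2 * K / (real (card J) * t\<^sup>2))"
    if "J \<subseteq> I" "J \<noteq> {}" for J
    by (intro deviates_prob I(1) that t card_noise_family(1) noise_family_bound; assumption)+
  have sets: "B1 \<in> sets ?PS" "B2 \<in> sets ?PS" "B3 \<in> sets ?PS" "B4 \<in> sets ?PS"
    unfolding B1_def B2_def B3_def B4_def using lim(1) noi(1) I fin by auto
  have B5: "B5 \<in> sets ?PS"
  proof -
    have [measurable]: "(\<lambda>S. avg I1 (\<lambda>i. (envelope (S i)) ^ 4)) \<in> borel_measurable ?PS"
      using I by (intro avg_PiM_measurable measurable_P) measurable
    show ?thesis unfolding B5_def by measurable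
  qed
  have Tm: "{S \<in> space ?PS. z < T_stat I1 I2 S} \<in> sets ?PS"
  proof -
    have [measurable]: "T_stat I1 I2 \<in> borel_measurable ?PS"
      using I fin by (intro T_stat_measurable sets_P) auto
    show ?thesis by measurable
  qed
  have K0: "0 \<le> M\<^sup>2 * K / (real n * x\<^sup>2)" for x using K_ge_1 by simp
  have "measure ?PS (deviates I J limit_family \<epsilon>)
      \<le> real (D * D + CARD('d) + CARD('d) + 2) * (M\<^sup>2 * K / (real n * \<epsilon>\<^sup>2))"
    if "J \<subseteq> I" "J \<noteq> {}" "card J = n" for J
  proof -
    have "measure ?PS (deviates I J limit_family \<epsilon>) \<le> real (card limit_family) * (M\<^sup>2 * K / (real n * \<epsilon>\<^sup>2))"
      using lim(2)[OF that(1,2)] that(3) by simp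
    also have "\<dots> \<le> real (D * D + CARD('d) + CARD('d) + 2) * (M\<^sup>2 * K / (real n * \<epsilon>\<^sup>2))"
      unfolding D_def using card_limit_family(2) by (intro mult_right_mono K0 of_nat_mono)
    finally show ?thesis .
  qed
  then have P12: "measure ?PS B1 \<le> real (D * D + CARD('d) + CARD('d) + 2) * (M\<^sup>2 * K / (real n * \<epsilon>\<^sup>2))"
    "measure ?PS B2 \<le> real (D * D + CARD('d) + CARD('d) + 2) * (M\<^sup>2 * K / (real n * \<epsilon>\<^sup>2))"
    unfolding B1_def B2_def using I fin by blast+
  have "measure ?PS (deviates I J noise_family t) \<le> real D * (M\<^sup>2 * K / (real n * t\<^sup>2))"
    if "J \<subseteq> I" "J \<noteq> {}" "card J = n" for J
  proof -
    have "measure ?PS (deviates I J noise_family t) \<le> real (card noise_family) * (M\<^sup>2 * K / (real n * t\<^sup>2))"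
      using noi(2)[OF that(1,2)] that(3) by simp
    also have "\<dots> \<le> real D * (M\<^sup>2 * K / (real n * t\<^sup>2))"
      unfolding D_def using card_noise_family(2) by (intro mult_right_mono K0 of_nat_mono)
    finally show ?thesis .
  qed
  then have P34: "measure ?PS B3 \<le> real D * (M\<^sup>2 * K / (real n * t\<^sup>2))"
    "measure ?PS B4 \<le> real D * (M\<^sup>2 * K / (real n * t\<^sup>2))"
    unfolding B3_def B4_def using I fin by blast+
  have P5: "measure ?PS B5 \<le> K / L"
    unfolding B5_def
    by (rule avg_Markov[OF prob_space_axioms I(1,2) fin(2) env4_integrable _ env4_integral L]) simp
  have incl: "space ?PS - {S \<in> space ?PS. z < T_stat I1 I2 S} \<subseteq> B1 \<union> B2 \<union> B3 \<union> B4 \<union> B5"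
  proof (rule ccontr)
    assume "\<not> ?thesis"
    then obtain S where S: "S \<in> space ?PS" "\<not> z < T_stat I1 I2 S"
      and nB: "S \<notin> B1" "S \<notin> B2" "S \<notin> B3" "S \<notin> B4" "S \<notin> B5" by blast
    have limf: "\<bar>avg I1 (\<lambda>i. f (S i)) - integral\<^sup>L P f\<bar> < \<epsilon>" if "f \<in> limit_family" for f
      using nB(1) S(1) that unfolding B1_def deviates_def by blast
    have "z < T_stat I1 I2 S"
    proof (rule T_stat_exceeds[where b = b and g = g and h = "eta P" and k = "c / 2" and t = t and A = A
          and K = L and \<epsilon> = \<epsilon> and \<epsilon>' = \<epsilon>' and \<mu> = \<mu> and \<tau> = \<tau>, folded r0_def xi_def])
      show "finite I1" "I1 \<noteq> {}" "finite I2" "I2 \<noteq> {}" by fact+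
      show "0 < c / 2" using pos by simp
      show "c / 2 * (norm v)\<^sup>2 \<le> avg I1 (\<lambda>i. (v \<bullet> design (S i))\<^sup>2)" for v
        using nB(1) \<epsilon>(2) unfolding B1_def D_def by (intro gram_sample_bound[OF S(1)])
      show "c / 2 * (norm v)\<^sup>2 \<le> avg I2 (\<lambda>i. (v \<bullet> design (S i))\<^sup>2)" for v
        using nB(2) \<epsilon>(2) unfolding B2_def D_def by (intro gram_sample_bound[OF S(1)])
      show "\<bar>avg I1 (\<lambda>i. noise b g (S i) * (u \<bullet> design (S i)))\<bar> \<le> t" if "u \<in> Basis" for u
        using nB(3) that unfolding B3_def by (intro noise_sample_bound[OF S(1)])
      show "\<bar>avg I2 (\<lambda>i. noise b g (S i) * (u \<bullet> design (S i)))\<bar> \<le> t" if "u \<in> Basis" for u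
        using nB(4) that unfolding B4_def by (intro noise_sample_bound[OF S(1)])
      show "norm (g + b *\<^sub>R eta P) \<le> A" by (rule r0_coef_le_A)
      show "norm (eta P) \<le> A" by (rule eta_le_A)
      show "avg I1 (\<lambda>i. (envelope (S i)) ^ 4) \<le> L"
        using nB(5) S(1) unfolding B5_def by simp
      show "\<bar>avg I1 (\<lambda>i. r0 (S i) * (u \<bullet> obs_Z (S i)))\<bar> \<le> \<epsilon>" if "u \<in> Basis" for u
        using limf[of "\<lambda>w. r0 w * (u \<bullet> obs_Z w)"] that by (simp add: limit_family_def r0_Z_mean)
      show "\<bar>avg I1 (\<lambda>i. xi P (S i) * (u \<bullet> obs_Z (S i)))\<bar> \<le> \<epsilon>" if "u \<in> Basis" for u
        using limf[of "\<lambda>w. xi P w * (u \<bullet> obs_Z w)"] that by (simp add: limit_family_def xi_Z_mean)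
      show "\<bar>avg I1 (\<lambda>i. r0 (S i) * xi P (S i)) - \<mu>\<bar> \<le> \<epsilon>"
        using limf[of score] by (simp add: limit_family_def \<mu>_def flip: score_def)
      show "\<tau> - \<epsilon> \<le> avg I1 (\<lambda>i. \<bar>r0 (S i) * xi P (S i) - \<mu>\<bar>)"
        using limf[of "\<lambda>w. \<bar>score w - \<mu>\<bar>"] score_abs_deviation
        by (simp add: limit_family_def flip: score_def)
      show "real CARD('d) * \<epsilon> / (c / 2) \<le> \<epsilon>'" using \<epsilon>(3) by simp
      show "\<epsilon>' \<le> 1" "2 * (\<epsilon>' * (3 + 2 * A) * L) + 2 * \<epsilon> < \<tau>" by fact+
      show "real DIM(real \<times> (real ^ 'd)) * t < c / 2 * \<bar>b\<bar>" using b by (simp add: D_def)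
      show "\<bar>z\<bar> * ((2 + A)\<^sup>2 * sqrt L) < sqrt (real (card I1)) * (c / 2 * \<bar>b\<bar> - real DIM(real \<times> (real ^ 'd)) * t)"
        using z I(4) by (simp add: D_def)
    qed
    with S(2) show False by simp
  qed
  have "1 - measure ?PS {S \<in> space ?PS. z < T_stat I1 I2 S}
      = measure ?PS (space ?PS - {S \<in> space ?PS. z < T_stat I1 I2 S})"
    by (rule PS.prob_compl[OF Tm, symmetric])
  also have "\<dots> \<le> measure ?PS (B1 \<union> B2 \<union> B3 \<union> B4 \<union> B5)"
    using sets B5 by (intro PS.finite_measure_mono incl) auto
  also have "\<dots> \<le> measure ?PS B1 + measure ?PS B2 + measure ?PS B3 + measure ?PS B4 + measure ?PS B5"
    using sets B5 by (intro order_trans[OF measure_Un_le] add_mono order_refl) auto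
  finally show ?thesis using P12 P34 P5 by linarith
qed

end

section \<open>Choice of constants and passage to the limit\<close>

lemma linear_law_intro:
  fixes P :: "'d::finite obs measure"
  assumes "prob_space P" "sets P = sets borel" "linear_model P b g"
    and "0 < C" "0 < \<delta>" "0 < c"
    and "(\<integral>\<^sup>+ w. ennreal (infnorm (obs_Z w) powr (4 + \<delta>)) \<partial>P) \<le> ennreal C"
      "(\<integral>\<^sup>+ w. ennreal (\<bar>obs_Y w\<bar> powr (4 + \<delta>)) \<partial>P) \<le> ennreal C"
      "(\<integral>\<^sup>+ w. ennreal (\<bar>obs_X w\<bar> powr (4 + \<delta>)) \<partial>P) \<le> ennreal C"
    and "invertible (E_ZZ P)"
    and "AE w in P. cond_variance P (sigma_XZ P) (noise b g) w \<ge> c" "lambda_min (Sigma_XZ P) \<ge> c"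
  shows "linear_law P (moment_bound (real CARD('d)) (4 + \<delta>) C) \<delta> b g c"
proof -
  interpret prob_space P by fact
  have p: "0 \<le> C" "0 \<le> 4 + \<delta>" using assms by auto
  interpret envelope_law P "moment_bound (real CARD('d)) (4 + \<delta>) C" \<delta>
    using envelope_moment[OF assms(1,2) p assms(7-9)] assms(2,5) by unfold_locales auto
  show ?thesis
    using assms gram_of_lambda_min by unfold_locales auto
qed

lemma small_multiples:
  fixes a1 a2 a3 b1 b2 b3 :: real
  assumes "0 < a1" "0 < a2" "0 < a3" "0 < b1" "0 < b2" "0 < b3"
  obtains \<epsilon> where "0 < \<epsilon>" "\<epsilon> * a1 \<le> b1" "\<epsilon> * a2 \<le> b2" "\<epsilon> * a3 < b3"
proof -
  define \<epsilon> where "\<epsilon> = min (b1 / a1) (min (b2 / a2) (b3 / (2 * a3)))"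
  have "0 < \<epsilon>" using assms by (simp add: \<epsilon>_def)
  moreover have "\<epsilon> \<le> b1 / a1" "\<epsilon> \<le> b2 / a2" "\<epsilon> \<le> b3 / (2 * a3)" by (auto simp: \<epsilon>_def)
  then have "\<epsilon> * a1 \<le> b1" "\<epsilon> * a2 \<le> b2" "\<epsilon> * a3 \<le> b3 / 2"
    using assms by (auto simp: field_simps)
  ultimately show ?thesis using that assms by auto
qed

text \<open>The five losses of \<open>power_lower_bound\<close> are each kept within
  \<open>p / 5\<close>. The order of choices matters: \<open>L\<close> from \<open>p\<close>, then
  \<epsilon> from \<open>L\<close>, then \<open>N\<close> from \<epsilon>, and finally
  \<open>\<kappa>0\<close> from \<open>T0\<close>, \<open>L\<close> and \<open>z\<close>. In
  particular \<open>N\<close> is independent of \<kappa>.\<close>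

lemma uniform_power:
  fixes \<P>s :: "'d::finite obs measure set"
  assumes law: "\<And>P. P \<in> \<P>s \<Longrightarrow> linear_law P K \<delta> (\<beta> P) (\<gamma> P) c"
    and pos: "1 \<le> K" "0 < \<delta>" "0 < c"
    and partition: "\<And>n. I1 n \<union> I2 n = {1..2 * n} \<and> I1 n \<inter> I2 n = {} \<and> card (I1 n) = n \<and> card (I2 n) = n"
    and p: "0 < p"
  shows "\<exists>\<kappa>0 N. \<forall>\<kappa>\<ge>\<kappa>0. \<forall>n\<ge>N. \<forall>P\<in>alternatives \<P>s \<beta> n \<kappa>.
    1 - p \<le> \<P>(S in PiM {1..2 * n} (\<lambda>_. P). z < T_stat (I1 n) (I2 n) S)"
proof -
  define A M \<tau> where "A = coef_bound K c" and "M = score_bound K c" and "\<tau> = deviation_bound K \<delta> c"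
  define D where "D = 1 + CARD('d)"
  define B where "B = M\<^sup>2 * K"
  define k where "k = c / 2"
  have k: "0 < k" using pos by (simp add: k_def)
  have A: "0 \<le> A" using pos by (simp add: A_def coef_bound_def)
  have M: "0 < M" using pos A unfolding M_def score_bound_def A_def by (intro mult_pos_pos) auto
  have B: "0 < B" using M pos by (simp add: B_def)
  have \<tau>: "0 < \<tau>"
    using M B pos unfolding \<tau>_def deviation_bound_def M_def[symmetric] by (intro divide_pos_pos mult_pos_pos) auto
  define L where "L = 5 * K / p"
  have L: "0 < L" using pos p by (simp add: L_def)
  define d' where "d' = real CARD('d) / k"
  have d': "0 < d'" using k by (simp add: d'_def)
  obtain \<epsilon> where \<epsilon>: "0 < \<epsilon>" "\<epsilon> * (real D)\<^sup>2 \<le> k" "\<epsilon> * d' \<le> 1" "\<epsilon> * (2 * (d' * (3 + 2 * A) * L) + 2) < \<tau>"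
  proof (rule small_multiples[of "(real D)\<^sup>2" d' "2 * (d' * (3 + 2 * A) * L) + 2" k 1 \<tau>])
    show "0 < (real D)\<^sup>2" by (simp add: D_def)
    show "0 < 2 * (d' * (3 + 2 * A) * L) + 2"
      using d' A L by (intro add_nonneg_pos mult_nonneg_nonneg) auto
  qed (use d' k \<tau> in simp_all)
  define N1 where "N1 = real (D * D + CARD('d) + CARD('d) + 2)"
  \<comment> \<open>With \<open>t = T0 / sqrt n\<close>, the Chebyshev loss for the noise on one
    half equals \<open>p / 5\<close> for every positive \<open>n\<close>.\<close>
  define T0 where "T0 = sqrt (5 * real D * B / p)"
  have T0: "0 < T0" using B p by (simp add: T0_def D_def)
  define N where "N = max 1 (nat \<lceil>5 * N1 * B / (p * \<epsilon>\<^sup>2)\<rceil>)"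
  \<comment> \<open>The noise tolerance plus the critical value times the bound on the denominator,
    on the scale of sqrt n; the final 1 makes the comparison strict.\<close>
  define \<kappa>0 where "\<kappa>0 = (real D * T0 + \<bar>z\<bar> * ((2 + A)\<^sup>2 * sqrt L) + 1) / k"
  show ?thesis
  proof (intro exI[of _ \<kappa>0] exI[of _ N] allI impI ballI)
    fix \<kappa> :: real and n :: nat and P
    assume \<kappa>: "\<kappa>0 \<le> \<kappa>" and n: "N \<le> n" and "P \<in> alternatives \<P>s \<beta> n \<kappa>"
    then have P: "P \<in> \<P>s" and \<beta>: "\<kappa> / sqrt (real n) \<le> \<bar>\<beta> P\<bar>" by (auto simp: alternatives_def)
    interpret linear_law P K \<delta> "\<beta> P" "\<gamma> P" c using P by (rule law)
    have n0: "0 < n" using n by (simp add: N_def)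
    define t where "t = T0 / sqrt (real n)"
    have t: "0 < t" using T0 n0 by (simp add: t_def)
    have kk: "real D * T0 + \<bar>z\<bar> * ((2 + A)\<^sup>2 * sqrt L) + 1 \<le> k * \<kappa>"
      using \<kappa> k by (simp add: \<kappa>0_def pos_divide_le_eq mult.commute)
    have "k * \<kappa> \<le> k * (sqrt (real n) * \<bar>\<beta> P\<bar>)"
      using \<beta> n0 k by (intro mult_left_mono) (auto simp: pos_divide_le_eq mult.commute)
    then have s: "real D * T0 + \<bar>z\<bar> * ((2 + A)\<^sup>2 * sqrt L) < sqrt (real n) * (k * \<bar>\<beta> P\<bar>)"
      using kk by (simp add: mult_ac)
    have sT: "sqrt (real n) * (real D * t) = real D * T0" using n0 by (simp add: t_def)
    have z: "\<bar>z\<bar> * ((2 + A)\<^sup>2 * sqrt L) < sqrt (real n) * (k * \<bar>\<beta> P\<bar> - real D * t)"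
      using s unfolding right_diff_distrib sT by linarith
    have b: "real D * t < k * \<bar>\<beta> P\<bar>"
    proof -
      have "0 \<le> \<bar>z\<bar> * ((2 + A)\<^sup>2 * sqrt L)" using L by simp
      then have "0 < sqrt (real n) * (k * \<bar>\<beta> P\<bar> - real D * t)" using z by linarith
      then show ?thesis using n0 by (simp add: zero_less_mult_iff)
    qed
    have fin: "I1 n \<subseteq> {1..2 * n}" "I2 n \<subseteq> {1..2 * n}" "card (I1 n) = n" "card (I2 n) = n"
      using partition[of n] by auto
    have "2 * (d' * \<epsilon> * (3 + 2 * A) * L) + 2 * \<epsilon> < \<tau>"
      using \<epsilon>(4) by (simp add: algebra_simps)
    then have "1 - (2 * (N1 * (B / (real n * \<epsilon>\<^sup>2))) + 2 * (real D * (B / (real n * t\<^sup>2))) + K / L)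
      \<le> \<P>(S in PiM {1..2 * n} (\<lambda>_. P). z < T_stat (I1 n) (I2 n) S)"
      unfolding N1_def B_def M_def D_def
      using \<epsilon> n0 t L b z fin
      by (intro power_lower_bound[where \<epsilon>' = "d' * \<epsilon>"])
        (auto simp: D_def A_def \<tau>_def k_def d'_def mult.commute)
    moreover have "N1 * (B / (real n * \<epsilon>\<^sup>2)) \<le> p / 5"
    proof -
      have "5 * N1 * B / (p * \<epsilon>\<^sup>2) \<le> real n" using n by (simp add: N_def)
      then show ?thesis using \<epsilon>(1) p n0 by (simp add: field_simps)
    qed
    moreover have "real D * (B / (real n * t\<^sup>2)) = p / 5"
    proof -
      have "real n * t\<^sup>2 = T0\<^sup>2" using n0 by (simp add: t_def power_divide)
      also have "\<dots> = 5 * real D * B / p" using B p by (simp add: T0_def)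
      finally have "real n * t\<^sup>2 = 5 * real D * B / p" .
      moreover have "0 < real D" by (simp add: D_def)
      ultimately show ?thesis using B p by simp
    qed
    moreover have "K / L = p / 5" using K_ge_1 by (simp add: L_def)
    ultimately show "1 - p \<le> \<P>(S in PiM {1..2 * n} (\<lambda>_. P). z < T_stat (I1 n) (I2 n) S)" by linarith
  qed
qed

text \<open>For fixed \<kappa> the limit in \<open>n\<close> may fail to exist, so the iterated
  limit is stated for both the lower and the upper limit in \<open>n\<close>.\<close>

theorem proposition1:
  fixes \<P>s :: "'d::finite obs measure set"
    and \<beta> :: "'d obs measure \<Rightarrow> real"
    and \<gamma> :: "'d obs measure \<Rightarrow> real ^ 'd"
    and I1 I2 :: "nat \<Rightarrow> nat set"
    and C \<delta> c \<alpha> :: real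
  assumes distributions: "\<And>P. P \<in> \<P>s \<Longrightarrow> prob_space P \<and> sets P = sets borel"
    and model: "\<And>P. P \<in> \<P>s \<Longrightarrow> linear_model P (\<beta> P) (\<gamma> P)"
    and pos: "C > 0" "\<delta> > 0" "c > 0"
    and moments: "\<And>P. P \<in> \<P>s \<Longrightarrow>
        (\<integral>\<^sup>+ w. ennreal (infnorm (obs_Z w) powr (4 + \<delta>)) \<partial>P) \<le> ennreal C \<and>
        (\<integral>\<^sup>+ w. ennreal (\<bar>obs_Y w\<bar> powr (4 + \<delta>)) \<partial>P) \<le> ennreal C \<and>
        (\<integral>\<^sup>+ w. ennreal (\<bar>obs_X w\<bar> powr (4 + \<delta>)) \<partial>P) \<le> ennreal C"
    and invertible_ZZ: "\<And>P. P \<in> \<P>s \<Longrightarrow> invertible (E_ZZ P)"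
    and nondegenerate: "\<And>P. P \<in> \<P>s \<Longrightarrow>
        (AE w in P. cond_variance P (sigma_XZ P) (noise (\<beta> P) (\<gamma> P)) w \<ge> c) \<and>
        prob_space.variance P (xi P) \<ge> c \<and>
        lambda_min (Sigma_XZ P) \<ge> c \<and>
        lambda_min (Theta P) \<ge> c"
    and partition: "\<And>n. I1 n \<union> I2 n = {1..2 * n} \<and> I1 n \<inter> I2 n = {} \<and>
        card (I1 n) = n \<and> card (I2 n) = n"
    and level: "0 < \<alpha>" "\<alpha> < 1"
  shows "((\<lambda>\<kappa>. liminf (\<lambda>n. worst_power (alternatives \<P>s \<beta> n \<kappa>) (I1 n) (I2 n) n \<alpha>)) \<longlongrightarrow> 1) at_top \<and>
         ((\<lambda>\<kappa>. limsup (\<lambda>n. worst_power (alternatives \<P>s \<beta> n \<kappa>) (I1 n) (I2 n) n \<alpha>)) \<longlongrightarrow> 1) at_top"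
proof -
  \<comment> \<open>The maximum supplies \<open>1 \<le> K\<close> even for an empty family; if some
    \<open>P\<close> exists, \<open>K_ge_1\<close> shows that it changes nothing.\<close>
  let ?K = "max 1 (moment_bound (real CARD('d)) (4 + \<delta>) C)"
  let ?W = "\<lambda>\<kappa> n. worst_power (alternatives \<P>s \<beta> n \<kappa>) (I1 n) (I2 n) n \<alpha>"
  have law: "linear_law P ?K \<delta> (\<beta> P) (\<gamma> P) c" if P: "P \<in> \<P>s" for P
  proof -
    interpret linear_law P "moment_bound (real CARD('d)) (4 + \<delta>) C" \<delta> "\<beta> P" "\<gamma> P" c
      using distributions[OF P] model[OF P] pos moments[OF P] invertible_ZZ[OF P] nondegenerate[OF P]
      by (intro linear_law_intro) auto
    have "?K = moment_bound (real CARD('d)) (4 + \<delta>) C" using K_ge_1 by simp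
    then show ?thesis using linear_law_axioms by metis
  qed
  have le1: "?W \<kappa> n \<le> 1" for \<kappa> n by (simp add: worst_power_def)
  have lower: "\<exists>\<kappa>0. \<forall>\<kappa>\<ge>\<kappa>0. \<exists>N. \<forall>n\<ge>N. ereal r \<le> ?W \<kappa> n" if r: "r < 1" for r :: real
  proof -
    obtain \<kappa>0 N where *: "\<And>\<kappa> n P. \<kappa>0 \<le> \<kappa> \<Longrightarrow> N \<le> n \<Longrightarrow> P \<in> alternatives \<P>s \<beta> n \<kappa> \<Longrightarrow>
        1 - (1 - r) \<le> \<P>(S in PiM {1..2 * n} (\<lambda>_. P).
          quantile std_normal_distribution (1 - \<alpha>) < T_stat (I1 n) (I2 n) S)"
      using uniform_power[of \<P>s, OF law _ pos(2,3) partition, of "1 - r" "quantile std_normal_distribution (1 - \<alpha>)"] r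
      by fastforce
    have "ereal r \<le> ?W \<kappa> n" if "\<kappa>0 \<le> \<kappa>" "N \<le> n" for \<kappa> n
      unfolding worst_power_def using *[OF that] r
      by (intro min.boundedI INF_greatest) (auto simp: one_ereal_def)
    then show ?thesis by blast
  qed
  \<comment> \<open>\<open>f\<close> stands for the lower or the upper limit in \<open>n\<close>;
    both inherit an eventual lower bound and the upper bound 1.\<close>
  have tends: "(f \<longlongrightarrow> 1) at_top"
    if low: "\<And>r \<kappa> N. \<forall>n\<ge>N. ereal r \<le> ?W \<kappa> n \<Longrightarrow> ereal r \<le> f \<kappa>" and up: "\<And>\<kappa>. f \<kappa> \<le> 1"
    for f :: "real \<Rightarrow> ereal"
  proof (rule order_tendstoI)
    fix a :: ereal assume "a < 1"
    then obtain r where r: "a < ereal r" "ereal r < 1" using ereal_dense2 by blast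
    then obtain \<kappa>0 where "\<forall>\<kappa>\<ge>\<kappa>0. \<exists>N. \<forall>n\<ge>N. ereal r \<le> ?W \<kappa> n"
      using lower[of r] by (auto simp: one_ereal_def)
    then have "\<forall>\<kappa>\<ge>\<kappa>0. a < f \<kappa>" using low r(1) by (meson less_le_trans)
    then show "\<forall>\<^sub>F \<kappa> in at_top. a < f \<kappa>" unfolding eventually_at_top_linorder by blast
  next
    fix a :: ereal assume "1 < a"
    then show "\<forall>\<^sub>F \<kappa> in at_top. f \<kappa> < a" using up by (intro always_eventually allI) (rule le_less_trans)
  qed
  show ?thesis
  proof (intro conjI tends)
    fix r \<kappa> N assume "\<forall>n\<ge>N. ereal r \<le> ?W \<kappa> n"
    then have ev: "\<forall>\<^sub>F n in sequentially. ereal r \<le> ?W \<kappa> n" by (auto simp: eventually_sequentially)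
    then show low: "ereal r \<le> liminf (?W \<kappa>)" by (rule Liminf_bounded)
    then show "ereal r \<le> limsup (?W \<kappa>)"
      using Liminf_le_Limsup[of sequentially "?W \<kappa>"] by (simp add: order_trans)
  next
    fix \<kappa>
    show "limsup (?W \<kappa>) \<le> 1" using le1 by (intro Limsup_bounded) auto
    then show "liminf (?W \<kappa>) \<le> 1"
      using Liminf_le_Limsup[of sequentially "?W \<kappa>"] by (simp add: order_trans)
  qed
qed

end
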